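(* Let $G$ be a Hodge group with complex Lie algebra $\mathfrak{g}_{\mathbb C}=\mathfrak{g}_2(\mathbb{C})$. Assume that $(V,\varphi)$ is a Hodge representation of $G$. Let $\mathtt{T}_\varphi$ be the associated grading element, and assume the normalization $\sigma_i(\mathtt{T}_\varphi)\ge 0$ for $i=1,2$. Then the Hodge representation is principal if and only if $V_{\mathbb C}=\mathbb{C}^7$ and $\mathtt{T}_\varphi=\mathtt{T}^1+\mathtt{T}^2$.
   Context: Hodge representations. Let $V$ be a (finite-dimensional) rational vector space, $w\in\mathbb{Z}$, and $Q:V\times V\to\mathbb{Q}$ a nondegenerate bilinear form with $Q(u,v)=(-1)^wQ(v,u)$. A $Q$-polarized Hodge structure of weight $w$ on $V$ is a nonconstant homomorphism $\phi:S^1\to\mathrm{Aut}(V_{\mathbb R},Q)$ of $\mathbb{R}$-algebraic groups with $\phi(-1)=(-1)^w\mathrm{Id}$ and $Q(v,\phi(\mathbf{i})\overline v)>0$ for all $0\ne v\in V_{\mathbb C}$. Its Hodge decomposition is $V_{\mathbb C}=\bigoplus_{p+q=w}V^{p,q}$, $V^{p,q}=\{v\in V_{\mathbb C}\mid \phi(z)v=z^{p-q}v\ \forall z\in S^1\}$. Let $G$ be a $\mathbb{Q}$-algebraic group, $\pi:G\to\mathrm{Aut}(V,Q)$ a homomorphism of $\mathbb{Q}$-algebraic groups such that $\pi_*:\mathfrak{g}_{\mathbb C}\to\mathrm{End}(V_{\mathbb C},Q)$ is injective, and $\varphi:S^1\to G_{\mathbb R}$ a nonconstant homomorphism of $\mathbb{R}$-algebraic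 groups. Then $(V,Q,\pi,\varphi)$, abbreviated $(V,\varphi)$, is a Hodge representation of $G$ if $\pi\circ\varphi$ is a $Q$-polarized Hodge structure on $V$. A $\mathbb{Q}$-algebraic group admitting a Hodge representation is a Hodge group. Grading element. Given $(V,\varphi)$, the grading element $\mathtt{T}_\varphi\in\mathbf{i}\,\mathfrak{g}_{\mathbb R}$ is the semisimple element (tangent, up to scaling, to $\varphi(S^1)$) that acts on $V^{p,q}$ with eigenvalue $(p-q)/2$. Let $V_\ell\subset V_{\mathbb C}$ be the $\ell$-eigenspace of $\mathtt{T}_\varphi$. Fix a compact maximal torus $T\subset G_{\mathbb R}$ with $\varphi(S^1)\subset T$ and $\dim_{\mathbb R}T=\mathrm{rank}(G_{\mathbb R})$; let $\mathfrak{t}_{\mathbb C}\subset\mathfrak{g}_{\mathbb C}$ be the corresponding Cartan subalgebra, so $\mathtt{T}_\varphi\in\mathfrak{t}_{\mathbb C}$. One chooses a Borel subalgebra containing $\mathfrak{t}_{\mathbb C}$ and contained in the sum of the eigenspaces of $\mathrm{ad}\,\mathtt{T}_\varphi$ with nonnegative eigenvalue; let $\sigma_1,\sigma_2$ be the corresponding simple roots and $\mathtt{T}^1,\mathtt{T}^2\in\mathfrak{t}_{\mathbb C}$ the basis dual to the simple roots, $\sigma_i(\mathtt{T}^j)=\delta_i^j$. Then $\mathtt{T}_\varphi=n_1\mathtt{T}^1+n_2\mathtt{T}^2$ with $n_i=\sigma_i(\mathtt{T}_\varphi)\in\mathbb{Z}_{\ge 0}$ (this nonnegativity is the normalization). Here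 $\mathbb{C}^7$ denotes the 7-dimensional irreducible representation of $\mathfrak{g}_2(\mathbb{C})$, of highest weight $\omega_1=2\sigma_1+\sigma_2$. Principal. Let $m$ be the largest $\mathtt{T}_\varphi$-eigenvalue on $V_{\mathbb C}$, so $V_{\mathbb C}=V_m\oplus V_{m-1}\oplus\cdots\oplus V_{1-m}\oplus V_{-m}$. The Hodge representation is principal if its Hodge numbers are $(1,1,\dots,1)$, i.e. $\dim_{\mathbb C}V_\ell=1$ for $\ell=m,m-1,\dots,-m$. *)

theory Defs
  imports "HOL-Analysis.Analysis"
begin

text \<open>
  Conventions. A finite-dimensional rational vector space is \<open>\<rat>\<^sup>n\<close>, so that \<open>V\<^sub>\<complex>\<close> is the type
  \<^typ>\<open>complex^'n\<close>. A linear algebraic group is identified with its group of complex points inside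
  some \<open>GL\<^sub>N(\<complex>)\<close>; in characteristic zero it is determined by this set of points. The group
  of real points consists of the matrices with real entries.
\<close>

section \<open>Complex matrices\<close>

definition cscale :: "complex \<Rightarrow> complex^'n^'m \<Rightarrow> complex^'n^'m"
  where "cscale c A = (\<chi> i j. c * A $ i $ j)"

global_interpretation cmat: vector_space "cscale :: complex \<Rightarrow> complex^'n^'m \<Rightarrow> complex^'n^'m"
  by standard (simp_all add: cscale_def vec_eq_iff algebra_simps)

definition real_points :: "(complex^'n^'m) set \<Rightarrow> (complex^'n^'m) set"
  where "real_points S = {A \<in> S. \<forall>i j. A $ i $ j \<in> \<real>}"

definition bracket :: "complex^'n^'n \<Rightarrow> complex^'n^'n \<Rightarrow> complex^'n^'n"
  where "bracket X Y = X ** Y - Y ** X"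

definition bilin :: "'a::field^'n^'n \<Rightarrow> 'a^'n \<Rightarrow> 'a^'n \<Rightarrow> 'a"
  where "bilin B u v = (\<Sum>i\<in>UNIV. \<Sum>j\<in>UNIV. u $ i * B $ i $ j * v $ j)"

section \<open>Algebraic groups and their Lie algebras\<close>

text \<open>The coordinate ring \<open>K[x\<^sub>i\<^sub>j, 1/det]\<close> of the general linear group over a subfield \<open>K\<close>.\<close>

inductive regular_fun :: "complex set \<Rightarrow> (complex^'N^'N \<Rightarrow> complex) \<Rightarrow> bool" for K where
  const: "c \<in> K \<Longrightarrow> regular_fun K (\<lambda>g. c)"
| entry: "regular_fun K (\<lambda>g. g $ i $ j)"
| inv_det: "regular_fun K (\<lambda>g. inverse (det g))"
| add: "regular_fun K f \<Longrightarrow> regular_fun K h \<Longrightarrow> regular_fun K (\<lambda>g. f g + h g)"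
| mult: "regular_fun K f \<Longrightarrow> regular_fun K h \<Longrightarrow> regular_fun K (\<lambda>g. f g * h g)"

definition matrix_group :: "(complex^'N^'N) set \<Rightarrow> bool"
  where "matrix_group G \<longleftrightarrow> mat 1 \<in> G \<and> (\<forall>g\<in>G. invertible g \<and> matrix_inv g \<in> G)
    \<and> (\<forall>g\<in>G. \<forall>h\<in>G. g ** h \<in> G)"

definition rational_algebraic_group :: "(complex^'N^'N) set \<Rightarrow> bool"
  where "rational_algebraic_group G \<longleftrightarrow> matrix_group G \<and>
    (\<exists>F. (\<forall>f\<in>F. regular_fun \<rat> f) \<and> G = {g. invertible g \<and> (\<forall>f\<in>F. f g = 0)})"

text \<open>
  The Zariski tangent space at the identity: the directions annihilated by the differentials of
  all regular functions vanishing on \<open>G\<close>. For a real algebraic group given by its set of real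
  points, with these Zariski dense in it, this is the complexification of its Lie algebra.
\<close>

definition lie_algebra :: "(complex^'N^'N) set \<Rightarrow> (complex^'N^'N) set"
  where "lie_algebra G = {X. \<forall>f. regular_fun UNIV f \<and> (\<forall>g\<in>G. f g = 0) \<longrightarrow>
    ((\<lambda>t. f (mat 1 + cscale t X)) has_field_derivative 0) (at 0)}"

text \<open>
  A morphism to a matrix group is given by regular functions on \<open>G\<close>; these extend to the
  ambient general linear group, and a morphism is represented by such an extension. Only its
  values on \<open>G\<close> matter, and so does its differential on the Lie algebra of \<open>G\<close>.
\<close>

definition rational_hom ::
  "(complex^'N^'N) set \<Rightarrow> (complex^'n^'n) set \<Rightarrow> (complex^'N^'N \<Rightarrow> complex^'n^'n) \<Rightarrow> bool"
  where "rational_hom G H \<pi> \<longleftrightarrow> (\<forall>i j. regular_fun \<rat> (\<lambda>g. \<pi> g $ i $ j))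
    \<and> (\<forall>g\<in>G. \<pi> g \<in> H) \<and> (\<forall>g\<in>G. \<forall>h\<in>G. \<pi> (g ** h) = \<pi> g ** \<pi> h)"

definition differential ::
  "(complex^'N^'N \<Rightarrow> complex^'n^'n) \<Rightarrow> complex^'N^'N \<Rightarrow> complex^'n^'n"
  where "differential \<pi> X = (\<chi> i j. deriv (\<lambda>t. \<pi> (mat 1 + cscale t X) $ i $ j) 0)"

text \<open>
  Homomorphisms of real algebraic groups from the circle \<open>x\<^sup>2 + y\<^sup>2 = 1\<close>, whose real points
  are Zariski dense. \<open>H\<close> is a complex group, \<^term>\<open>real_points H\<close> the relevant real form.
\<close>

definition circle_hom :: "(complex^'n^'n) set \<Rightarrow> (complex \<Rightarrow> complex^'n^'n) \<Rightarrow> bool"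
  where "circle_hom H \<psi> \<longleftrightarrow>
    (\<exists>p. polynomial_function p \<and> (\<forall>z\<in>sphere 0 1. \<psi> z = p z))
    \<and> (\<forall>z\<in>sphere 0 1. \<psi> z \<in> real_points H)
    \<and> (\<forall>z\<in>sphere 0 1. \<forall>w\<in>sphere 0 1. \<psi> (z * w) = \<psi> z ** \<psi> w)"

section \<open>Hodge representations\<close>

text \<open>\<open>Q\<close> is the Gram matrix of a rational bilinear form.\<close>

definition Aut_form :: "rat^'n^'n \<Rightarrow> (complex^'n^'n) set"
  where "Aut_form Q = {A. invertible A \<and>
    (\<forall>u v. bilin (map_matrix of_rat Q) (A *v u) (A *v v) = bilin (map_matrix of_rat Q) u v)}"

definition polarization_form :: "int \<Rightarrow> rat^'n^'n \<Rightarrow> bool"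
  where "polarization_form w Q \<longleftrightarrow> (\<forall>u v. bilin Q u v = (- 1) powi w * bilin Q v u)
    \<and> (\<forall>u. u \<noteq> 0 \<longrightarrow> (\<exists>v. bilin Q u v \<noteq> 0))"

definition polarized_hodge_structure ::
  "int \<Rightarrow> rat^'n^'n \<Rightarrow> (complex \<Rightarrow> complex^'n^'n) \<Rightarrow> bool"
  where "polarized_hodge_structure w Q \<psi> \<longleftrightarrow>
    circle_hom (Aut_form Q) \<psi> \<and> \<not> \<psi> constant_on sphere 0 1
    \<and> \<psi> (- 1) = mat ((- 1) powi w)
    \<and> (\<forall>v. v \<noteq> 0 \<longrightarrow>
        (\<exists>r>0. bilin (map_matrix of_rat Q) v (\<psi> \<i> *v (\<chi> i. cnj (v $ i))) = complex_of_real r))"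

definition hodge_space :: "(complex \<Rightarrow> complex^'n^'n) \<Rightarrow> int \<Rightarrow> int \<Rightarrow> (complex^'n) set"
  where "hodge_space \<psi> p q = {v. \<forall>z\<in>sphere 0 1. \<psi> z *v v = (z powi (p - q)) *s v}"

definition hodge_representation ::
  "(complex^'N^'N) set \<Rightarrow> int \<Rightarrow> rat^'n^'n \<Rightarrow> (complex^'N^'N \<Rightarrow> complex^'n^'n)
    \<Rightarrow> (complex \<Rightarrow> complex^'N^'N) \<Rightarrow> bool"
  where "hodge_representation G w Q \<pi> \<phi> \<longleftrightarrow>
    rational_algebraic_group G \<and> polarization_form w Q
    \<and> rational_hom G (Aut_form Q) \<pi> \<and> inj_on (differential \<pi>) (lie_algebra G)
    \<and> circle_hom G \<phi> \<and> \<not> \<phi> constant_on sphere 0 1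
    \<and> polarized_hodge_structure w Q (\<pi> \<circ> \<phi>)"

text \<open>Such an element is unique, since the differential of \<open>\<pi>\<close> is injective, and semisimple.\<close>

definition grading_element ::
  "(complex^'N^'N) set \<Rightarrow> int \<Rightarrow> (complex^'N^'N \<Rightarrow> complex^'n^'n) \<Rightarrow> (complex \<Rightarrow> complex^'N^'N)
    \<Rightarrow> complex^'N^'N \<Rightarrow> bool"
  where "grading_element G w \<pi> \<phi> E \<longleftrightarrow>
    E \<in> cscale \<i> ` real_points (lie_algebra G)
    \<and> (\<forall>p q. p + q = w \<longrightarrow> (\<forall>v\<in>hodge_space (\<pi> \<circ> \<phi>) p q.
          differential \<pi> E *v v = (of_int (p - q) / 2) *s v))"

definition eigenspace :: "complex^'n^'n \<Rightarrow> real \<Rightarrow> (complex^'n) set"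
  where "eigenspace A l = {v. A *v v = complex_of_real l *s v}"

definition principal_hodge_rep ::
  "(complex^'N^'N \<Rightarrow> complex^'n^'n) \<Rightarrow> complex^'N^'N \<Rightarrow> bool"
  where "principal_hodge_rep \<pi> E \<longleftrightarrow> (\<exists>m.
    eigenspace (differential \<pi> E) m \<noteq> {0}
    \<and> (\<forall>l. eigenspace (differential \<pi> E) l \<noteq> {0} \<longrightarrow> l \<le> m)
    \<and> (\<forall>k::nat. real k \<le> 2 * m \<longrightarrow> vec.dim (eigenspace (differential \<pi> E) (m - real k)) = 1))"

section \<open>Cartan and Borel subalgebras, roots\<close>

definition lie_subalgebra :: "(complex^'N^'N) set \<Rightarrow> (complex^'N^'N) set \<Rightarrow> bool"
  where "lie_subalgebra \<gg> \<hh> \<longleftrightarrow> cmat.subspace \<hh> \<and> \<hh> \<subseteq> \<gg> \<and> (\<forall>X\<in>\<hh>. \<forall>Y\<in>\<hh>. bracket X Y \<in> \<hh>)"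

text \<open>
  Toral: abelian and acting diagonalizably on \<open>\<gg>\<close>. In a semisimple Lie algebra the Cartan
  subalgebras are the maximal toral subalgebras, all of the same dimension.
\<close>

definition toral_subalgebra :: "(complex^'N^'N) set \<Rightarrow> (complex^'N^'N) set \<Rightarrow> bool"
  where "toral_subalgebra \<gg> \<hh> \<longleftrightarrow> lie_subalgebra \<gg> \<hh>
    \<and> (\<forall>X\<in>\<hh>. \<forall>Y\<in>\<hh>. bracket X Y = 0)
    \<and> (\<forall>X\<in>\<hh>. \<gg> \<subseteq> cmat.span {Y\<in>\<gg>. \<exists>c. bracket X Y = cscale c Y})"

definition lie_rank :: "(complex^'N^'N) set \<Rightarrow> nat"
  where "lie_rank \<gg> = Max {cmat.dim \<hh> | \<hh>. toral_subalgebra \<gg> \<hh>}"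

definition compact_torus :: "(complex^'N^'N) set \<Rightarrow> bool"
  where "compact_torus T \<longleftrightarrow> matrix_group T \<and> (\<forall>s\<in>T. \<forall>t\<in>T. s ** t = t ** s)
    \<and> compact T \<and> connected T"

text \<open>
  A compact torus of real matrices is real algebraic, so \<^term>\<open>lie_algebra T\<close> is the
  complexified Lie algebra of \<open>T\<close> and its complex dimension is the real dimension of \<open>T\<close>.
\<close>

definition full_rank_compact_torus :: "(complex^'N^'N) set \<Rightarrow> (complex^'N^'N) set \<Rightarrow> bool"
  where "full_rank_compact_torus G T \<longleftrightarrow> compact_torus T \<and> T \<subseteq> real_points G
    \<and> (\<forall>T'. compact_torus T' \<and> T \<subseteq> T' \<and> T' \<subseteq> real_points G \<longrightarrow> T' = T)
    \<and> cmat.dim (lie_algebra T) = lie_rank (lie_algebra G)"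

definition derived_algebra :: "(complex^'N^'N) set \<Rightarrow> (complex^'N^'N) set"
  where "derived_algebra \<hh> = cmat.span {bracket X Y | X Y. X \<in> \<hh> \<and> Y \<in> \<hh>}"

definition solvable_subalgebra :: "(complex^'N^'N) set \<Rightarrow> (complex^'N^'N) set \<Rightarrow> bool"
  where "solvable_subalgebra \<gg> \<hh> \<longleftrightarrow> lie_subalgebra \<gg> \<hh> \<and> (\<exists>k. (derived_algebra ^^ k) \<hh> = {0})"

definition borel_subalgebra :: "(complex^'N^'N) set \<Rightarrow> (complex^'N^'N) set \<Rightarrow> bool"
  where "borel_subalgebra \<gg> \<bb> \<longleftrightarrow> solvable_subalgebra \<gg> \<bb>
    \<and> (\<forall>\<bb>'. solvable_subalgebra \<gg> \<bb>' \<and> \<bb> \<subseteq> \<bb>' \<longrightarrow> \<bb>' = \<bb>)"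

definition nonneg_part :: "(complex^'N^'N) set \<Rightarrow> complex^'N^'N \<Rightarrow> (complex^'N^'N) set"
  where "nonneg_part \<gg> E = cmat.span {X\<in>\<gg>. \<exists>c\<in>\<real>\<^sub>\<ge>\<^sub>0. bracket E X = cscale c X}"

definition root_space ::
  "(complex^'N^'N) set \<Rightarrow> (complex^'N^'N) set \<Rightarrow> (complex^'N^'N \<Rightarrow> complex) \<Rightarrow> (complex^'N^'N) set"
  where "root_space \<gg> \<tt> \<alpha> = {X\<in>\<gg>. \<forall>H\<in>\<tt>. bracket H X = cscale (\<alpha> H) X}"

text \<open>
  A functional on \<open>\<tt>\<close> is represented by its extension by zero to all matrices. Linearity of a
  root on \<open>\<tt>\<close> is automatic because the root space is nonzero.
\<close>

definition roots ::
  "(complex^'N^'N) set \<Rightarrow> (complex^'N^'N) set \<Rightarrow> (complex^'N^'N \<Rightarrow> complex) set"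
  where "roots \<gg> \<tt> = {\<alpha>. (\<forall>H. H \<notin> \<tt> \<longrightarrow> \<alpha> H = 0) \<and> (\<exists>H\<in>\<tt>. \<alpha> H \<noteq> 0) \<and> root_space \<gg> \<tt> \<alpha> \<noteq> {0}}"

definition positive_roots ::
  "(complex^'N^'N) set \<Rightarrow> (complex^'N^'N) set \<Rightarrow> (complex^'N^'N) set \<Rightarrow> (complex^'N^'N \<Rightarrow> complex) set"
  where "positive_roots \<gg> \<tt> \<bb> = {\<alpha> \<in> roots \<gg> \<tt>. root_space \<gg> \<tt> \<alpha> \<subseteq> \<bb>}"

definition simple_roots ::
  "(complex^'N^'N) set \<Rightarrow> (complex^'N^'N) set \<Rightarrow> (complex^'N^'N) set \<Rightarrow> (complex^'N^'N \<Rightarrow> complex) set"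
  where "simple_roots \<gg> \<tt> \<bb> = {\<alpha> \<in> positive_roots \<gg> \<tt> \<bb>.
    \<not> (\<exists>\<beta>\<in>positive_roots \<gg> \<tt> \<bb>. \<exists>\<gamma>\<in>positive_roots \<gg> \<tt> \<bb>. \<alpha> = (\<lambda>H. \<beta> H + \<gamma> H))}"

text \<open>
  \<open>\<sigma>\<^sub>1\<close> is the short and \<open>\<sigma>\<^sub>2\<close> the long simple root, the numbering for which the fundamental
  weight \<open>\<omega>\<^sub>1\<close> is \<open>2 \<sigma>\<^sub>1 + \<sigma>\<^sub>2\<close>; equivalently \<open>3 \<sigma>\<^sub>1 + \<sigma>\<^sub>2\<close>, and not \<open>\<sigma>\<^sub>1 + 3 \<sigma>\<^sub>2\<close>, is a root.
\<close>

definition g2_simple_roots ::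
  "(complex^'N^'N) set \<Rightarrow> (complex^'N^'N) set \<Rightarrow> (complex^'N^'N) set
    \<Rightarrow> (complex^'N^'N \<Rightarrow> complex) \<Rightarrow> (complex^'N^'N \<Rightarrow> complex) \<Rightarrow> bool"
  where "g2_simple_roots \<gg> \<tt> \<bb> \<sigma>1 \<sigma>2 \<longleftrightarrow> simple_roots \<gg> \<tt> \<bb> = {\<sigma>1, \<sigma>2} \<and> \<sigma>1 \<noteq> \<sigma>2
    \<and> (\<lambda>H. 3 * \<sigma>1 H + \<sigma>2 H) \<in> roots \<gg> \<tt>"

section \<open>The exceptional Lie algebra of rank two and its representation of dimension seven\<close>

text \<open>
  The associative 3-form of the complexified imaginary octonions, in the basis (indexed modulo
  7) with multiplication rule \<open>e\<^sub>i e\<^sub>i\<^sub>+\<^sub>1 = e\<^sub>i\<^sub>+\<^sub>3\<close>: the sum over \<open>i\<close> of the coordinate 3-forms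
  \<open>e\<^sup>i \<and> e\<^sup>i\<^sup>+\<^sup>1 \<and> e\<^sup>i\<^sup>+\<^sup>3\<close>. Its stabilizer is the derivation algebra of the octonions.
\<close>

definition octonion_form :: "complex^7 \<Rightarrow> complex^7 \<Rightarrow> complex^7 \<Rightarrow> complex"
  where "octonion_form u v w = (\<Sum>i\<in>UNIV.
    det (vector [vector [u $ i, u $ (i + 1), u $ (i + 3)],
                 vector [v $ i, v $ (i + 1), v $ (i + 3)],
                 vector [w $ i, w $ (i + 1), w $ (i + 3)]] :: complex^3^3))"

definition g2 :: "(complex^7^7) set"
  where "g2 = {A. \<forall>u v w. octonion_form (A *v u) v w + octonion_form u (A *v v) w
    + octonion_form u v (A *v w) = 0}"

definition lie_isomorphic :: "(complex^'N^'N) set \<Rightarrow> (complex^'M^'M) set \<Rightarrow> bool"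
  where "lie_isomorphic \<gg> \<hh> \<longleftrightarrow> (\<exists>f. bij_betw f \<gg> \<hh>
    \<and> (\<forall>X\<in>\<gg>. \<forall>Y\<in>\<gg>. f (X + Y) = f X + f Y)
    \<and> (\<forall>c. \<forall>X\<in>\<gg>. f (cscale c X) = cscale c (f X))
    \<and> (\<forall>X\<in>\<gg>. \<forall>Y\<in>\<gg>. f (bracket X Y) = bracket (f X) (f Y)))"

text \<open>A representation of \<open>\<gg>\<close> is a map \<open>\<rho>\<close> from matrices in \<open>\<gg>\<close> to endomorphisms of \<open>\<complex>\<^sup>n\<close>.\<close>

definition irreducible_rep ::
  "(complex^'N^'N) set \<Rightarrow> (complex^'N^'N \<Rightarrow> complex^'n^'n) \<Rightarrow> bool"
  where "irreducible_rep \<gg> \<rho> \<longleftrightarrow>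
    (\<forall>W. vec.subspace W \<and> (\<forall>X\<in>\<gg>. \<forall>v\<in>W. \<rho> X *v v \<in> W) \<longrightarrow> W = {0} \<or> W = UNIV)"

definition has_highest_weight ::
  "(complex^'N^'N) set \<Rightarrow> (complex^'N^'N) set \<Rightarrow> (complex^'N^'N) set
    \<Rightarrow> (complex^'N^'N \<Rightarrow> complex^'n^'n) \<Rightarrow> (complex^'N^'N \<Rightarrow> complex) \<Rightarrow> bool"
  where "has_highest_weight \<gg> \<tt> \<bb> \<rho> \<mu> \<longleftrightarrow> (\<exists>v. v \<noteq> 0 \<and> (\<forall>H\<in>\<tt>. \<rho> H *v v = \<mu> H *s v)
    \<and> (\<forall>\<alpha>\<in>positive_roots \<gg> \<tt> \<bb>. \<forall>X\<in>root_space \<gg> \<tt> \<alpha>. \<rho> X *v v = 0))"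

text \<open>\<open>V\<^sub>\<complex> = \<complex>\<^sup>7\<close>, the irreducible representation of dimension 7 and highest weight \<open>\<omega>\<^sub>1\<close>.\<close>

definition is_standard_rep ::
  "(complex^'N^'N) set \<Rightarrow> (complex^'N^'N) set \<Rightarrow> (complex^'N^'N) set
    \<Rightarrow> (complex^'N^'N \<Rightarrow> complex) \<Rightarrow> (complex^'N^'N \<Rightarrow> complex)
    \<Rightarrow> (complex^'N^'N \<Rightarrow> complex^'n^'n) \<Rightarrow> bool"
  where "is_standard_rep \<gg> \<tt> \<bb> \<sigma>1 \<sigma>2 \<rho> \<longleftrightarrow> CARD('n) = 7 \<and> irreducible_rep \<gg> \<rho>
    \<and> has_highest_weight \<gg> \<tt> \<bb> \<rho> (\<lambda>H. 2 * \<sigma>1 H + \<sigma>2 H)"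

definition dual_basis ::
  "(complex^'N^'N) set \<Rightarrow> (complex^'N^'N \<Rightarrow> complex) \<Rightarrow> (complex^'N^'N \<Rightarrow> complex)
    \<Rightarrow> complex^'N^'N \<Rightarrow> complex^'N^'N \<Rightarrow> bool"
  where "dual_basis \<tt> \<sigma>1 \<sigma>2 T1 T2 \<longleftrightarrow> T1 \<in> \<tt> \<and> T2 \<in> \<tt>
    \<and> \<sigma>1 T1 = 1 \<and> \<sigma>1 T2 = 0 \<and> \<sigma>2 T1 = 0 \<and> \<sigma>2 T2 = 1"

end

theory Submission
  imports Defs "HOL-Computational_Algebra.Fundamental_Theorem_Algebra"
begin

text \<open>
  With \<open>c = \<phi>(\<i>)\<close>, the polarization turns \<open>Q(u, c \<cdot> cnj v)\<close> into a positive definite Hermitian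
  form on \<open>V\<^sub>\<complex>\<close>, for which the adjoint of \<open>X \<in> \<gg>\<close> is \<open>- cnj (c\<inverse> X c) \<in> \<gg>\<close>. So \<open>\<gg>\<close> is a
  self-adjoint Lie algebra of matrices: commuting self-adjoint subspaces are diagonalizable, a toral
  subalgebra of maximal dimension is its own centralizer, every root gives an \<open>\<ss>\<ll>\<^sub>2\<close>-triple, and
  submodules have complements. Since \<open>3 \<sigma>\<^sub>1 + \<sigma>\<^sub>2\<close> is a root, the strict Cauchy-Schwarz inequality for
  coroots forces the Cartan integers of \<open>G\<^sub>2\<close>.

  If \<open>V\<close> is standard and \<open>T\<^sub>\<phi> = T\<^sup>1 + T\<^sup>2\<close>, root strings lead from the highest weight to eigenvectors
  of \<open>T\<^sub>\<phi>\<close> for the eigenvalues \<open>3, \<dots>, -3\<close>. Conversely, if the spectrum of \<open>T\<^sub>\<phi>\<close> is simple, then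
  \<open>\<tt>\<close> is the centralizer of \<open>T\<^sub>\<phi>\<close>, and \<open>\<bb>\<close> is the sum of all nonnegative eigenspaces of
  \<open>ad T\<^sub>\<phi>\<close>. Every submodule contains the weight \<open>0\<close>, which has multiplicity one, so \<open>V\<close> is irreducible.
  All weights are obtained from the highest weight \<open>p \<omega>\<^sub>1 + q \<omega>\<^sub>2\<close> by subtracting simple roots, and
  they are separated by their values on \<open>T\<^sub>\<phi>\<close>, which are consecutive integers. Following a few root
  strings one finds two weights with the same value unless \<open>p = 1\<close>, \<open>q = 0\<close> and \<open>T\<^sub>\<phi> = T\<^sup>1 + T\<^sup>2\<close>.
\<close>

text \<open>The polarization supplies an adjoint inside \<gg>. This lets the positive form
  \<open>trace (\<rho> (star Y) ** \<rho> X)\<close> do the work of the Killing form, and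
  orthogonality that of complete reducibility. From the isomorphism with \<open>g2\<close> comes the
  triviality of the centre, which makes the roots separate the elements of \<tt>. The type of the
  root system is read off from the root 3 \<sigma>1 + \<sigma>2.

  A grading element with simple spectrum is regular, because matrices that preserve each of its
  eigenlines commute with each other. Hence \<sigma>1 and \<sigma>2 take values at least 1 on it,
  and inductions over roots can run on these values. That the weight 0 occurs in every submodule
  rests on the Cartan determinant of G2 being 1: the root lattice is the whole weight lattice, so
  one can descend from any dominant weight to 0.\<close>

lemma cscale_nth [simp]: "cscale c A $ i $ j = c * A $ i $ j"
  by (simp add: cscale_def)

lemma matrix_eqI: "(\<And>i j. A $ i $ j = B $ i $ j) \<Longrightarrow> A = B"
  by (simp add: vec_eq_iff)

lemma cscale_mult_left: "cscale c A ** B = cscale c (A ** B)"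
  by (rule matrix_eqI) (simp add: matrix_matrix_mult_def sum_distrib_left mult.assoc)

lemma cscale_mult_right: "A ** cscale c B = cscale c (A ** B)"
  by (rule matrix_eqI) (simp add: matrix_matrix_mult_def sum_distrib_left algebra_simps)

lemma cscale_vector: "cscale c A *v v = c *s (A *v v)"
  by (simp add: vec_eq_iff matrix_vector_mult_def sum_distrib_left mult.assoc)

lemma matrix_minus_left: "(- A :: complex^'n^'m) ** B = - (A ** B)"
  by (rule matrix_eqI) (simp add: matrix_matrix_mult_def sum_negf)

lemma matrix_minus_right: "(A :: complex^'n^'m) ** (- B) = - (A ** B)"
  by (rule matrix_eqI) (simp add: matrix_matrix_mult_def sum_negf)

lemma matrix_diff_left: "(A - A' :: complex^'n^'m) ** B = A ** B - A' ** B"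
  by (rule matrix_eqI) (simp add: matrix_matrix_mult_def sum_subtractf algebra_simps)

lemma matrix_diff_right: "(A :: complex^'n^'m) ** (B - B') = A ** B - A ** B'"
  by (rule matrix_eqI) (simp add: matrix_matrix_mult_def sum_subtractf algebra_simps)

lemma matrix_add_left: "(A + A' :: complex^'n^'m) ** B = A ** B + A' ** B"
  by (rule matrix_eqI) (simp add: matrix_matrix_mult_def sum.distrib algebra_simps)

lemma matrix_add_right: "(A :: complex^'n^'m) ** (B + B') = A ** B + A ** B'"
  by (rule matrix_eqI) (simp add: matrix_matrix_mult_def sum.distrib algebra_simps)

lemma matrix_inv_cancel:
  assumes "invertible A"
  shows "A ** matrix_inv A = mat 1" "matrix_inv A ** A = mat 1"
  using someI_ex [OF assms [unfolded invertible_def]] by (auto simp: matrix_inv_def)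

lemma bracket_add_left: "bracket (X + Y) Z = bracket X Z + bracket Y Z"
  by (simp add: bracket_def matrix_add_left matrix_add_right)

lemma bracket_add_right: "bracket X (Y + Z) = bracket X Y + bracket X Z"
  by (simp add: bracket_def matrix_add_left matrix_add_right)

lemma bracket_cscale_left: "bracket (cscale c X) Y = cscale c (bracket X Y)"
  by (simp add: bracket_def cscale_mult_left cscale_mult_right cmat.scale_right_diff_distrib)

lemma bracket_cscale_right: "bracket X (cscale c Y) = cscale c (bracket X Y)"
  by (simp add: bracket_def cscale_mult_left cscale_mult_right cmat.scale_right_diff_distrib)

lemma bracket_swap: "bracket X Y = - bracket Y X"
  by (simp add: bracket_def)

lemma bracket_self [simp]: "bracket X X = 0"
  by (simp add: bracket_def)

lemma bracket_zero [simp]: "bracket 0 X = 0" "bracket X 0 = 0"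
  by (simp_all add: bracket_def matrix_matrix_mult_def vec_eq_iff)

lemma bracket_jacobi: "bracket X (bracket Y Z) = bracket (bracket X Y) Z + bracket Y (bracket X Z)"
  by (simp add: bracket_def matrix_diff_left matrix_diff_right matrix_mul_assoc)

section \<open>Derivatives of regular functions at the identity\<close>

text \<open>Complex differentiability at the identity, stated as the chain rule along every complex
  curve through it. One matrix \<open>d\<close> serves all curves; this yields linearity in the
  direction and the freedom to replace a line by any curve with the same tangent.\<close>

definition gradient_at_one :: "(complex^'N^'N \<Rightarrow> complex) \<Rightarrow> complex^'N^'N \<Rightarrow> bool"
  where "gradient_at_one f d \<longleftrightarrow> (\<forall>\<gamma> X. \<gamma> 0 = mat 1 \<and>
    (\<forall>i j. ((\<lambda>t::complex. \<gamma> t $ i $ j) has_field_derivative X $ i $ j) (at 0)) \<longrightarrow>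
    ((\<lambda>t. f (\<gamma> t)) has_field_derivative (\<Sum>i\<in>UNIV. \<Sum>j\<in>UNIV. d $ i $ j * X $ i $ j)) (at 0))"

definition mat_deriv :: "(complex \<Rightarrow> complex^'n^'m) \<Rightarrow> complex^'n^'m \<Rightarrow> bool"
  where "mat_deriv \<gamma> X \<longleftrightarrow>
    (\<forall>i j. ((\<lambda>t. \<gamma> t $ i $ j) has_field_derivative X $ i $ j) (at 0))"

lemma gradient_at_one_const: "gradient_at_one (\<lambda>g. c) 0"
  by (simp add: gradient_at_one_def)

lemma gradient_at_one_entry:
  fixes a b :: "'N::finite"
  shows "gradient_at_one (\<lambda>g. g $ a $ b) (\<chi> i j. if i = a \<and> j = b then 1 else 0)"
proof -
  have "(\<Sum>i\<in>UNIV. \<Sum>j\<in>UNIV. (if i = a \<and> j = b then 1 else 0) * X $ i $ j) = X $ a $ b"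
    for X :: "complex^'N^'N"
  proof -
    have "(\<Sum>i\<in>UNIV. \<Sum>j\<in>UNIV. (if i = a \<and> j = b then 1 else 0) * X $ i $ j)
      = (\<Sum>i\<in>UNIV. if i = a then X $ a $ b else 0)"
      by (rule sum.cong) (auto simp: if_distrib [of "\<lambda>x. x * _"] cong: if_cong)
    then show ?thesis by simp
  qed
  then show ?thesis by (simp add: gradient_at_one_def)
qed

lemma gradient_at_one_add:
  assumes "gradient_at_one f d" "gradient_at_one h e"
  shows "gradient_at_one (\<lambda>g. f g + h g) (d + e)"
  unfolding gradient_at_one_def
proof (intro allI impI, goal_cases)
  case (1 \<gamma> X)
  then have "((\<lambda>t. f (\<gamma> t) + h (\<gamma> t)) has_field_derivative
    (\<Sum>i\<in>UNIV. \<Sum>j\<in>UNIV. d $ i $ j * X $ i $ j) + (\<Sum>i\<in>UNIV. \<Sum>j\<in>UNIV. e $ i $ j * X $ i $ j)) (at 0)"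
    using assms by (intro DERIV_add) (auto simp: gradient_at_one_def)
  then show ?case by (simp add: algebra_simps sum.distrib)
qed

lemma gradient_at_one_mult:
  assumes "gradient_at_one f d" "gradient_at_one h e"
  shows "gradient_at_one (\<lambda>g. f g * h g) (cscale (h (mat 1)) d + cscale (f (mat 1)) e)"
  unfolding gradient_at_one_def
proof (intro allI impI, goal_cases)
  case (1 \<gamma> X)
  then have "((\<lambda>t. f (\<gamma> t) * h (\<gamma> t)) has_field_derivative
    (\<Sum>i\<in>UNIV. \<Sum>j\<in>UNIV. d $ i $ j * X $ i $ j) * h (\<gamma> 0)
      + (\<Sum>i\<in>UNIV. \<Sum>j\<in>UNIV. e $ i $ j * X $ i $ j) * f (\<gamma> 0)) (at 0)"
    using assms by (intro DERIV_mult) (auto simp: gradient_at_one_def)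
  with 1 show ?case by (simp add: algebra_simps sum.distrib sum_distrib_left)
qed

lemma gradient_at_one_sum:
  assumes "\<And>x. x \<in> S \<Longrightarrow> \<exists>d. gradient_at_one (f x) d"
  shows "\<exists>d. gradient_at_one (\<lambda>g. \<Sum>x\<in>S. f x g) d"
  using assms
proof (induction S rule: infinite_finite_induct)
  case (insert x S)
  then obtain d e where "gradient_at_one (f x) d" "gradient_at_one (\<lambda>g. \<Sum>x\<in>S. f x g) e"
    by (meson insertCI)
  from gradient_at_one_add [OF this] show ?case using insert.hyps by auto
qed (auto intro!: exI [of _ 0] gradient_at_one_const)

lemma gradient_at_one_prod:
  assumes "\<And>x. x \<in> S \<Longrightarrow> \<exists>d. gradient_at_one (f x) d"
  shows "\<exists>d. gradient_at_one (\<lambda>g. \<Prod>x\<in>S. f x g) d"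
  using assms
proof (induction S rule: infinite_finite_induct)
  case (insert x S)
  then obtain d e where "gradient_at_one (f x) d" "gradient_at_one (\<lambda>g. \<Prod>x\<in>S. f x g) e"
    by (meson insertCI)
  from gradient_at_one_mult [OF this] show ?case using insert.hyps by auto
qed (auto intro!: exI [of _ 0] gradient_at_one_const)

lemma gradient_at_one_det: "\<exists>d. gradient_at_one (det :: complex^'N^'N \<Rightarrow> complex) d"
  unfolding det_def [abs_def]
proof (rule gradient_at_one_sum)
  fix p :: "'N \<Rightarrow> 'N"
  obtain d where "gradient_at_one (\<lambda>g :: complex^'N^'N. \<Prod>i\<in>UNIV. g $ i $ p i) d"
    using gradient_at_one_prod [of UNIV "\<lambda>i g. g $ i $ p i"] gradient_at_one_entry by blast
  from gradient_at_one_mult [OF gradient_at_one_const this]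
  show "\<exists>d. gradient_at_one (\<lambda>g :: complex^'N^'N. of_int (sign p) * (\<Prod>i\<in>UNIV. g $ i $ p i)) d"
    by blast
qed

lemma gradient_at_one_inverse:
  assumes "gradient_at_one f d" "f (mat 1) \<noteq> 0"
  shows "gradient_at_one (\<lambda>g. inverse (f g)) (cscale (- inverse (f (mat 1) ^ 2)) d)"
  unfolding gradient_at_one_def
proof (intro allI impI, goal_cases)
  case (1 \<gamma> X)
  with assms have "((\<lambda>t. inverse (f (\<gamma> t))) has_field_derivative
    - ((\<Sum>i\<in>UNIV. \<Sum>j\<in>UNIV. d $ i $ j * X $ i $ j) * inverse (f (\<gamma> 0) ^ Suc (Suc 0)))) (at 0)"
    by (intro DERIV_inverse_fun) (auto simp: gradient_at_one_def)
  moreover have "(\<Sum>i\<in>UNIV. \<Sum>j\<in>UNIV. cscale (- inverse (f (mat 1) ^ 2)) d $ i $ j * X $ i $ j)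
    = - inverse (f (mat 1) ^ 2) * (\<Sum>i\<in>UNIV. \<Sum>j\<in>UNIV. d $ i $ j * X $ i $ j)"
    unfolding sum_distrib_left by (simp add: algebra_simps)
  ultimately show ?case using 1 by (simp add: power2_eq_square algebra_simps)
qed

lemma regular_fun_gradient:
  fixes f :: "complex^'N^'N \<Rightarrow> complex"
  assumes "regular_fun K f"
  shows "\<exists>d. gradient_at_one f d"
  using assms
proof induction
  case inv_det
  obtain d where "gradient_at_one (det :: complex^'N^'N \<Rightarrow> complex) d"
    using gradient_at_one_det by blast
  from gradient_at_one_inverse [OF this] show ?case by auto
qed (blast intro: gradient_at_one_const gradient_at_one_entry gradient_at_one_add gradient_at_one_mult)+

definition dir_deriv :: "(complex^'N^'N \<Rightarrow> complex) \<Rightarrow> complex^'N^'N \<Rightarrow> complex"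
  where "dir_deriv f X = deriv (\<lambda>t. f (mat 1 + cscale t X)) 0"

lemma mat_deriv_line: "mat_deriv (\<lambda>t. A + cscale t X) X"
  unfolding mat_deriv_def by (auto intro!: derivative_eq_intros)

lemma dir_deriv_gradient:
  assumes "gradient_at_one f d"
  shows "dir_deriv f X = (\<Sum>i\<in>UNIV. \<Sum>j\<in>UNIV. d $ i $ j * X $ i $ j)"
proof -
  have "((\<lambda>t. f (mat 1 + cscale t X)) has_field_derivative
      (\<Sum>i\<in>UNIV. \<Sum>j\<in>UNIV. d $ i $ j * X $ i $ j)) (at 0)"
    using assms [unfolded gradient_at_one_def, rule_format, of "\<lambda>t. mat 1 + cscale t X" X]
      mat_deriv_line [of "mat 1" X] by (simp add: mat_deriv_def)
  then show ?thesis unfolding dir_deriv_def by (rule DERIV_imp_deriv)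
qed

text \<open>Only the tangent matters, so conjugates of a line or entire curves extending a circle
  homomorphism may be used where \<open>lie_algebra\<close> speaks of straight lines.\<close>

lemma dir_deriv_curve:
  assumes "regular_fun K f" "\<gamma> 0 = mat 1" "mat_deriv \<gamma> X"
  shows "((\<lambda>t. f (\<gamma> t)) has_field_derivative dir_deriv f X) (at 0)"
proof -
  obtain d where d: "gradient_at_one f d" using regular_fun_gradient [OF assms(1)] ..
  show ?thesis
    using d [unfolded gradient_at_one_def, rule_format, of \<gamma> X] assms(2,3)
    by (simp add: mat_deriv_def dir_deriv_gradient [OF d])
qed

lemma dir_deriv_line:
  assumes "regular_fun K f"
  shows "((\<lambda>t. f (mat 1 + cscale t X)) has_field_derivative dir_deriv f X) (at 0)"
  by (rule dir_deriv_curve [OF assms _ mat_deriv_line]) simp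

lemma dir_deriv_add:
  assumes "regular_fun K f"
  shows "dir_deriv f (X + Y) = dir_deriv f X + dir_deriv f Y"
proof -
  obtain d where "gradient_at_one f d" using regular_fun_gradient [OF assms] ..
  then show ?thesis by (simp add: dir_deriv_gradient sum.distrib algebra_simps)
qed

lemma dir_deriv_cscale:
  assumes "regular_fun K f"
  shows "dir_deriv f (cscale c X) = c * dir_deriv f X"
proof -
  obtain d where "gradient_at_one f d" using regular_fun_gradient [OF assms] ..
  then show ?thesis by (simp add: dir_deriv_gradient sum_distrib_left algebra_simps)
qed

text \<open>Regular functions are differentiable at the identity, so the condition that the
  derivative exists and is 0 reduces to the vanishing of \<open>dir_deriv\<close>.\<close>

lemma lie_algebra_iff:
  "X \<in> lie_algebra G \<longleftrightarrow>
    (\<forall>f. regular_fun UNIV f \<and> (\<forall>g\<in>G. f g = 0) \<longrightarrow> dir_deriv f X = 0)"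
proof -
  have "((\<lambda>t. f (mat 1 + cscale t X)) has_field_derivative 0) (at 0) \<longleftrightarrow> dir_deriv f X = 0"
    if "regular_fun UNIV f" for f
    using DERIV_unique [OF dir_deriv_line [OF that, of X], of 0] dir_deriv_line [OF that, of X] by auto
  then show ?thesis unfolding lie_algebra_def by blast
qed

lemma lie_algebra_dir_deriv:
  "\<lbrakk>X \<in> lie_algebra G; regular_fun UNIV f; \<And>g. g \<in> G \<Longrightarrow> f g = 0\<rbrakk> \<Longrightarrow> dir_deriv f X = 0"
  by (simp add: lie_algebra_iff)

lemma lie_algebra_subspace: "cmat.subspace (lie_algebra G)"
  unfolding cmat.subspace_def
proof (intro conjI ballI allI)
  show "0 \<in> lie_algebra G"
    unfolding lie_algebra_iff
  proof (intro allI impI)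
    fix f assume "regular_fun UNIV f \<and> (\<forall>g\<in>G. f g = 0)"
    then show "dir_deriv f 0 = 0" using dir_deriv_cscale [of UNIV f 0 0] by simp
  qed
next
  fix X Y assume "X \<in> lie_algebra G" "Y \<in> lie_algebra G"
  then show "X + Y \<in> lie_algebra G"
    unfolding lie_algebra_iff by (metis dir_deriv_add add_0)
next
  fix c X assume "X \<in> lie_algebra G"
  then show "cscale c X \<in> lie_algebra G"
    unfolding lie_algebra_iff by (metis dir_deriv_cscale mult_zero_right)
qed

lemma lie_algebra_mono: "T \<subseteq> G \<Longrightarrow> lie_algebra T \<subseteq> lie_algebra G"
  by (meson lie_algebra_iff subset_eq)

section \<open>Closure properties of regular functions\<close>

lemma regular_fun_UNIV_mono: "regular_fun K f \<Longrightarrow> regular_fun UNIV f"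
  by (induction rule: regular_fun.induct) (auto intro: regular_fun.intros)

lemma regular_fun_diff:
  assumes "regular_fun UNIV f" "regular_fun UNIV h"
  shows "regular_fun UNIV (\<lambda>g. f g - h g)"
  using regular_fun.add [OF assms(1) regular_fun.mult [OF regular_fun.const assms(2), of "-1"]]
  by simp

lemma regular_fun_sum:
  "(\<And>x. x \<in> S \<Longrightarrow> regular_fun UNIV (f x)) \<Longrightarrow> regular_fun UNIV (\<lambda>g. \<Sum>x\<in>S. f x g)"
  by (induction S rule: infinite_finite_induct) (auto intro: regular_fun.intros)

lemma regular_fun_prod:
  "(\<And>x. x \<in> S \<Longrightarrow> regular_fun UNIV (f x)) \<Longrightarrow> regular_fun UNIV (\<lambda>g. \<Prod>x\<in>S. f x g)"
  by (induction S rule: infinite_finite_induct) (auto intro: regular_fun.intros)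

lemma regular_fun_det:
  "(\<And>i j. regular_fun UNIV (\<lambda>g. M g $ i $ j)) \<Longrightarrow> regular_fun UNIV (\<lambda>g. det (M g))"
  unfolding det_def by (intro regular_fun_sum regular_fun.mult regular_fun_prod regular_fun.const UNIV_I)

lemma regular_fun_matrix_mult:
  assumes "\<And>i j. regular_fun UNIV (\<lambda>g. M g $ i $ j)" "\<And>i j. regular_fun UNIV (\<lambda>g. N g $ i $ j)"
  shows "regular_fun UNIV (\<lambda>g. (M g ** N g) $ i $ j)"
  unfolding matrix_matrix_mult_def by (simp, intro regular_fun_sum regular_fun.mult assms)

lemma regular_fun_matrix_const: "regular_fun UNIV (\<lambda>g. A $ i $ j)"
  by (simp add: regular_fun.const)

lemma regular_fun_translate:
  fixes a b :: "complex^'N^'N"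
  assumes "regular_fun UNIV f"
  shows "regular_fun UNIV (\<lambda>g. f (a ** g ** b))"
  using assms
proof induction
  case (entry i j)
  show ?case
    by (intro regular_fun_matrix_mult regular_fun_matrix_const regular_fun.entry)
next
  \<comment> \<open>The determinant of the product splits off the constant det a det b; the
    convention that the inverse of 0 is 0 covers singular a and b.\<close>
  case inv_det
  show ?case
    using regular_fun.mult [OF regular_fun.const regular_fun.inv_det, of "inverse (det a * det b)" UNIV]
    by (simp add: det_mul algebra_simps)
qed (auto intro: regular_fun.intros)

text \<open>
  Cramer's rule, read as a regular function on all matrices; it is the inverse only where the
  determinant does not vanish.
\<close>

definition regular_inv :: "complex^'N^'N \<Rightarrow> complex^'N^'N"
  where "regular_inv g =
    (\<chi> k l. det (\<chi> i j. if j = k then axis l 1 $ i else g $ i $ j) * inverse (det g))"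

lemma regular_fun_regular_inv: "regular_fun UNIV (\<lambda>g. regular_inv g $ i $ j)"
  unfolding regular_inv_def
proof (simp, intro regular_fun.mult regular_fun_det regular_fun.inv_det)
  fix a b
  show "regular_fun UNIV (\<lambda>g. (\<chi> a b. if b = i then axis j 1 $ a else g $ a $ b) $ a $ b)"
    by (cases "b = i") (simp_all add: regular_fun.const regular_fun.entry)
qed

lemma regular_inv_right:
  assumes "det g \<noteq> 0"
  shows "g ** regular_inv g = mat 1"
proof (rule matrix_eqI)
  fix i l
  have "g *v (\<chi> k. regular_inv g $ k $ l) = axis l 1"
    unfolding cramer [OF assms] by (simp add: regular_inv_def divide_inverse)
  then have "(\<Sum>k\<in>UNIV. g $ i $ k * regular_inv g $ k $ l) = axis l 1 $ i"
    by (simp add: vec_eq_iff matrix_vector_mult_def)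
  then show "(g ** regular_inv g) $ i $ l = mat 1 $ i $ l"
    by (simp add: matrix_matrix_mult_def mat_def axis_def)
qed

lemma regular_inv_left: "det g \<noteq> 0 \<Longrightarrow> regular_inv g ** g = mat 1"
  using regular_inv_right matrix_left_right_inverse by blast

lemma regular_inv_eq:
  assumes "invertible g"
  shows "regular_inv g = matrix_inv g"
proof -
  have "regular_inv g = matrix_inv g ** g ** regular_inv g"
    by (simp add: matrix_inv_cancel(2) assms)
  also have "\<dots> = matrix_inv g"
    using assms unfolding matrix_mul_assoc [symmetric]
    by (simp add: regular_inv_right invertible_det_nz [symmetric])
  finally show ?thesis .
qed

section \<open>The Lie algebra of a matrix group\<close>

lemma mat_deriv_mult:
  assumes "mat_deriv \<gamma> X" "mat_deriv \<delta> Y"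
  shows "mat_deriv (\<lambda>t. \<gamma> t ** \<delta> t) (X ** \<delta> 0 + \<gamma> 0 ** Y)"
  unfolding mat_deriv_def
proof (intro allI)
  fix i j
  have "((\<lambda>t. \<Sum>k\<in>UNIV. \<gamma> t $ i $ k * \<delta> t $ k $ j) has_field_derivative
    (\<Sum>k\<in>UNIV. X $ i $ k * \<delta> 0 $ k $ j + Y $ k $ j * \<gamma> 0 $ i $ k)) (at 0)"
    using assms unfolding mat_deriv_def by (intro DERIV_sum DERIV_mult) auto
  then show "((\<lambda>t. (\<gamma> t ** \<delta> t) $ i $ j) has_field_derivative (X ** \<delta> 0 + \<gamma> 0 ** Y) $ i $ j) (at 0)"
    by (simp add: matrix_matrix_mult_def sum.distrib mult.commute)
qed

lemma mat_deriv_const: "mat_deriv (\<lambda>t. A) 0"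
  by (simp add: mat_deriv_def)

lemma mat_deriv_unique: "mat_deriv \<gamma> X \<Longrightarrow> mat_deriv \<gamma> Y \<Longrightarrow> X = Y"
  unfolding mat_deriv_def by (intro matrix_eqI) (metis DERIV_unique)

lemma mat_deriv_regular_fun:
  assumes "\<And>i j. regular_fun K (\<lambda>g. \<pi> g $ i $ j)" "\<gamma> 0 = mat 1" "mat_deriv \<gamma> X"
  shows "mat_deriv (\<lambda>t. \<pi> (\<gamma> t)) (differential \<pi> X)"
  unfolding mat_deriv_def differential_def
  using dir_deriv_curve [OF assms(1) assms(2,3)] by (simp add: dir_deriv_def)

lemma differential_nth: "differential \<pi> X $ i $ j = dir_deriv (\<lambda>g. \<pi> g $ i $ j) X"
  by (simp add: differential_def dir_deriv_def)

text \<open>Differentiates the product of \<open>regular_inv (\<gamma> t)\<close> with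
  \<open>\<gamma> t\<close>, which is constantly 1 near 0. That the first factor is differentiable
  at all comes from its entries being regular functions.\<close>

lemma mat_deriv_regular_inv:
  assumes "\<gamma> 0 = mat 1" "mat_deriv \<gamma> X"
  shows "mat_deriv (\<lambda>t. regular_inv (\<gamma> t)) (- X)"
proof -
  let ?Y = "differential regular_inv X"
  have Y: "mat_deriv (\<lambda>t. regular_inv (\<gamma> t)) ?Y"
    by (rule mat_deriv_regular_fun [OF regular_fun_regular_inv assms])
  have one: "regular_inv (mat 1 :: complex^'a^'a) = mat 1"
    using regular_inv_left [of "mat 1 :: complex^'a^'a"] by simp
  have "mat_deriv (\<lambda>t. regular_inv (\<gamma> t) ** \<gamma> t) (?Y + X)"
    using mat_deriv_mult [OF Y assms(2)] by (simp add: assms(1) one)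
  moreover have "mat_deriv (\<lambda>t. regular_inv (\<gamma> t) ** \<gamma> t) 0"
    unfolding mat_deriv_def
  proof (intro allI)
    fix i j
    obtain d where "gradient_at_one (det :: complex^'a^'a \<Rightarrow> complex) d"
      using gradient_at_one_det by blast
    \<comment> \<open>The product is 1 only where the determinant does not vanish; continuity along
      the curve provides a neighbourhood of 0 where this holds.\<close>
    then have "isCont (\<lambda>t. det (\<gamma> t)) 0"
      using assms unfolding gradient_at_one_def mat_deriv_def by (blast intro: DERIV_isCont)
    then have "((\<lambda>t. det (\<gamma> t)) \<longlongrightarrow> 1) (nhds 0)"
      using assms(1) by (simp add: isCont_def tendsto_nhds_iff)
    then have "eventually (\<lambda>t. det (\<gamma> t) \<noteq> 0) (nhds 0)"
      by (rule tendsto_imp_eventually_ne) simp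
    then have "eventually (\<lambda>t. (regular_inv (\<gamma> t) ** \<gamma> t) $ i $ j = (mat 1 :: complex^'a^'a) $ i $ j) (nhds 0)"
      by eventually_elim (simp add: regular_inv_left)
    then show "((\<lambda>t. (regular_inv (\<gamma> t) ** \<gamma> t) $ i $ j) has_field_derivative 0 $ i $ j) (at 0)"
      using DERIV_cong_ev [OF refl _ refl] by fastforce
  qed
  ultimately have "?Y + X = 0" using mat_deriv_unique by blast
  then have "?Y = - X" by (simp add: eq_neg_iff_add_eq_0)
  with Y show ?thesis by simp
qed

lemma mat_deriv_conj:
  "mat_deriv (\<lambda>t. A ** (mat 1 + cscale t X) ** B) (A ** X ** B)"
  using mat_deriv_mult [OF mat_deriv_mult [OF mat_deriv_const mat_deriv_line] mat_deriv_const, of A "mat 1" X B]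
  by simp

lemma dir_deriv_mult_entries:
  assumes "\<And>i j. regular_fun UNIV (\<lambda>g. M g $ i $ j)" and "mat_deriv (\<lambda>t. M (mat 1 + cscale t X)) Z"
  shows "dir_deriv (\<lambda>g. M g $ i $ j) X = Z $ i $ j"
  using DERIV_unique [OF dir_deriv_line [OF assms(1)] assms(2) [unfolded mat_deriv_def, rule_format]] .

text \<open>Identities between regular matrix functions that hold on \<open>G\<close> may be
  differentiated at the identity. Commutation and the compatibility of \<open>differential\<close>
  with conjugation and brackets are obtained this way.\<close>

lemma lie_algebra_matrix_eq:
  assumes "X \<in> lie_algebra G" "\<And>i j. regular_fun UNIV (\<lambda>g. M g $ i $ j)"
    and "\<And>g. g \<in> G \<Longrightarrow> M g = 0" and "mat_deriv (\<lambda>t. M (mat 1 + cscale t X)) Z"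
  shows "Z = 0"
  using lie_algebra_dir_deriv [OF assms(1,2)] dir_deriv_mult_entries [OF assms(2,4)] assms(3)
  by (intro matrix_eqI) simp

locale mat_group =
  fixes G :: "(complex^'N^'N) set"
  assumes group: "matrix_group G"
begin

lemma one: "mat 1 \<in> G"
  and mult: "g \<in> G \<Longrightarrow> h \<in> G \<Longrightarrow> g ** h \<in> G"
  and invertible: "g \<in> G \<Longrightarrow> invertible g"
  and inv: "g \<in> G \<Longrightarrow> matrix_inv g \<in> G"
  using group by (auto simp: matrix_group_def)

text \<open>Conjugation by \<open>g\<close> maps \<open>G\<close> to itself, so a function vanishing
  on \<open>G\<close> still does so after its argument is conjugated.\<close>

lemma Ad_closed:
  assumes "g \<in> G" "X \<in> lie_algebra G"
  shows "g ** X ** matrix_inv g \<in> lie_algebra G"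
  unfolding lie_algebra_iff
proof (intro allI impI, elim conjE)
  fix f assume f: "regular_fun UNIV f" "\<forall>g\<in>G. f g = 0"
  have "dir_deriv (\<lambda>h. f (g ** h ** matrix_inv g)) X = 0"
    by (rule lie_algebra_dir_deriv [OF assms(2) regular_fun_translate [OF f(1)]])
      (simp add: f(2) assms(1) mult inv)
  moreover have "((\<lambda>t. f (g ** (mat 1 + cscale t X) ** matrix_inv g)) has_field_derivative
      dir_deriv f (g ** X ** matrix_inv g)) (at 0)"
    by (rule dir_deriv_curve [OF f(1) _ mat_deriv_conj])
      (simp add: matrix_inv_cancel(1) [OF invertible [OF assms(1)]])
  ultimately show "dir_deriv f (g ** X ** matrix_inv g) = 0"
    using DERIV_unique [OF dir_deriv_line [OF regular_fun_translate [OF f(1)]]] by simp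
qed

text \<open>The derivative of Ad is ad. The inverse is written as \<open>regular_inv\<close>, which
  makes conjugation a regular function of the group element.\<close>

lemma Ad_mat_deriv:
  "mat_deriv (\<lambda>t. (mat 1 + cscale t Y) ** X ** regular_inv (mat 1 + cscale t Y)) (bracket Y X)"
proof -
  have "mat_deriv (\<lambda>t. regular_inv (mat 1 + cscale t Y)) (- Y)"
    by (rule mat_deriv_regular_inv) (simp_all add: mat_deriv_line)
  moreover have "regular_inv (mat 1 + cscale 0 Y) = mat 1"
    using regular_inv_left [of "mat 1"] by simp
  ultimately show ?thesis
    using mat_deriv_mult [OF mat_deriv_mult [OF mat_deriv_line [of "mat 1" Y] mat_deriv_const [of X]],
        of "\<lambda>t. regular_inv (mat 1 + cscale t Y)" "- Y"]
    by (simp add: bracket_def matrix_minus_right)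
qed

lemma regular_fun_Ad: "regular_fun UNIV (\<lambda>g. (g ** X ** regular_inv g) $ i $ j)"
  by (intro regular_fun_matrix_mult regular_fun_matrix_const regular_fun.entry regular_fun_regular_inv)

text \<open>Two differentiations: for a function f vanishing on \<open>G\<close>, the map sending g
  to df(Ad g Y) vanishes on \<open>G\<close> again, and its derivative in the direction
  \<open>X\<close> is df of the bracket.\<close>

lemma bracket_closed:
  assumes "X \<in> lie_algebra G" "Y \<in> lie_algebra G"
  shows "bracket X Y \<in> lie_algebra G"
  unfolding lie_algebra_iff
proof (intro allI impI, elim conjE)
  fix f assume f: "regular_fun UNIV f" "\<forall>g\<in>G. f g = 0"
  obtain d where d: "gradient_at_one f d" using regular_fun_gradient [OF f(1)] by blast
  \<comment> \<open>Writing df through its gradient exhibits \<open>F\<close> as a regular function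
    of g.\<close>
  define F where "F = (\<lambda>g. \<Sum>i\<in>UNIV. \<Sum>j\<in>UNIV. d $ i $ j * (g ** Y ** regular_inv g) $ i $ j)"
  have F: "F g = dir_deriv f (g ** Y ** regular_inv g)" for g
    by (simp add: F_def dir_deriv_gradient [OF d])
  have reg: "regular_fun UNIV F"
    unfolding F_def
    by (intro regular_fun_sum regular_fun.mult regular_fun.const regular_fun_Ad) simp
  have "dir_deriv F X = 0"
  proof (rule lie_algebra_dir_deriv [OF assms(1) reg])
    fix g assume g: "g \<in> G"
    show "F g = 0"
      unfolding F regular_inv_eq [OF invertible [OF g]]
      using Ad_closed [OF g assms(2)] f lie_algebra_dir_deriv by blast
  qed
  moreover have "((\<lambda>t. F (mat 1 + cscale t X)) has_field_derivative dir_deriv f (bracket X Y)) (at 0)"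
    unfolding F_def dir_deriv_gradient [OF d]
    using Ad_mat_deriv [of X Y] unfolding mat_deriv_def by (intro DERIV_sum DERIV_cmult) auto
  ultimately show "dir_deriv f (bracket X Y) = 0"
    using DERIV_unique [OF dir_deriv_line [OF reg]] by simp
qed

text \<open>A matrix commuting with all of \<open>G\<close> commutes with its tangent vectors. This
  is applied to the elements of \<open>G\<close>, and once more to the elements of the Lie
  algebra.\<close>

lemma abelian_lie_algebra:
  assumes comm: "\<And>g h. g \<in> G \<Longrightarrow> h \<in> G \<Longrightarrow> g ** h = h ** g"
  shows "X \<in> lie_algebra G \<Longrightarrow> h \<in> G \<Longrightarrow> h ** X = X ** h"
    and "X \<in> lie_algebra G \<Longrightarrow> Y \<in> lie_algebra G \<Longrightarrow> bracket X Y = 0"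
proof -
  have *: "A ** X = X ** A" if "X \<in> lie_algebra G" "\<And>g. g \<in> G \<Longrightarrow> A ** g = g ** A" for A X
  proof -
    have "A ** X - X ** A = 0"
    proof (rule lie_algebra_matrix_eq [OF that(1), where M = "\<lambda>g. A ** g - g ** A"])
      fix i j
      show "regular_fun UNIV (\<lambda>g. (A ** g - g ** A) $ i $ j)"
        by (simp, intro regular_fun_diff regular_fun_matrix_mult regular_fun_matrix_const regular_fun.entry)
    next
      have "(\<lambda>t. A ** (mat 1 + cscale t X) - (mat 1 + cscale t X) ** A) = (\<lambda>t. 0 + cscale t (A ** X - X ** A))"
        by (simp add: matrix_add_left matrix_add_right cscale_mult_left cscale_mult_right
            cmat.scale_right_diff_distrib)
      then show "mat_deriv (\<lambda>t. A ** (mat 1 + cscale t X) - (mat 1 + cscale t X) ** A) (A ** X - X ** A)"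
        using mat_deriv_line by metis
    qed (use that in simp)
    then show ?thesis by simp
  qed
  show 1: "X \<in> lie_algebra G \<Longrightarrow> h \<in> G \<Longrightarrow> h ** X = X ** h" for X h
    using * comm by metis
  show "X \<in> lie_algebra G \<Longrightarrow> Y \<in> lie_algebra G \<Longrightarrow> bracket X Y = 0"
    using * [of Y X] 1 [of X] by (simp add: bracket_def)
qed

end

locale mat_group_hom = mat_group G for G :: "(complex^'N^'N) set" +
  fixes \<pi> :: "complex^'N^'N \<Rightarrow> complex^'n^'n"
  assumes regular: "\<And>i j. regular_fun UNIV (\<lambda>g. \<pi> g $ i $ j)"
    and hom: "\<And>g h. g \<in> G \<Longrightarrow> h \<in> G \<Longrightarrow> \<pi> (g ** h) = \<pi> g ** \<pi> h"
    and inv_image: "\<And>g. g \<in> G \<Longrightarrow> invertible (\<pi> g)"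
begin

lemma pi_one: "\<pi> (mat 1) = mat 1"
proof -
  have "\<pi> (mat 1) ** \<pi> (mat 1) = \<pi> (mat 1)"
    using hom [OF one one] by simp
  then have "matrix_inv (\<pi> (mat 1)) ** \<pi> (mat 1) ** \<pi> (mat 1) = matrix_inv (\<pi> (mat 1)) ** \<pi> (mat 1)"
    by (simp add: matrix_mul_assoc [symmetric])
  then show ?thesis
    by (simp add: matrix_inv_cancel(2) [OF inv_image [OF one]])
qed

lemma differential_add: "differential \<pi> (X + Y) = differential \<pi> X + differential \<pi> Y"
  by (rule matrix_eqI) (simp add: differential_nth dir_deriv_add [OF regular])

lemma differential_cscale: "differential \<pi> (cscale c X) = cscale c (differential \<pi> X)"
  by (rule matrix_eqI) (simp add: differential_nth dir_deriv_cscale [OF regular])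

text \<open>Derivative in h of the identity \<pi>(g h g^-1) \<pi>(g) = \<pi>(g) \<pi>(h). Keeping
  \<pi>(g) on the right avoids its inverse.\<close>

lemma differential_Ad:
  assumes g: "g \<in> G" and X: "X \<in> lie_algebra G"
  shows "differential \<pi> (g ** X ** matrix_inv g) ** \<pi> g = \<pi> g ** differential \<pi> X"
proof -
  let ?g' = "matrix_inv g"
  let ?M = "\<lambda>h. \<pi> (g ** h ** ?g') ** \<pi> g - \<pi> g ** \<pi> h"
  have gg: "g ** ?g' = mat 1" "?g' ** g = mat 1"
    using invertible [OF g] by (auto simp: matrix_inv_cancel)
  have "differential \<pi> (g ** X ** ?g') ** \<pi> g - \<pi> g ** differential \<pi> X = 0"
  proof (rule lie_algebra_matrix_eq [OF X, where M = ?M])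
    show "regular_fun UNIV (\<lambda>h. ?M h $ i $ j)" for i j
      by (simp, intro regular_fun_diff regular_fun_matrix_mult regular_fun_matrix_const regular)
        (rule regular_fun_translate [OF regular])
    show "?M h = 0" if h: "h \<in> G" for h
    proof -
      have "\<pi> (g ** h ** ?g') ** \<pi> g = \<pi> (g ** h ** ?g' ** g)"
        using hom [OF mult [OF mult [OF g h] inv [OF g]] g] by simp
      also have "g ** h ** ?g' ** g = g ** h"
        by (simp add: matrix_mul_assoc [symmetric] gg(2))
      finally show ?thesis using hom [OF g h] by simp
    qed
    have 1: "mat_deriv (\<lambda>t. \<pi> (g ** (mat 1 + cscale t X) ** ?g')) (differential \<pi> (g ** X ** ?g'))"
      by (rule mat_deriv_regular_fun [OF regular _ mat_deriv_conj]) (simp add: gg)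
    have 2: "mat_deriv (\<lambda>t. \<pi> (mat 1 + cscale t X)) (differential \<pi> X)"
      by (rule mat_deriv_regular_fun [OF regular _ mat_deriv_line]) simp
    show "mat_deriv (\<lambda>t. ?M (mat 1 + cscale t X))
        (differential \<pi> (g ** X ** ?g') ** \<pi> g - \<pi> g ** differential \<pi> X)"
      using mat_deriv_mult [OF 1 mat_deriv_const [of "\<pi> g"]] mat_deriv_mult [OF mat_deriv_const [of "\<pi> g"] 2]
      unfolding mat_deriv_def by (auto intro!: DERIV_diff)
  qed
  then show ?thesis by simp
qed

text \<open>Derivative in g, at g = 1, of the intertwining identity
  \<open>differential_Ad\<close>.\<close>

lemma differential_bracket:
  assumes X: "X \<in> lie_algebra G" and Y: "Y \<in> lie_algebra G"
  shows "differential \<pi> (bracket X Y) = bracket (differential \<pi> X) (differential \<pi> Y)"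
proof -
  let ?M = "\<lambda>g. differential \<pi> (g ** Y ** regular_inv g) ** \<pi> g - \<pi> g ** differential \<pi> Y"
  \<comment> \<open>Each entry of \<open>differential \<pi>\<close> is a linear form in its
    argument, so composing it with the regular map Ad gives a regular function of g.\<close>
  have comp: "\<exists>d. \<forall>Z. differential \<pi> Z $ i $ j = (\<Sum>a\<in>UNIV. \<Sum>b\<in>UNIV. d $ a $ b * Z $ a $ b)" for i j
  proof -
    obtain d where "gradient_at_one (\<lambda>g. \<pi> g $ i $ j) d"
      using regular_fun_gradient [OF regular] by blast
    then show ?thesis by (auto simp: differential_nth dir_deriv_gradient)
  qed
  have reg: "regular_fun UNIV (\<lambda>g. differential \<pi> (g ** Y ** regular_inv g) $ i $ j)" for i j
  proof -
    obtain d where "\<forall>Z. differential \<pi> Z $ i $ j = (\<Sum>a\<in>UNIV. \<Sum>b\<in>UNIV. d $ a $ b * Z $ a $ b)"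
      using comp by blast
    then show ?thesis
      by simp (intro regular_fun_sum regular_fun.mult regular_fun_Ad regular_fun.const, simp)
  qed
  have "differential \<pi> (bracket X Y) + differential \<pi> Y ** differential \<pi> X
      - differential \<pi> X ** differential \<pi> Y = 0"
  proof (rule lie_algebra_matrix_eq [OF X, where M = ?M])
    show "regular_fun UNIV (\<lambda>g. ?M g $ i $ j)" for i j
      by (simp, intro regular_fun_diff regular_fun_matrix_mult regular_fun_matrix_const regular reg)
    show "?M g = 0" if "g \<in> G" for g
      using differential_Ad [OF that Y] by (simp add: regular_inv_eq invertible that)
    have 1: "mat_deriv (\<lambda>t. differential \<pi> ((mat 1 + cscale t X) ** Y ** regular_inv (mat 1 + cscale t X)))
       (differential \<pi> (bracket X Y))"
      unfolding mat_deriv_def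
    proof (intro allI)
      fix i j
      obtain d where d: "\<And>Z. differential \<pi> Z $ i $ j = (\<Sum>a\<in>UNIV. \<Sum>b\<in>UNIV. d $ a $ b * Z $ a $ b)"
        using comp by blast
      show "((\<lambda>t. differential \<pi> ((mat 1 + cscale t X) ** Y ** regular_inv (mat 1 + cscale t X)) $ i $ j)
          has_field_derivative differential \<pi> (bracket X Y) $ i $ j) (at 0)"
        unfolding d using Ad_mat_deriv [of X Y] unfolding mat_deriv_def
        by (intro DERIV_sum DERIV_cmult) auto
    qed
    have 2: "mat_deriv (\<lambda>t. \<pi> (mat 1 + cscale t X)) (differential \<pi> X)"
      by (rule mat_deriv_regular_fun [OF regular _ mat_deriv_line]) simp
    have "mat 1 ** Y ** regular_inv (mat 1) = Y"
      using regular_inv_left [of "mat 1 :: complex^'N^'N"] by simp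
    then show "mat_deriv (\<lambda>t. ?M (mat 1 + cscale t X)) (differential \<pi> (bracket X Y)
        + differential \<pi> Y ** differential \<pi> X - differential \<pi> X ** differential \<pi> Y)"
      using mat_deriv_mult [OF 1 2] mat_deriv_mult [OF 2 mat_deriv_const [of "differential \<pi> Y"]]
      unfolding mat_deriv_def by (auto intro!: DERIV_diff simp: pi_one)
  qed
  then show ?thesis by (simp add: bracket_def algebra_simps)
qed

end

section \<open>Homomorphisms from the circle\<close>

text \<open>Trigonometric polynomials: on the unit circle the real coordinates of z are combinations
  of z and 1/z, and the factor \<open>z ^ M\<close> clears denominators.\<close>

definition laurent_on_circle :: "(complex \<Rightarrow> complex) \<Rightarrow> bool"
  where "laurent_on_circle f \<longleftrightarrow> (\<exists>M p. \<forall>z\<in>sphere 0 1. z ^ M * f z = poly p z)"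

lemma laurent_on_circle_add:
  assumes "laurent_on_circle f" "laurent_on_circle g"
  shows "laurent_on_circle (\<lambda>z. f z + g z)"
proof -
  from assms obtain M p N q where
    f: "\<And>z. z \<in> sphere 0 1 \<Longrightarrow> z ^ M * f z = poly p z" and
    g: "\<And>z. z \<in> sphere 0 1 \<Longrightarrow> z ^ N * g z = poly q z"
    unfolding laurent_on_circle_def by blast
  have "z ^ (M + N) * (f z + g z) = poly (monom 1 N * p + monom 1 M * q) z" if "z \<in> sphere 0 1" for z
    unfolding poly_add poly_mult poly_monom f [OF that, symmetric] g [OF that, symmetric]
    by (simp add: power_add algebra_simps)
  then show ?thesis unfolding laurent_on_circle_def by blast
qed

lemma laurent_on_circle_mult:
  assumes "laurent_on_circle f" "laurent_on_circle g"
  shows "laurent_on_circle (\<lambda>z. f z * g z)"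
proof -
  from assms obtain M p N q where
    f: "\<And>z. z \<in> sphere 0 1 \<Longrightarrow> z ^ M * f z = poly p z" and
    g: "\<And>z. z \<in> sphere 0 1 \<Longrightarrow> z ^ N * g z = poly q z"
    unfolding laurent_on_circle_def by blast
  have "z ^ (M + N) * (f z * g z) = poly (p * q) z" if "z \<in> sphere 0 1" for z
    unfolding poly_mult f [OF that, symmetric] g [OF that, symmetric]
    by (simp add: power_add algebra_simps)
  then show ?thesis unfolding laurent_on_circle_def by blast
qed

lemma laurent_on_circle_const: "laurent_on_circle (\<lambda>z. c)"
  unfolding laurent_on_circle_def by (rule exI [of _ 0], rule exI [of _ "[:c:]"]) simp

lemma laurent_on_circle_linear:
  fixes f :: "complex \<Rightarrow> real"
  assumes "bounded_linear f"
  shows "laurent_on_circle (\<lambda>z. complex_of_real (f z))"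
proof -
  interpret bounded_linear f by fact
  \<comment> \<open>With this \<open>a\<close> one has f(z) = a z + cnj a cnj z for every z, and cnj
    z = 1/z on the circle.\<close>
  define a where "a = (f 1 - \<i> * f \<i>) / 2"
  have "z ^ 1 * complex_of_real (f z) = poly [:cnj a, 0, a:] z" if "z \<in> sphere 0 1" for z
  proof -
    have "z = Re z *\<^sub>R 1 + Im z *\<^sub>R \<i>"
      by (simp add: complex_eq_iff)
    then have "f z = f (Re z *\<^sub>R 1 + Im z *\<^sub>R \<i>)" by metis
    then have 1: "f z = Re z * f 1 + Im z * f \<i>" by (simp add: add scaleR)
    have "z * cnj z = 1" using that complex_norm_square [of z] by simp
    moreover have "complex_of_real (f z) = a * z + cnj a * cnj z"
      unfolding 1 a_def by (simp add: complex_eq_iff field_simps)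
    ultimately show ?thesis by (simp add: algebra_simps)
  qed
  then show ?thesis unfolding laurent_on_circle_def by blast
qed

lemma laurent_on_circle_polynomial:
  fixes f :: "complex \<Rightarrow> real"
  assumes "real_polynomial_function f"
  shows "laurent_on_circle (\<lambda>z. complex_of_real (f z))"
  using assms
proof induction
  case (add f g)
  then show ?case using laurent_on_circle_add by fastforce
next
  case (mult f g)
  then show ?case using laurent_on_circle_mult by fastforce
qed (auto intro: laurent_on_circle_linear laurent_on_circle_const)

lemma laurent_on_circle_complex:
  assumes "polynomial_function f"
  shows "laurent_on_circle f"
proof -
  have "real_polynomial_function (Re \<circ> f)" "real_polynomial_function (Im \<circ> f)"
    using assms bounded_linear_Re bounded_linear_Im unfolding polynomial_function_def by blast+
  then have "laurent_on_circle (\<lambda>z. of_real (Re (f z)) + \<i> * of_real (Im (f z)))"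
    using laurent_on_circle_polynomial laurent_on_circle_add laurent_on_circle_mult laurent_on_circle_const
    by (fastforce simp: o_def)
  then show ?thesis by (simp add: complex_eq [symmetric])
qed

lemma infinite_circle: "infinite (sphere (0::complex) 1)"
proof
  assume "finite (sphere (0::complex) 1)"
  moreover have "connected (sphere (0::complex) 1)" by (rule connected_sphere) simp
  ultimately have "sphere (0::complex) 1 = {} \<or> (\<exists>a. sphere (0::complex) 1 = {a})"
    using connected_finite_iff_sing by blast
  moreover have "1 \<in> sphere (0::complex) 1" "-1 \<in> sphere (0::complex) 1" by auto
  ultimately show False
    by (metis empty_iff one_neq_neg_one singletonD)
qed

lemma poly_zero_on_circle:
  assumes "\<And>z. z \<in> sphere (0::complex) 1 \<Longrightarrow> (\<Sum>k\<le>D::nat. c k * z ^ k) = 0" and "k \<le> D"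
  shows "c k = 0"
proof -
  have "\<not> finite {z. (\<Sum>k\<le>D. c k * z ^ k) = 0}"
    using infinite_circle assms(1) by (meson mem_Collect_eq rev_finite_subset subsetI)
  then show ?thesis using polyfun_finite_roots [of c D] assms(2) by blast
qed

locale circle_action =
  fixes \<psi> :: "complex \<Rightarrow> complex^'n^'n"
  assumes poly: "\<exists>p. polynomial_function p \<and> (\<forall>z\<in>sphere 0 1. \<psi> z = p z)"
    and mult: "\<And>z w. z \<in> sphere 0 1 \<Longrightarrow> w \<in> sphere 0 1 \<Longrightarrow> \<psi> (z * w) = \<psi> z ** \<psi> w"
    and psi_one: "\<psi> 1 = mat 1"
begin

text \<open>One exponent \<open>M\<close> and one degree \<open>D\<close> serve all entries, so the
  coefficients can be collected into matrices \<open>A k\<close>.\<close>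

lemma laurent_expansion:
  obtains M :: nat and D :: nat and A where
    "\<And>z. z \<in> sphere 0 1 \<Longrightarrow> cscale (z ^ M) (\<psi> z) = (\<Sum>k\<le>D. cscale (z ^ k) (A k))"
proof -
  obtain p where p: "polynomial_function p" "\<And>z. z \<in> sphere 0 1 \<Longrightarrow> \<psi> z = p z"
    using poly by blast
  have "laurent_on_circle (\<lambda>z. p z $ i $ j)" for i j
  proof (rule laurent_on_circle_complex)
    have "bounded_linear (\<lambda>X :: complex^'n^'n. X $ i $ j)"
      by (rule bounded_linear_compose [OF bounded_linear_vec_nth bounded_linear_vec_nth])
    then show "polynomial_function (\<lambda>z. p z $ i $ j)"
      using p(1) unfolding polynomial_function_def
      using bounded_linear_compose by (fastforce simp: o_def)
  qed
  then have "\<exists>M q. \<forall>z\<in>sphere 0 1. z ^ M * p z $ i $ j = poly q z" for i j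
    unfolding laurent_on_circle_def by blast
  then obtain m q where mq: "\<And>i j z. z \<in> sphere 0 1 \<Longrightarrow> z ^ (m i j :: nat) * p z $ i $ j = poly (q i j) z"
    by metis
  define M where "M = Max (range (\<lambda>(i, j). m i j))"
  have M: "m i j \<le> M" for i j
    unfolding M_def by (rule Max_ge) auto
  define r where "r i j = monom 1 (M - m i j) * q i j" for i j
  define D where "D = Max (range (\<lambda>(i, j). degree (r i j)))"
  have D: "degree (r i j) \<le> D" for i j
    unfolding D_def by (rule Max_ge) auto
  have "cscale (z ^ M) (\<psi> z) = (\<Sum>k\<le>D. cscale (z ^ k) (\<chi> i j. coeff (r i j) k))"
    if z: "z \<in> sphere 0 1" for z
  proof (rule matrix_eqI)
    fix i j
    have "z ^ M * \<psi> z $ i $ j = z ^ (M - m i j) * (z ^ m i j * p z $ i $ j)"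
      using M [of i j] p(2) [OF z] by (simp add: mult.assoc [symmetric] power_add [symmetric])
    also have "\<dots> = poly (r i j) z"
      by (simp add: mq [OF z] r_def poly_monom)
    also have "\<dots> = (\<Sum>k\<le>D. coeff (r i j) k * z ^ k)"
      unfolding poly_altdef using D [of i j]
      by (intro sum.mono_neutral_left) (auto simp: coeff_eq_0)
    finally show "cscale (z ^ M) (\<psi> z) $ i $ j
        = (\<Sum>k\<le>D. cscale (z ^ k) (\<chi> i j. coeff (r i j) k)) $ i $ j"
      by (simp add: sum_component mult.commute)
  qed
  then show thesis by (rule that)
qed

text \<open>Tangent vectors are defined with a complex parameter, so the real one-parameter group
  \<psi>(cis t) is continued to an entire curve by means of its Laurent expansion.\<close>

lemma circle_curve:
  obtains \<gamma> X where "\<gamma> 0 = mat 1" "mat_deriv \<gamma> X" "\<And>t. \<gamma> (complex_of_real t) = \<psi> (cis t)"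
proof -
  obtain M D A where A: "\<And>z. z \<in> sphere 0 1 \<Longrightarrow> cscale (z ^ M) (\<psi> z) = (\<Sum>k\<le>D. cscale (z ^ k) (A k))"
    using laurent_expansion by metis
  define \<gamma> where "\<gamma> t = (\<Sum>k\<le>D. cscale (exp (\<i> * t * (of_nat k - of_nat M))) (A k))" for t
  define X where "X = (\<Sum>k\<le>D. cscale (\<i> * (of_nat k - of_nat M)) (A k))"
  have real: "\<gamma> (complex_of_real t) = \<psi> (cis t)" for t
  proof -
    have "\<psi> (cis t) = cscale (exp (- \<i> * t * of_nat M)) (cscale (cis t ^ M) (\<psi> (cis t)))"
      by (simp add: cis_conv_exp exp_of_nat_mult [symmetric] exp_add [symmetric] algebra_simps)
    also have "\<dots> = \<gamma> (complex_of_real t)"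
      unfolding \<gamma>_def by (subst A) (simp_all add: cmat.scale_sum_right cis_conv_exp
        exp_of_nat_mult [symmetric] exp_add [symmetric] algebra_simps)
    finally show ?thesis by simp
  qed
  show thesis
  proof (rule that [of \<gamma> X])
    show "\<gamma> 0 = mat 1" using real [of 0] psi_one by simp
    show "mat_deriv \<gamma> X"
      unfolding mat_deriv_def \<gamma>_def X_def sum_component cscale_nth
      by (intro allI DERIV_sum) (auto intro!: derivative_eq_intros)
  qed (rule real)
qed

definition weight_space :: "int \<Rightarrow> (complex^'n) set"
  where "weight_space k = {v. \<forall>z\<in>sphere 0 1. \<psi> z *v v = (z powi k) *s v}"

text \<open>Comparing coefficients of powers of w in \<psi>(z w) = \<psi>(z) \<psi>(w) shows that
  \<psi>(z) acts on the image of \<open>A k\<close> by the power k - M of z, and z = 1 shows that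
  the \<open>A k\<close> add up to the identity. So the Laurent coefficients are the projections
  onto the weight spaces.\<close>

lemma weight_decomposition:
  obtains K :: "int set" and P where "finite K" "\<And>k. P k \<in> weight_space k" "v = (\<Sum>k\<in>K. P k)"
proof -
  obtain M D A where A: "\<And>z. z \<in> sphere 0 1 \<Longrightarrow> cscale (z ^ M) (\<psi> z) = (\<Sum>k\<le>D. cscale (z ^ k) (A k))"
    using laurent_expansion by metis
  have eig: "\<psi> z *v (A k *v v) = (z powi (int k - int M)) *s (A k *v v)"
    if z: "z \<in> sphere 0 1" and k: "k \<le> D" for z k
  proof -
    have z0: "z \<noteq> 0" using z by auto
    have "cscale (z ^ M) (\<psi> z) ** A k = cscale (z ^ k) (A k)"
    proof (rule matrix_eqI)
      fix i j
      have "(cscale (z ^ M) (\<psi> z) ** A k - cscale (z ^ k) (A k)) $ i $ j = 0"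
      proof (rule poly_zero_on_circle [OF _ k])
        fix w :: complex assume w: "w \<in> sphere 0 1"
        have zw: "z * w \<in> sphere 0 1" using z w by (simp add: norm_mult)
        have "(\<Sum>k\<le>D. cscale (w ^ k) (cscale (z ^ M) (\<psi> z) ** A k))
          = cscale (z ^ M) (\<psi> z) ** (\<Sum>k\<le>D. cscale (w ^ k) (A k))"
          by (rule matrix_eqI)
            (simp add: matrix_matrix_mult_def sum_component sum_distrib_left sum.swap [of _ "{..D}"] algebra_simps)
        also have "\<dots> = cscale (z ^ M) (\<psi> z) ** cscale (w ^ M) (\<psi> w)"
          by (simp add: A [OF w])
        also have "\<dots> = cscale ((z * w) ^ M) (\<psi> (z * w))"
          by (simp add: mult [OF z w] cscale_mult_left cscale_mult_right power_mult_distrib)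
        also have "\<dots> = (\<Sum>k\<le>D. cscale (w ^ k) (cscale (z ^ k) (A k)))"
          by (subst A [OF zw]) (simp add: power_mult_distrib mult.commute)
        finally have "(\<Sum>k\<le>D. cscale (w ^ k) (cscale (z ^ M) (\<psi> z) ** A k)) $ i $ j
          = (\<Sum>k\<le>D. cscale (w ^ k) (cscale (z ^ k) (A k))) $ i $ j" by simp
        then show "(\<Sum>k\<le>D. (cscale (z ^ M) (\<psi> z) ** A k - cscale (z ^ k) (A k)) $ i $ j * w ^ k) = 0"
          by (simp add: sum_component sum_subtractf algebra_simps)
      qed
      then show "(cscale (z ^ M) (\<psi> z) ** A k) $ i $ j = cscale (z ^ k) (A k) $ i $ j" by simp
    qed
    then have "z ^ M *s (\<psi> z *v (A k *v v)) = z ^ k *s (A k *v v)"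
      by (metis cscale_mult_left cscale_vector matrix_vector_mul_assoc)
    then have "inverse (z ^ M) *s (z ^ M *s (\<psi> z *v (A k *v v))) = inverse (z ^ M) *s (z ^ k *s (A k *v v))"
      by simp
    then show ?thesis
      using z0 by (simp add: power_int_diff divide_inverse mult.commute)
  qed
  \<comment> \<open>Indices are shifted by \<open>M\<close>; the value 0 outside the range of the
    expansion puts \<open>P k\<close> into \<open>weight_space k\<close> for every integer
    k.\<close>
  define P where "P k = (if 0 \<le> k + int M \<and> k + int M \<le> int D then A (nat (k + int M)) *v v else 0)" for k
  have "P k \<in> weight_space k" for k
    using eig [of _ "nat (k + int M)"] by (auto simp: P_def weight_space_def)
  moreover have "v = (\<Sum>k\<in>(\<lambda>k. int k - int M) ` {..D}. P k)"
  proof -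
    have "v = (\<Sum>k\<le>D. cscale (1 ^ k) (A k)) *v v"
      by (subst A [symmetric]) (simp_all add: psi_one)
    also have "\<dots> = (\<Sum>k\<le>D. A k *v v)"
      by (simp add: matrix_vector_mult_def vec_eq_iff sum_component sum_distrib_right sum.swap [of _ "{..D}"])
    also have "\<dots> = (\<Sum>k\<in>(\<lambda>k. int k - int M) ` {..D}. P k)"
      by (subst sum.reindex) (auto simp: inj_on_def P_def)
    finally show ?thesis .
  qed
  ultimately show thesis using that by blast
qed

end

text \<open>A complex derivative that exists can be computed along the sequence 1/(n+1). This passes
  from the real parameters of a curve, where membership in a group is known, to its complex
  tangent.\<close>

lemma deriv_zero_on_reals:
  assumes "(F has_field_derivative D) (at 0)" "\<And>t. F (complex_of_real t) = c"
  shows "D = 0"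
proof -
  have "((\<lambda>h. (F (0 + h) - F 0) / h) \<longlongrightarrow> D) (at 0)"
    using assms(1) by (simp add: DERIV_def)
  moreover have "filterlim (\<lambda>n. complex_of_real (inverse (real (Suc n)))) (at 0) sequentially"
    unfolding filterlim_at using tendsto_of_real [OF LIMSEQ_inverse_real_of_nat, where 'a = complex]
    by (simp del: of_real_inverse)
  ultimately have "(\<lambda>n. (F (0 + complex_of_real (inverse (real (Suc n)))) - F 0)
      / complex_of_real (inverse (real (Suc n)))) \<longlonglongrightarrow> D"
    by (rule filterlim_compose)
  moreover have "F 0 = c" using assms(2) [of 0] by simp
  ultimately have "(\<lambda>n. 0) \<longlonglongrightarrow> D"
    using assms(2) by (simp del: of_real_inverse)
  then show ?thesis using LIMSEQ_const_iff by metis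
qed

section \<open>Complex conjugation\<close>

definition mcnj :: "complex^'n^'m \<Rightarrow> complex^'n^'m"
  where "mcnj A = (\<chi> i j. cnj (A $ i $ j))"

definition vcnj :: "complex^'n \<Rightarrow> complex^'n"
  where "vcnj v = (\<chi> i. cnj (v $ i))"

lemma mcnj_nth [simp]: "mcnj A $ i $ j = cnj (A $ i $ j)"
  by (simp add: mcnj_def)

lemma vcnj_nth [simp]: "vcnj v $ i = cnj (v $ i)"
  by (simp add: vcnj_def)

lemma mcnj_mcnj [simp]: "mcnj (mcnj A) = A"
  by (simp add: vec_eq_iff)

lemma vcnj_eq_0 [simp]: "vcnj v = 0 \<longleftrightarrow> v = 0"
  by (simp add: vec_eq_iff)

lemma vcnj_mult: "vcnj (A *v v) = mcnj A *v vcnj v"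
  by (simp add: vec_eq_iff matrix_vector_mult_def)

lemma vcnj_scale: "vcnj (c *s v) = cnj c *s vcnj v"
  by (simp add: vec_eq_iff)

lemma vcnj_add: "vcnj (u + v) = vcnj u + vcnj v"
  by (simp add: vec_eq_iff)

lemma mcnj_minus: "mcnj (- A) = - mcnj A"
  by (simp add: vec_eq_iff)

lemma mcnj_cscale: "mcnj (cscale c A) = cscale (cnj c) (mcnj A)"
  by (simp add: vec_eq_iff)

lemma mcnj_real: "(\<forall>i j. A $ i $ j \<in> \<real>) \<longleftrightarrow> mcnj A = A"
  by (simp add: vec_eq_iff Reals_cnj_iff)

lemma det_mcnj: "det (mcnj A) = cnj (det A)"
  by (simp add: det_def)

text \<open>Conjugating both argument and value amounts to conjugating the coefficients. The twisted
  function is therefore available as a test function for \<open>lie_algebra\<close>.\<close>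

lemma regular_fun_mcnj:
  "regular_fun UNIV f \<Longrightarrow> regular_fun UNIV (\<lambda>g. cnj (f (mcnj g)))"
  by (induction rule: regular_fun.induct) (simp_all add: det_mcnj regular_fun.intros)

lemma rational_fun_mcnj:
  "regular_fun \<rat> f \<Longrightarrow> f (mcnj g) = cnj (f g)"
proof (induction rule: regular_fun.induct)
  case (const c)
  then obtain q where "c = of_rat q" by (auto simp: Rats_def)
  then show ?case by (cases q) (simp add: of_rat_rat)
qed (simp_all add: det_mcnj)

lemma dir_deriv_mcnj:
  assumes "regular_fun UNIV f"
  shows "dir_deriv (\<lambda>g. cnj (f (mcnj g))) X = cnj (dir_deriv f (mcnj X))"
proof -
  have "((cnj \<circ> (\<lambda>t. f (mat 1 + cscale t (mcnj X))) \<circ> cnj) has_field_derivative cnj (dir_deriv f (mcnj X)))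
    (at (cnj 0))"
    using dir_deriv_line [OF assms] by (intro has_field_derivative_cnj_cnj) simp
  moreover have "mat 1 + cscale (cnj t) (mcnj X) = mcnj (mat 1 + cscale t X)" for t
    by (simp add: vec_eq_iff mat_def)
  ultimately have "((\<lambda>t. cnj (f (mcnj (mat 1 + cscale t X)))) has_field_derivative cnj (dir_deriv f (mcnj X))) (at 0)"
    by (simp add: o_def)
  then show ?thesis
    using DERIV_unique [OF dir_deriv_line [OF regular_fun_mcnj [OF assms]]] by blast
qed

lemma lie_algebra_mcnj:
  assumes "\<And>g. g \<in> G \<Longrightarrow> mcnj g \<in> G" "X \<in> lie_algebra G"
  shows "mcnj X \<in> lie_algebra G"
  unfolding lie_algebra_iff
proof (intro allI impI, elim conjE)
  fix f assume f: "regular_fun UNIV f" "\<forall>g\<in>G. f g = 0"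
  have "dir_deriv (\<lambda>g. cnj (f (mcnj g))) X = 0"
    by (rule lie_algebra_dir_deriv [OF assms(2) regular_fun_mcnj [OF f(1)]]) (simp add: f(2) assms(1))
  then show "dir_deriv f (mcnj X) = 0" by (simp add: dir_deriv_mcnj [OF f(1)])
qed

lemma differential_mcnj:
  assumes "\<And>i j. regular_fun \<rat> (\<lambda>g. \<pi> g $ i $ j)"
  shows "differential \<pi> (mcnj X) = mcnj (differential \<pi> X)"
proof (rule matrix_eqI)
  fix i j
  have "dir_deriv (\<lambda>g. cnj (\<pi> (mcnj g) $ i $ j)) X = cnj (dir_deriv (\<lambda>g. \<pi> g $ i $ j) (mcnj X))"
    by (rule dir_deriv_mcnj [OF regular_fun_UNIV_mono [OF assms]])
  then show "differential \<pi> (mcnj X) $ i $ j = mcnj (differential \<pi> X) $ i $ j"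
    by (simp add: differential_nth rational_fun_mcnj [OF assms])
qed

lemma rational_algebraic_group_mcnj:
  assumes "rational_algebraic_group G" "g \<in> G"
  shows "mcnj g \<in> G"
proof -
  obtain F where F: "\<forall>f\<in>F. regular_fun \<rat> f" "G = {g. invertible g \<and> (\<forall>f\<in>F. f g = 0)}"
    using assms(1) unfolding rational_algebraic_group_def by blast
  with assms(2) show ?thesis
    by (auto simp: rational_fun_mcnj invertible_det_nz det_mcnj)
qed

section \<open>Complex linear algebra\<close>

text \<open>Abstract in the scaling because it is used both for vectors and for matrices under
  \<open>cscale\<close>.\<close>

locale complex_vector_space = finite_dimensional_vector_space scale Basis
  for scale :: "complex \<Rightarrow> 'b::ab_group_add \<Rightarrow> 'b" and Basis
begin

definition linear_on :: "'b set \<Rightarrow> ('b \<Rightarrow> 'b) \<Rightarrow> bool"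
  where "linear_on S T \<longleftrightarrow> (\<forall>x\<in>S. T x \<in> S) \<and> (\<forall>x\<in>S. \<forall>y\<in>S. T (x + y) = T x + T y)
    \<and> (\<forall>c. \<forall>x\<in>S. T (scale c x) = scale c (T x))"

lemma linear_on_sum:
  assumes "linear_on S T" "subspace S" "\<And>i. i \<in> I \<Longrightarrow> f i \<in> S"
  shows "T (\<Sum>i\<in>I. f i) = (\<Sum>i\<in>I. T (f i))"
  using assms(3)
proof (induction I rule: infinite_finite_induct)
  case (insert i I)
  then have "(\<Sum>i\<in>I. f i) \<in> S" using assms(2) by (intro subspace_sum) auto
  with insert assms(1) show ?case by (simp add: linear_on_def)
next
  case empty
  have "T (scale 0 0) = scale 0 (T 0)"
    using assms(1) subspace_0 [OF assms(2)] unfolding linear_on_def by blast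
  then show ?case by simp
next
  case (infinite I)
  have "T (scale 0 0) = scale 0 (T 0)"
    using assms(1) subspace_0 [OF assms(2)] unfolding linear_on_def by blast
  with infinite show ?case by simp
qed

text \<open>One vector more than the dimension. The relation is cut off at its last nonzero
  coefficient, which can then serve as the leading coefficient of a polynomial.\<close>

lemma iterates_dependent:
  "\<exists>n a. (\<Sum>i\<le>n. scale (a i) (v i)) = 0 \<and> a n \<noteq> 0" for v :: "nat \<Rightarrow> 'b"
proof -
  let ?n = "dim UNIV"
  have ex: "\<exists>a. (\<Sum>i\<le>?n. scale (a i) (v i)) = 0 \<and> (\<exists>i\<le>?n. a i \<noteq> 0)"
  proof (cases "inj_on v {..?n}")
    \<comment> \<open>A repetition in the family is invisible in the set of its values, so it yields
      its relation separately.\<close>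
    case False
    then obtain i j where ij: "i \<le> ?n" "j \<le> ?n" "i \<noteq> j" "v i = v j"
      by (auto simp: inj_on_def)
    let ?a = "\<lambda>k. if k = i then 1 else if k = j then - 1 else 0"
    have "(\<Sum>k\<le>?n. scale (?a k) (v k)) = (\<Sum>k\<in>{i, j}. scale (?a k) (v k))"
      using ij by (intro sum.mono_neutral_right) auto
    also have "\<dots> = 0" using ij by simp
    finally show ?thesis using ij by (intro exI [of _ ?a]) auto
  next
    case True
    have "dependent (v ` {..?n})"
      using independent_card_le_dim [of "v ` {..?n}" UNIV] True by (auto simp: card_image)
    then obtain u where u: "\<exists>x\<in>v ` {..?n}. u x \<noteq> 0" "(\<Sum>x\<in>v ` {..?n}. scale (u x) x) = 0"
      using dependent_finite [of "v ` {..?n}"] by blast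
    then have "(\<Sum>i\<le>?n. scale (u (v i)) (v i)) = 0"
      using sum.reindex [OF True, of "\<lambda>x. scale (u x) x"] by (simp add: o_def)
    then show ?thesis using u(1) by (intro exI [of _ "\<lambda>i. u (v i)"]) auto
  qed
  then obtain a i where a: "(\<Sum>i\<le>?n. scale (a i) (v i)) = 0" "i \<le> ?n" "a i \<noteq> 0" by blast
  define m where "m = Max {i. i \<le> ?n \<and> a i \<noteq> 0}"
  have fin: "finite {i. i \<le> ?n \<and> a i \<noteq> 0}" by simp
  have m: "m \<le> ?n" "a m \<noteq> 0"
    using Max_in [OF fin] a unfolding m_def by blast+
  have "a j = 0" if "m < j" "j \<le> ?n" for j
    using Max_ge [OF fin, of j] that unfolding m_def by fastforce
  then have "(\<Sum>i\<le>m. scale (a i) (v i)) = (\<Sum>i\<le>?n. scale (a i) (v i))"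
    using m by (intro sum.mono_neutral_left) auto
  then show ?thesis using a m by auto
qed

text \<open>A relation of least length among the iterates of x is a polynomial p with p(T) x = 0. If
  c is a root and p = (X - c) q, minimality makes q(T) x nonzero, and this is the
  eigenvector.\<close>

lemma eigenvector_exists:
  assumes P: "subspace P" "P \<noteq> {0}" and T: "linear_on P T"
  obtains x c where "x \<in> P" "x \<noteq> 0" "T x = scale c x"
proof -
  obtain x where x: "x \<in> P" "x \<noteq> 0" using P subspace_0 by blast
  define v where "v i = (T ^^ i) x" for i
  have v: "v i \<in> P" for i
    by (induction i) (use x T in \<open>auto simp: v_def linear_on_def\<close>)
  have Tv: "T (v i) = v (Suc i)" for i by (simp add: v_def)
  let ?R = "\<lambda>n. \<exists>a. (\<Sum>i\<le>n. scale (a i) (v i)) = 0 \<and> a n \<noteq> 0"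
  define n where "n = (LEAST n. ?R n)"
  have "?R n" unfolding n_def by (rule LeastI_ex) (use iterates_dependent [of v] in blast)
  then obtain a where a: "(\<Sum>i\<le>n. scale (a i) (v i)) = 0" "a n \<noteq> 0" by blast
  have least: "\<not> ?R k" if "k < n" for k using not_less_Least that unfolding n_def by blast
  have "n \<noteq> 0"
  proof
    assume "n = 0"
    with a x show False by (simp add: v_def)
  qed
  then obtain m where m: "n = Suc m" using not0_implies_Suc by blast
  define p where "p = (\<Sum>i\<le>n. monom (a i) i)"
  have cp: "coeff p i = (if i \<le> n then a i else 0)" for i
    by (simp add: p_def coeff_sum)
  have dp: "degree p = n"
    using a(2) by (intro antisym degree_le le_degree) (auto simp: cp)
  then obtain c where "poly p c = 0"
    using fundamental_theorem_of_algebra [of p] m by (auto simp: constant_degree)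
  then obtain q where q: "p = [:- c, 1:] * q" using poly_eq_0_iff_dvd dvd_def by blast
  define y where "y = (\<Sum>i\<le>m. scale (coeff q i) (v i))"
  have "q \<noteq> 0" using q a(2) cp [of n] by auto
  then have "degree p = Suc (degree q)"
    unfolding q by (subst degree_mult_eq) auto
  then have dq: "degree q = m" using dp m by simp
  have "y \<noteq> 0"
    using least [of m] m dq \<open>q \<noteq> 0\<close> unfolding y_def by (metis leading_coeff_neq_0 lessI)
  moreover have "y \<in> P" unfolding y_def using v P(1) by (intro subspace_sum subspace_scale) auto
  moreover have "T y = scale c y"
  proof -
    have cq: "coeff p (Suc i) = coeff q i - c * coeff q (Suc i)" "coeff p 0 = - c * coeff q 0" for i
      by (simp_all add: q mult_poly_0 coeff_pCons)
    have "T y = (\<Sum>i\<le>m. T (scale (coeff q i) (v i)))"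
      unfolding y_def using v P(1) T by (intro linear_on_sum [OF T]) (auto intro: subspace_scale)
    also have "\<dots> = (\<Sum>i\<le>m. scale (coeff q i) (v (Suc i)))"
      using T v by (intro sum.cong) (auto simp: linear_on_def Tv)
    finally have Ty: "T y = (\<Sum>i\<le>m. scale (coeff q i) (v (Suc i)))" .
    \<comment> \<open>This vanishing coefficient lets the sum for c y run one index further, so that
      it lines up with the coefficients of \<open>p\<close>.\<close>
    have "coeff q (Suc m) = 0" using dq by (simp add: coeff_eq_0)
    then have "scale c y = (\<Sum>i\<le>Suc m. scale (c * coeff q i) (v i))"
      unfolding y_def by (simp add: scale_sum_right)
    also have "\<dots> = scale (c * coeff q 0) (v 0) + (\<Sum>i\<le>m. scale (c * coeff q (Suc i)) (v (Suc i)))"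
      by (rule sum.atMost_Suc_shift)
    finally have "T y - scale c y = - scale (c * coeff q 0) (v 0)
        + (\<Sum>i\<le>m. scale (coeff q i - c * coeff q (Suc i)) (v (Suc i)))"
      unfolding Ty by (simp add: scale_left_diff_distrib sum_subtractf)
    also have "\<dots> = scale (coeff p 0) (v 0) + (\<Sum>i\<le>m. scale (coeff p (Suc i)) (v (Suc i)))"
      by (simp add: cq)
    also have "\<dots> = (\<Sum>i\<le>n. scale (coeff p i) (v i))"
      unfolding m by (rule sum.atMost_Suc_shift [symmetric])
    also have "\<dots> = 0" using a(1) by (simp add: cp)
    finally show ?thesis by simp
  qed
  ultimately show thesis using that by blast
qed

text \<open>Applying T - d to a relation removes the term of eigenvalue d and multiplies the others
  by the nonzero factors c - d.\<close>

lemma eigenvectors_independent: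
  assumes S: "subspace S" and T: "linear_on S T"
    and f: "\<And>c. c \<in> C \<Longrightarrow> f c \<in> S \<and> f c \<noteq> 0 \<and> T (f c) = scale c (f c)"
    and D: "D \<subseteq> C" "finite D" "(\<Sum>c\<in>D. scale (u c) (f c)) = 0"
  shows "\<forall>c\<in>D. u c = 0"
  using D(2,1,3)
proof (induction D arbitrary: u rule: finite_induct)
  case (insert d D)
  have "(\<Sum>c\<in>D. scale (u c * (c - d)) (f c)) = (\<Sum>c\<in>insert d D. scale (u c * c) (f c))
      - scale d (\<Sum>c\<in>insert d D. scale (u c) (f c))"
    using insert.hyps by (simp add: scale_sum_right sum_subtractf scale_left_diff_distrib
        right_diff_distrib mult.commute scale_right_distrib)
  also have "(\<Sum>c\<in>insert d D. scale (u c * c) (f c)) = T (\<Sum>c\<in>insert d D. scale (u c) (f c))"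
    using insert.prems(1) f T S
    by (subst linear_on_sum [OF T S]) (auto intro!: subspace_scale sum.cong simp: linear_on_def subset_iff)
  also have "\<dots> = 0"
    unfolding insert.prems(2) using T subspace_0 [OF S] linear_on_sum [OF T S, of "{}"] by simp
  finally have "(\<Sum>c\<in>D. scale (u c * (c - d)) (f c)) = 0" by (simp add: insert.prems(2))
  then have "\<forall>c\<in>D. u c * (c - d) = 0"
    using insert.IH [of "\<lambda>c. u c * (c - d)"] insert.prems(1) by blast
  then have D: "\<forall>c\<in>D. u c = 0" using insert.hyps by auto
  then have "scale (u d) (f d) = 0" using insert by simp
  then show ?case using D f insert.prems(1) by auto
qed simp

lemma independent_eigenvectors:
  assumes S: "subspace S" and T: "linear_on S T" and C: "finite C"
    and f: "\<And>c. c \<in> C \<Longrightarrow> f c \<in> S \<and> f c \<noteq> 0 \<and> T (f c) = scale c (f c)"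
  shows "inj_on f C" "independent (f ` C)"
proof -
  show inj: "inj_on f C"
  proof (rule inj_onI)
    fix c d assume cd: "c \<in> C" "d \<in> C" "f c = f d"
    then have "scale c (f c) = scale d (f c)" using f by metis
    then show "c = d" using f cd(1) by (metis scale_right_imp_eq)
  qed
  show "independent (f ` C)"
    unfolding dependent_finite [OF finite_imageI [OF C]]
  proof (intro notI, elim exE conjE)
    fix u assume u: "\<exists>v\<in>f ` C. u v \<noteq> 0" "(\<Sum>v\<in>f ` C. scale (u v) v) = 0"
    have "(\<Sum>c\<in>C. scale (u (f c)) (f c)) = 0"
      using u(2) sum.reindex [OF inj, of "\<lambda>x. scale (u x) x"] by (simp add: o_def)
    then have "\<forall>c\<in>C. u (f c) = 0"
      using eigenvectors_independent [OF S T f, of C C "\<lambda>c. u (f c)"] C by blast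
    with u(1) show False by blast
  qed
qed

text \<open>This finiteness is behind the nilpotency of raising and lowering operators, each step of
  which changes the eigenvalue.\<close>

lemma finite_eigenvalues:
  assumes S: "subspace S" and T: "linear_on S T"
  shows "finite {c. \<exists>x\<in>S. x \<noteq> 0 \<and> T x = scale c x}" (is "finite ?C")
proof (rule ccontr)
  assume "infinite ?C"
  then obtain C where C: "finite C" "card C = Suc (dim UNIV)" "C \<subseteq> ?C"
    using infinite_arbitrarily_large by blast
  then have "\<forall>c\<in>C. \<exists>x. x \<in> S \<and> x \<noteq> 0 \<and> T x = scale c x" by blast
  then obtain f where f: "\<And>c. c \<in> C \<Longrightarrow> f c \<in> S \<and> f c \<noteq> 0 \<and> T (f c) = scale c (f c)"
    by metis
  have "card C \<le> dim UNIV"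
    using independent_card_le_dim [of "f ` C" UNIV] independent_eigenvectors [OF S T C(1) f]
    by (simp add: card_image)
  with C(2) show False by simp
qed

end

locale hermitian_form = complex_vector_space scale Basis
  for scale :: "complex \<Rightarrow> 'b::ab_group_add \<Rightarrow> 'b" and Basis +
  fixes S :: "'b set" and ip :: "'b \<Rightarrow> 'b \<Rightarrow> complex"
  assumes S: "subspace S"
    and ip_add: "\<And>x y z. x \<in> S \<Longrightarrow> y \<in> S \<Longrightarrow> z \<in> S \<Longrightarrow> ip (x + y) z = ip x z + ip y z"
    and ip_scale: "\<And>c x z. x \<in> S \<Longrightarrow> z \<in> S \<Longrightarrow> ip (scale c x) z = c * ip x z"
    and ip_sym: "\<And>x y. x \<in> S \<Longrightarrow> y \<in> S \<Longrightarrow> ip y x = cnj (ip x y)"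
    and ip_definite: "\<And>x. x \<in> S \<Longrightarrow> x \<noteq> 0 \<Longrightarrow> ip x x \<noteq> 0"
begin

lemma ip_zero: "x \<in> S \<Longrightarrow> ip 0 x = 0" "x \<in> S \<Longrightarrow> ip x 0 = 0"
  using ip_scale [of 0 x 0] ip_sym [of 0 x] subspace_0 [OF S] by simp_all

lemma ip_add_right: "x \<in> S \<Longrightarrow> y \<in> S \<Longrightarrow> z \<in> S \<Longrightarrow> ip x (y + z) = ip x y + ip x z"
  using ip_add [of y z x] ip_sym [of "y + z" x] ip_sym [of y x] ip_sym [of z x] subspace_add [OF S, of y z]
  by simp

lemma ip_scale_right: "x \<in> S \<Longrightarrow> y \<in> S \<Longrightarrow> ip x (scale c y) = cnj c * ip x y"
  using ip_scale [of y x c] ip_sym [of "scale c y" x] ip_sym [of y x] subspace_scale [OF S, of y c]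
  by simp

lemma ip_diff: "x \<in> S \<Longrightarrow> y \<in> S \<Longrightarrow> z \<in> S \<Longrightarrow> ip (x - y) z = ip x z - ip y z"
  using ip_add [of x "scale (-1) y" z] ip_scale [of y z "-1"] subspace_scale [OF S, of y "-1"]
  by (simp add: scale_minus_left)

lemma ip_sum:
  assumes "\<And>i. i \<in> I \<Longrightarrow> f i \<in> S" "z \<in> S"
  shows "ip (\<Sum>i\<in>I. f i) z = (\<Sum>i\<in>I. ip (f i) z)"
  using assms(1)
proof (induction I rule: infinite_finite_induct)
  case (insert i I)
  then have "(\<Sum>i\<in>I. f i) \<in> S" by (intro subspace_sum [OF S]) auto
  with insert show ?case by (simp add: ip_add assms(2))
qed (simp_all add: ip_zero assms(2))

lemma orthogonal_span:
  assumes "A \<subseteq> S" "x \<in> S" "\<And>a. a \<in> A \<Longrightarrow> ip x a = 0" "y \<in> span A"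
  shows "ip x y = 0"
proof -
  have "subspace {y \<in> S. ip x y = 0}"
    unfolding subspace_def
    using S assms(2) by (auto simp: subspace_def ip_zero ip_add_right ip_scale_right)
  then have "span A \<subseteq> {y \<in> S. ip x y = 0}"
    by (intro span_minimal) (use assms in auto)
  then show ?thesis using assms(4) by blast
qed

lemma orthogonal_projection:
  assumes "finite A" "A \<subseteq> S" "0 \<notin> A" "pairwise (\<lambda>a b. ip a b = 0) A" "x \<in> S"
  shows "\<exists>p\<in>span A. \<forall>y\<in>span A. ip (x - p) y = 0"
proof -
  define p where "p = (\<Sum>a\<in>A. scale (ip x a / ip a a) a)"
  have p: "p \<in> span A" unfolding p_def by (intro span_sum span_scale span_base)
  then have pS: "p \<in> S" using span_minimal [OF assms(2) S] by blast
  have "ip (x - p) b = 0" if b: "b \<in> A" for b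
  proof -
    have bS: "b \<in> S" using b assms(2) by blast
    have "ip p b = (\<Sum>a\<in>A. ip (scale (ip x a / ip a a) a) b)"
      unfolding p_def using assms(2) bS by (intro ip_sum) (auto intro: subspace_scale [OF S])
    also have "\<dots> = (\<Sum>a\<in>A. if a = b then ip x b else 0)"
    proof (rule sum.cong [OF refl])
      fix a assume a: "a \<in> A"
      have "ip b b \<noteq> 0" using ip_definite [OF bS] b assms(3) by metis
      moreover have "a \<noteq> b \<Longrightarrow> ip a b = 0" using a b assms(4) by (auto simp: pairwise_def)
      moreover have "a \<in> S" using a assms(2) by blast
      ultimately show "ip (scale (ip x a / ip a a) a) b = (if a = b then ip x b else 0)"
        by (auto simp: ip_scale bS)
    qed
    also have "\<dots> = ip x b" using b assms(1) by simp
    finally show ?thesis by (simp add: ip_diff [OF assms(5) pS bS])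
  qed
  then show ?thesis
    using orthogonal_span [OF assms(2) subspace_diff [OF S assms(5) pS]] p by blast
qed

lemma orthogonal_basis:
  assumes "finite B" "B \<subseteq> S"
  shows "\<exists>A. finite A \<and> A \<subseteq> S \<and> 0 \<notin> A \<and> pairwise (\<lambda>a b. ip a b = 0) A \<and> span A = span B"
  using assms
proof (induction B rule: finite_induct)
  case empty
  then show ?case by (intro exI [of _ "{}"]) (auto simp: pairwise_def)
next
  case (insert b B)
  then obtain A where A: "finite A" "A \<subseteq> S" "0 \<notin> A" "pairwise (\<lambda>a b. ip a b = 0) A" "span A = span B"
    by auto
  have bS: "b \<in> S" using insert.prems by blast
  obtain p where p: "p \<in> span A" "\<forall>y\<in>span A. ip (b - p) y = 0"
    using orthogonal_projection [OF A(1-4) bS] by blast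
  have pS: "p \<in> S" using p(1) span_minimal [OF A(2) S] by blast
  show ?case
  proof (cases "b - p = 0")
    case True
    then have "b \<in> span B" using p(1) A(5) by simp
    then have "span (insert b B) = span B" by (rule span_redundant)
    with A show ?thesis by auto
  next
    case False
    have eq: "span (insert (b - p) A) = span (insert b B)"
    proof (rule antisym)
      show "span (insert (b - p) A) \<subseteq> span (insert b B)"
      proof (rule span_minimal [OF _ subspace_span], rule subsetI)
        fix x assume x: "x \<in> insert (b - p) A"
        have "span A \<subseteq> span (insert b B)" unfolding A(5) by (rule span_mono) blast
        moreover have "b \<in> span (insert b B)" by (rule span_base) simp
        moreover have "A \<subseteq> span A" by (rule span_superset)
        ultimately show "x \<in> span (insert b B)"
          using x p(1) by (blast intro: span_diff)
      qed
      show "span (insert b B) \<subseteq> span (insert (b - p) A)"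
      proof (rule span_minimal [OF _ subspace_span], rule subsetI)
        fix x assume x: "x \<in> insert b B"
        have sub: "span A \<subseteq> span (insert (b - p) A)" by (rule span_mono) blast
        have "(b - p) + p \<in> span (insert (b - p) A)"
          using p(1) sub by (intro span_add) (auto intro: span_base)
        moreover have "B \<subseteq> span A" unfolding A(5) by (rule span_superset)
        ultimately show "x \<in> span (insert (b - p) A)" using x sub by auto
      qed
    qed
    have orth: "ip (b - p) a = 0" "ip a (b - p) = 0" if "a \<in> A" for a
    proof -
      show 1: "ip (b - p) a = 0" using p(2) that span_base by blast
      have "a \<in> S" using that A(2) by blast
      then show "ip a (b - p) = 0"
        using 1 ip_sym [of "b - p" a] subspace_diff [OF S bS pS] by simp
    qed
    show ?thesis
      by (rule exI [of _ "insert (b - p) A"])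
        (use False in \<open>simp add: A eq orth subspace_diff [OF S bS pS] pairwise_insert\<close>)
  qed
qed

lemma subspace_orthogonal_basis:
  assumes "subspace P" "P \<subseteq> S"
  shows "\<exists>A. finite A \<and> A \<subseteq> S \<and> 0 \<notin> A \<and> pairwise (\<lambda>a b. ip a b = 0) A \<and> span A = P"
proof -
  obtain B where B: "B \<subseteq> P" "independent B" "P \<subseteq> span B" by (rule basis_exists [of P])
  have "span B = P" by (rule span_subspace [OF B(1,3) assms(1)])
  then show ?thesis
    using orthogonal_basis [OF finiteI_independent [OF B(2)] order.trans [OF B(1) assms(2)]] by simp
qed

lemma orthogonal_vector_exists:
  assumes P: "subspace P" "P \<subseteq> S" "P \<noteq> S"
  obtains x where "x \<in> S" "x \<noteq> 0" "\<And>y. y \<in> P \<Longrightarrow> ip x y = 0"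
proof -
  obtain A where A: "finite A" "A \<subseteq> S" "0 \<notin> A" "pairwise (\<lambda>a b. ip a b = 0) A" "span A = P"
    using subspace_orthogonal_basis [OF P(1,2)] by blast
  obtain z where z: "z \<in> S" "z \<notin> P" using P by blast
  obtain p where p: "p \<in> P" "\<forall>y\<in>P. ip (z - p) y = 0"
    using orthogonal_projection [OF A(1-4) z(1)] A(5) by blast
  show thesis
  proof (rule that [of "z - p"])
    show "z - p \<in> S" using p(1) z(1) P(2) by (intro subspace_diff [OF S]) auto
    show "z - p \<noteq> 0" using p(1) z(2) by auto
  qed (use p in blast)
qed

text \<open>Induction on the dimension: a member of \<open>F\<close> that is not scalar on
  \<open>P\<close> has an eigenspace in \<open>P\<close> that is nonzero, proper, and stable under
  all of \<open>F\<close> by commutation.\<close>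

lemma joint_eigenvector_exists:
  assumes P: "subspace P" "P \<subseteq> S" "P \<noteq> {0}"
    and F: "\<And>T. T \<in> F \<Longrightarrow> linear_on S T" "\<And>T x. T \<in> F \<Longrightarrow> x \<in> P \<Longrightarrow> T x \<in> P"
    and comm: "\<And>T U x. T \<in> F \<Longrightarrow> U \<in> F \<Longrightarrow> x \<in> S \<Longrightarrow> T (U x) = U (T x)"
  shows "\<exists>x\<in>P. x \<noteq> 0 \<and> (\<forall>T\<in>F. \<exists>c. T x = scale c x)"
  using P F(2)
proof (induction "dim P" arbitrary: P rule: less_induct)
  case less
  show ?case
  proof (cases "\<forall>T\<in>F. \<exists>c. \<forall>x\<in>P. T x = scale c x")
    case True
    obtain x where "x \<in> P" "x \<noteq> 0" using less.prems subspace_0 by blast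
    with True show ?thesis by (intro bexI [of _ x]) auto
  next
    case False
    then obtain T where T: "T \<in> F" "\<And>c. \<exists>x\<in>P. T x \<noteq> scale c x" by blast
    have linP: "linear_on P T"
      using F(1) [OF T(1)] less.prems(4) [OF T(1)] less.prems(2) unfolding linear_on_def
      by (simp add: subset_iff)
    obtain x c where xc: "x \<in> P" "x \<noteq> 0" "T x = scale c x"
      by (rule eigenvector_exists [OF less.prems(1,3) linP])
    define P' where "P' = {x \<in> P. T x = scale c x}"
    have "T 0 = 0" using linear_on_sum [OF linP less.prems(1), of "{}"] by simp
    then have sub: "subspace P'"
      using less.prems(1) linP unfolding P'_def subspace_def linear_on_def
      by (auto simp: scale_right_distrib mult.commute)
    have "P' \<subset> P" using T(2) [of c] unfolding P'_def by blast
    then have "dim P' < dim P"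
      using subspace_dim_equal [OF sub less.prems(1)] dim_subset [of P' P] by fastforce
    moreover have "P' \<noteq> {0}" using xc unfolding P'_def by blast
    moreover have "U y \<in> P'" if U: "U \<in> F" and y: "y \<in> P'" for U y
    proof -
      have yS: "y \<in> S" "y \<in> P" "T y = scale c y" using y less.prems(2) unfolding P'_def by auto
      have "T (U y) = U (scale c y)" using comm [OF T(1) U yS(1)] yS(3) by simp
      also have "\<dots> = scale c (U y)" using F(1) [OF U] yS(1) by (simp add: linear_on_def)
      finally show ?thesis unfolding P'_def using less.prems(4) U yS by simp
    qed
    moreover have "P' \<subseteq> S" using \<open>P' \<subset> P\<close> less.prems(2) by blast
    ultimately have "\<exists>x\<in>P'. x \<noteq> 0 \<and> (\<forall>T\<in>F. \<exists>c. T x = scale c x)"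
      using sub by (intro less.hyps)
    then show ?thesis using \<open>P' \<subset> P\<close> by blast
  qed
qed

text \<open>As \<open>F\<close> contains adjoints of its members, the orthogonal complement of the
  joint eigenvectors is stable under \<open>F\<close>. A joint eigenvector inside it would be
  orthogonal to itself.\<close>

lemma joint_diagonalization:
  assumes F: "\<And>T. T \<in> F \<Longrightarrow> linear_on S T"
    and comm: "\<And>T U x. T \<in> F \<Longrightarrow> U \<in> F \<Longrightarrow> x \<in> S \<Longrightarrow> T (U x) = U (T x)"
    and adj: "\<And>T. T \<in> F \<Longrightarrow> \<exists>T'\<in>F. \<forall>x\<in>S. \<forall>y\<in>S. ip (T x) y = ip x (T' y)"
  shows "S \<subseteq> span {x \<in> S. \<forall>T\<in>F. \<exists>c. T x = scale c x}" (is "_ \<subseteq> span ?E")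
proof (rule ccontr)
  assume *: "\<not> S \<subseteq> span ?E"
  define E where "E = ?E"
  have ES: "E \<subseteq> S" and E: "\<And>x T. x \<in> E \<Longrightarrow> T \<in> F \<Longrightarrow> \<exists>c. T x = scale c x"
    unfolding E_def by auto
  have PS: "span E \<subseteq> S" by (rule span_minimal [OF ES S])
  define R where "R = {x \<in> S. \<forall>y\<in>E. ip x y = 0}"
  have R: "subspace R"
    unfolding subspace_def
  proof (intro conjI ballI allI)
    show "0 \<in> R" using ES subspace_0 [OF S] by (simp add: R_def ip_zero subset_iff)
  next
    fix x y assume "x \<in> R" "y \<in> R"
    then show "x + y \<in> R" using ES subspace_add [OF S] by (simp add: R_def ip_add subset_iff)
  next
    fix c x assume "x \<in> R"
    then show "scale c x \<in> R" using ES subspace_scale [OF S] by (simp add: R_def ip_scale subset_iff)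
  qed
  have "span E \<noteq> S" using * unfolding E_def by blast
  then obtain x where x: "x \<in> S" "x \<noteq> 0" "\<And>y. y \<in> span E \<Longrightarrow> ip x y = 0"
    using orthogonal_vector_exists [OF subspace_span PS] by metis
  have "\<exists>x\<in>R. x \<noteq> 0 \<and> (\<forall>T\<in>F. \<exists>c. T x = scale c x)"
  proof (rule joint_eigenvector_exists [OF R])
    show "R \<subseteq> S" by (auto simp: R_def)
    have "x \<in> R" using x(1,3) span_base [of _ E] by (simp add: R_def)
    then show "R \<noteq> {0}" using x(2) by blast
    show "linear_on S T" if "T \<in> F" for T using F that .
    show "T (U x) = U (T x)" if "T \<in> F" "U \<in> F" "x \<in> S" for T U x using comm that .
    fix T x assume T: "T \<in> F" and x: "x \<in> R"
    then have xS: "x \<in> S" and xE: "\<And>y. y \<in> E \<Longrightarrow> ip x y = 0" by (auto simp: R_def)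
    obtain T' where T': "T' \<in> F" "\<forall>x\<in>S. \<forall>y\<in>S. ip (T x) y = ip x (T' y)" using adj [OF T] by blast
    have "ip (T x) y = 0" if y: "y \<in> E" for y
    proof -
      obtain c where c: "T' y = scale c y" using E [OF y T'(1)] by blast
      have yS: "y \<in> S" using y ES by blast
      have "ip (T x) y = ip x (T' y)" using T'(2) xS yS by blast
      then show ?thesis by (simp add: c ip_scale_right [OF xS yS] xE [OF y])
    qed
    then show "T x \<in> R" using F [OF T] xS by (simp add: R_def linear_on_def)
  qed
  then obtain y where y: "y \<in> R" "y \<noteq> 0" "\<forall>T\<in>F. \<exists>c. T y = scale c y" by blast
  then have yS: "y \<in> S" and "y \<in> E" by (auto simp: R_def E_def)
  then have "ip y y = 0" using y(1) by (simp add: R_def)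
  then show False using ip_definite [OF yS y(2)] by simp
qed

end

section \<open>The centre of the derivation algebra of the octonions\<close>

lemma UNIV_7: "(UNIV :: 7 set) = {0, 1, 2, 3, 4, 5, 6}"
proof -
  have "card {0, 1, 2, 3, 4, 5, 6 :: 7} = CARD(7)" by simp
  then show ?thesis by (metis card_subset_eq finite subset_UNIV)
qed

lemma numeral_7: "(7 :: 7) = 0" "(8 :: 7) = 1" "(9 :: 7) = 2"
  by simp_all

lemma sum_7: "(\<Sum>i\<in>(UNIV :: 7 set). f i) = f 0 + f 1 + f 2 + f 3 + f 4 + f 5 + (f 6 :: 'a::comm_monoid_add)"
  unfolding UNIV_7 by (simp add: add.assoc)

lemma forall_7: "(\<forall>i :: 7. P i) \<longleftrightarrow> P 0 \<and> P 1 \<and> P 2 \<and> P 3 \<and> P 4 \<and> P 5 \<and> P 6"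
  using UNIV_7 by (metis (full_types) UNIV_I insertE singletonD)

lemma octonion_form_eq:
  "octonion_form u v w = (\<Sum>i\<in>UNIV.
     u $ i * (v $ (i + 1) * w $ (i + 3) - v $ (i + 3) * w $ (i + 1))
   + u $ (i + 1) * (v $ (i + 3) * w $ i - v $ i * w $ (i + 3))
   + u $ (i + 3) * (v $ i * w $ (i + 1) - v $ (i + 1) * w $ i))"
  unfolding octonion_form_def det_3 vector_3 by (intro sum.cong refl) (simp add: algebra_simps)

definition shift :: "7 \<Rightarrow> complex^7 \<Rightarrow> complex^7"
  where "shift k u = (\<chi> i. u $ (i + k))"

lemma sum_shift: "(\<Sum>i\<in>UNIV. g (i + k)) = (\<Sum>i\<in>UNIV. g i)" for k :: 7
proof (rule sum.reindex_bij_betw)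
  show "bij (\<lambda>i. i + k)" by (rule bij_betw_byWitness [of _ "\<lambda>i. i - k"]) auto
qed

text \<open>Translation of the indices modulo 7 permutes the terms of the 3-form, so membership of
  \<open>rot k\<close> in \<open>g2\<close> has to be computed for k = 0 alone.\<close>

lemma octonion_form_shift: "octonion_form (shift k u) (shift k v) (shift k w) = octonion_form u v w"
proof -
  have *: "i + 1 + k = i + k + 1" "i + 3 + k = i + k + 3" for i
    by (simp_all only: add.assoc add.commute [of k])
  show ?thesis
    unfolding octonion_form_eq shift_def vec_lambda_beta *
    by (rule trans [OF _ sum_shift [of _ k]], rule refl)
qed

text \<open>
  The elements of \<^const>\<open>g2\<close> annihilating the \<open>k\<close>-th basis vector form a copy of
  \<open>\<ss>\<ll>\<^sub>3\<close>. This is a diagonal element with eigenvalues \<open>\<plusminus>\<i>, \<plusminus>\<i>, \<plusminus>2\<i>\<close> on the other basis vectors.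
\<close>

definition rot_entry :: "7 \<Rightarrow> 7 \<Rightarrow> complex"
  where "rot_entry r c =
    (if r = 3 \<and> c = 1 then 1 else if r = 1 \<and> c = 3 then - 1
     else if r = 6 \<and> c = 2 then 1 else if r = 2 \<and> c = 6 then - 1
     else if r = 5 \<and> c = 4 then - 2 else if r = 4 \<and> c = 5 then 2 else 0)"

definition rot :: "7 \<Rightarrow> complex^7^7"
  where "rot k = (\<chi> r c. rot_entry (r - k) (c - k))"

lemma rot_0_mult:
  "(rot 0 *v u) $ 0 = 0" "(rot 0 *v u) $ 1 = - u $ 3" "(rot 0 *v u) $ 2 = - u $ 6"
  "(rot 0 *v u) $ 3 = u $ 1" "(rot 0 *v u) $ 4 = 2 * u $ 5" "(rot 0 *v u) $ 5 = - 2 * u $ 4"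
  "(rot 0 *v u) $ 6 = u $ 2"
  by (simp_all add: rot_def matrix_vector_mult_def sum_7 rot_entry_def)

lemma shift_rot: "shift k (rot k *v u) = rot 0 *v shift k u"
proof -
  have "(\<Sum>c\<in>UNIV. rot_entry i c * u $ (c + k)) = (\<Sum>c\<in>UNIV. rot_entry i (c - k) * u $ c)" for i
    using sum_shift [of "\<lambda>c. rot_entry i (c - k) * u $ c" k] by simp
  then show ?thesis
    by (simp add: shift_def rot_def matrix_vector_mult_def vec_eq_iff)
qed

lemma rot_g2: "rot k \<in> g2"
proof -
  have 0: "octonion_form (rot 0 *v u) v w + octonion_form u (rot 0 *v v) w + octonion_form u v (rot 0 *v w) = 0"
    for u v w
    unfolding octonion_form_eq sum_7 by (simp add: numeral_7 rot_0_mult) (simp add: algebra_simps)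
  show ?thesis
    unfolding g2_def mem_Collect_eq
  proof (intro allI)
    fix u v w
    show "octonion_form (rot k *v u) v w + octonion_form u (rot k *v v) w + octonion_form u v (rot k *v w) = 0"
      using 0 [of "shift k u" "shift k v" "shift k w"]
      by (simp add: shift_rot [symmetric] octonion_form_shift)
  qed
qed

text \<open>A central z preserves the kernel of every \<open>rot k\<close>, the line of the k-th
  basis vector, so z is diagonal. Off-diagonal entries of the commutation relations make its
  diagonal entries equal, and a scalar c acts on the 3-form as multiplication by 3 c.\<close>

lemma g2_centre:
  assumes "z \<in> g2" "\<And>A. A \<in> g2 \<Longrightarrow> bracket z A = 0"
  shows "z = 0"
proof -
  have comm: "z ** rot k = rot k ** z" for k
    using assms(2) [OF rot_g2] by (simp add: bracket_def)
  have entry: "(\<Sum>j\<in>UNIV. z $ r $ j * rot k $ j $ c) = (\<Sum>j\<in>UNIV. rot k $ r $ j * z $ j $ c)" for k r c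
    using arg_cong [OF comm, of "\<lambda>A. A $ r $ c"] by (simp add: matrix_matrix_mult_def)
  have kernel: "x $ j = 0" if "rot k *v x = 0" "j \<noteq> k" for k x j
  proof -
    have "rot 0 *v shift k x = 0" using that(1) shift_rot [of k x] by (simp add: shift_def vec_eq_iff)
    then have "shift k x $ 1 = 0 \<and> shift k x $ 2 = 0 \<and> shift k x $ 3 = 0 \<and> shift k x $ 4 = 0
      \<and> shift k x $ 5 = 0 \<and> shift k x $ 6 = 0"
      using rot_0_mult [of "shift k x"] by simp
    then have "\<forall>i. i \<noteq> 0 \<longrightarrow> shift k x $ i = 0" unfolding forall_7 by simp
    then show ?thesis using that(2) by (auto simp: shift_def dest: spec [of _ "j - k"])
  qed
  have off: "z $ j $ k = 0" if "j \<noteq> k" for j k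
  proof -
    have "rot k $ j $ k = 0" for j by (simp add: rot_def rot_entry_def)
    then have "rot k *v (\<chi> j. z $ j $ k) = 0"
      using entry [of _ k k] by (simp add: vec_eq_iff matrix_vector_mult_def)
    from kernel [OF this that] show ?thesis by simp
  qed
  \<comment> \<open>\<open>rot k\<close> links the indices k + 1 and k + 3; since 2 generates the
    residues modulo 7, all diagonal entries become connected.\<close>
  have step: "z $ (k + 1) $ (k + 1) = z $ (k + 3) $ (k + 3)" for k
  proof -
    have 1: "(\<Sum>j\<in>UNIV. z $ (k + 1) $ j * rot k $ j $ (k + 3)) = z $ (k + 1) $ (k + 1) * rot k $ (k + 1) $ (k + 3)"
      using off [of "k + 1"] by (subst sum.remove [of _ "k + 1"]) auto
    have 2: "(\<Sum>j\<in>UNIV. rot k $ (k + 1) $ j * z $ j $ (k + 3)) = rot k $ (k + 1) $ (k + 3) * z $ (k + 3) $ (k + 3)"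
      using off [of _ "k + 3"] by (subst sum.remove [of _ "k + 3"]) auto
    have "rot k $ (k + 1) $ (k + 3) = - 1" by (simp add: rot_def rot_entry_def)
    then show ?thesis using entry [of "k + 1" k "k + 3"] unfolding 1 2 by simp
  qed
  define c where "c = z $ 0 $ 0"
  have "\<forall>k. z $ k $ k = c"
    unfolding forall_7 c_def
    using step [of 0] step [of 1] step [of 2] step [of 3] step [of 4] step [of 5] step [of 6]
    by (simp add: numeral_7)
  then have z: "z *v u = c *s u" for u
  proof -
    assume *: "\<forall>k. z $ k $ k = c"
    show ?thesis
      unfolding vec_eq_iff
    proof
      fix i
      have "(z *v u) $ i = z $ i $ i * u $ i"
        unfolding matrix_vector_mult_def using off [of i] by (simp, subst sum.remove [of _ i]) auto
      then show "(z *v u) $ i = (c *s u) $ i" using * by simp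
    qed
  qed
  let ?e = "\<lambda>i. axis i 1 :: complex^7"
  \<comment> \<open>The term i = 0 of the form is 1 on these three basis vectors and the other terms
    vanish, so the identity reads 3 c = 0.\<close>
  have "octonion_form (z *v ?e 0) (?e 1) (?e 3) + octonion_form (?e 0) (z *v ?e 1) (?e 3)
      + octonion_form (?e 0) (?e 1) (z *v ?e 3) = 0"
    using assms(1) unfolding g2_def by blast
  then have "c = 0"
    unfolding z octonion_form_eq sum_7 by (simp add: numeral_7 axis_def)
  then have "z *v u = 0" for u by (simp add: z)
  then show ?thesis by (metis matrix_eq matrix_vector_mult_0)
qed

section \<open>Modules over the three-dimensional simple Lie algebra\<close>

locale sl2_module = complex_vector_space scale Basis
  for scale :: "complex \<Rightarrow> 'b::ab_group_add \<Rightarrow> 'b" and Basis +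
  fixes S :: "'b set" and e f h :: "'b \<Rightarrow> 'b"
  assumes S: "subspace S"
    and e_linear: "linear_on S e" and f_linear: "linear_on S f" and h_linear: "linear_on S h"
    and he: "\<And>x. x \<in> S \<Longrightarrow> h (e x) = e (h x) + scale 2 (e x)"
    and hf: "\<And>x. x \<in> S \<Longrightarrow> h (f x) = f (h x) - scale 2 (f x)"
    and ef: "\<And>x. x \<in> S \<Longrightarrow> e (f x) = f (e x) + h x"
begin

lemma e_closed: "x \<in> S \<Longrightarrow> (e ^^ k) x \<in> S"
  by (induction k) (use e_linear in \<open>auto simp: linear_on_def\<close>)

lemma f_closed: "x \<in> S \<Longrightarrow> (f ^^ k) x \<in> S"
  by (induction k) (use f_linear in \<open>auto simp: linear_on_def\<close>)

lemma linear_zero: "linear_on S T \<Longrightarrow> T 0 = 0"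
  using linear_on_sum [OF _ S, of T "{}"] by simp

lemma linear_scale: "linear_on S T \<Longrightarrow> x \<in> S \<Longrightarrow> T (scale c x) = scale c (T x)"
  by (simp add: linear_on_def)

lemma e_weight:
  assumes "x \<in> S" "h x = scale c x"
  shows "h ((e ^^ k) x) = scale (c + 2 * of_nat k) ((e ^^ k) x)"
proof (induction k)
  case (Suc k)
  show ?case
    by (simp add: he [OF e_closed [OF assms(1)]] Suc linear_scale [OF e_linear e_closed [OF assms(1)]])
      (simp add: algebra_simps)
qed (simp add: assms)

lemma f_weight:
  assumes "x \<in> S" "h x = scale c x"
  shows "h ((f ^^ k) x) = scale (c - 2 * of_nat k) ((f ^^ k) x)"
proof (induction k)
  case (Suc k)
  show ?case
    by (simp add: hf [OF f_closed [OF assms(1)]] Suc linear_scale [OF f_linear f_closed [OF assms(1)]])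
      (simp add: algebra_simps)
qed (simp add: assms)

text \<open>Otherwise the vectors T k would be eigenvectors of \<open>h\<close> for infinitely many
  different eigenvalues.\<close>

lemma nilpotent_on_weight_vector:
  assumes x: "x \<in> S" and T: "\<And>k. T k \<in> S" "\<And>k. h (T k) = scale (c + d * of_nat k) (T k)" "d \<noteq> 0"
  shows "\<exists>k :: nat. T k = 0"
proof (rule ccontr)
  assume "\<not> ?thesis"
  then have "range (\<lambda>k. c + d * of_nat k) \<subseteq> {c. \<exists>x\<in>S. x \<noteq> 0 \<and> h x = scale c x}"
    using T by blast
  then have "finite (range (\<lambda>k :: nat. c + d * of_nat k))"
    using finite_eigenvalues [OF S h_linear] finite_subset by blast
  moreover have "inj (\<lambda>k :: nat. c + d * of_nat k)"
    using T(3) by (auto simp: inj_on_def)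
  ultimately show False using finite_imageD by blast
qed

text \<open>By induction e f^(k+1) u = (k+1) (c - k) f^k u. For the last nonzero power f^n u the
  left side vanishes at k = n, which leaves c = n.\<close>

lemma primitive_vector:
  assumes u: "u \<in> S" "u \<noteq> 0" "e u = 0" "h u = scale c u"
  obtains n :: nat where "c = of_nat n" "\<And>j. j \<le> n \<Longrightarrow> (f ^^ j) u \<noteq> 0"
proof -
  have fS: "(f ^^ k) u \<in> S" for k by (rule f_closed [OF u(1)])
  have eq: "e ((f ^^ Suc k) u) = scale (of_nat (Suc k) * (c - of_nat k)) ((f ^^ k) u)" for k
  proof (induction k)
    case 0
    then show ?case using ef [OF u(1)] u linear_zero [OF f_linear] by simp
  next
    case (Suc k)
    have "e ((f ^^ Suc (Suc k)) u) = f (e ((f ^^ Suc k) u)) + h ((f ^^ Suc k) u)"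
      using ef [OF fS [of "Suc k"]] by simp
    also have "\<dots> = scale (of_nat (Suc k) * (c - of_nat k)) ((f ^^ Suc k) u)
        + scale (c - 2 * of_nat (Suc k)) ((f ^^ Suc k) u)"
      unfolding Suc f_weight [OF u(1,4)] linear_scale [OF f_linear fS] by simp
    also have "\<dots> = scale (of_nat (Suc k) * (c - of_nat k) + (c - 2 * of_nat (Suc k))) ((f ^^ Suc k) u)"
      by (rule scale_left_distrib [symmetric])
    also have "of_nat (Suc k) * (c - of_nat k) + (c - 2 * of_nat (Suc k)) = of_nat (Suc (Suc k)) * (c - of_nat (Suc k))"
      by (simp add: algebra_simps)
    finally show ?case .
  qed
  have ex: "\<exists>k. (f ^^ k) u = 0"
    by (rule nilpotent_on_weight_vector [OF u(1) fS, where c = c and d = "- 2"])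
      (simp_all add: f_weight [OF u(1,4)])
  define N where "N = (LEAST k. (f ^^ k) u = 0)"
  have N: "(f ^^ N) u = 0" unfolding N_def using ex by (rule LeastI_ex)
  have nz: "(f ^^ k) u \<noteq> 0" if "k < N" for k using not_less_Least that unfolding N_def by blast
  have "N \<noteq> 0"
  proof
    assume "N = 0"
    with N u(2) show False by simp
  qed
  then obtain n where n: "N = Suc n" using not0_implies_Suc by blast
  have "scale (of_nat (Suc n) * (c - of_nat n)) ((f ^^ n) u) = 0"
    using eq [of n] N n linear_zero [OF e_linear] by simp
  then have "c = of_nat n" using nz [of n] n by (simp del: of_nat_Suc)
  then show thesis using that nz n by simp
qed

text \<open>Raising x as long as possible ends in a primitive vector of weight c + 2 s, and from
  there the lowering operator survives that many steps.\<close>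

lemma weight_string:
  assumes x: "x \<in> S" "x \<noteq> 0" "h x = scale c x"
  shows "\<exists>s. (\<exists>n :: nat. c + 2 * of_nat s = of_nat n \<and> (\<forall>j\<le>n. (f ^^ j) ((e ^^ s) x) \<noteq> 0))"
proof -
  have eS: "(e ^^ k) x \<in> S" for k by (rule e_closed [OF x(1)])
  have ex: "\<exists>k. (e ^^ k) x = 0"
    by (rule nilpotent_on_weight_vector [OF x(1) eS, where c = c and d = 2])
      (simp_all add: e_weight [OF x(1,3)])
  define N where "N = (LEAST k. (e ^^ k) x = 0)"
  have N: "(e ^^ N) x = 0" unfolding N_def using ex by (rule LeastI_ex)
  have nz: "(e ^^ k) x \<noteq> 0" if "k < N" for k using not_less_Least that unfolding N_def by blast
  have "N \<noteq> 0"
  proof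
    assume "N = 0"
    with N x(2) show False by simp
  qed
  then obtain s where s: "N = Suc s" using not0_implies_Suc by blast
  have "e ((e ^^ s) x) = 0" using N s by simp
  then show ?thesis
    using primitive_vector [OF eS [of s] nz [of s] _ e_weight [OF x(1,3)]] s by (metis lessI)
qed

lemma weight_integral:
  assumes "x \<in> S" "x \<noteq> 0" "h x = scale c x"
  obtains k :: int where "c = of_int k"
proof -
  obtain s n where "c + 2 * of_nat s = of_nat n" using weight_string [OF assms] by blast
  then have "c = of_int (int n - 2 * int s)" by (simp add: algebra_simps)
  then show thesis using that by blast
qed

text \<open>A nonzero vector j steps below x is found by going up s steps to the top of a string and
  down j + s steps. This detour takes the place of complete reducibility; it fits since j + s \<le>
  n + 2 s.\<close>

lemma weight_string_down:
  assumes "x \<in> S" "x \<noteq> 0" "h x = scale (of_nat n) x" "j \<le> n"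
  obtains s where "(f ^^ (j + s)) ((e ^^ s) x) \<noteq> 0"
proof -
  obtain s m where s: "of_nat n + 2 * of_nat s = (of_nat m :: complex)" "\<forall>j\<le>m. (f ^^ j) ((e ^^ s) x) \<noteq> 0"
    using weight_string [OF assms(1-3)] by blast
  then have "n + 2 * s = m" by (metis of_nat_add of_nat_eq_iff of_nat_mult of_nat_numeral)
  then have "j + s \<le> m" using assms(4) by simp
  then show thesis using s(2) that by blast
qed

text \<open>Exchanging the roles of e and f turns statements about lowering into statements about
  raising.\<close>

lemma opposite: "sl2_module scale Basis S f e (\<lambda>x. - h x)"
proof
  show "linear_on S (\<lambda>x. - h x)"
    using h_linear subspace_neg [OF S] unfolding linear_on_def by (simp add: scale_minus_right)
next
  fix x assume x: "x \<in> S"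
  have "f (- h x) = - f (h x)"
    using linear_scale [OF f_linear, of "h x" "- 1"] h_linear x by (simp add: linear_on_def)
  then show "- h (f x) = f (- h x) + scale 2 (f x)" by (simp add: hf [OF x])
  have "e (- h x) = - e (h x)"
    using linear_scale [OF e_linear, of "h x" "- 1"] h_linear x by (simp add: linear_on_def)
  then show "- h (e x) = e (- h x) - scale 2 (e x)" by (simp add: he [OF x])
  show "f (e x) = e (f x) + - h x" by (simp add: ef [OF x])
qed (use S e_linear f_linear in auto)

end

text \<open>\<open>complex_vector_space\<close> wants a fixed finite basis; for matrices any one
  will do.\<close>

definition cmat_basis :: "(complex^'n^'m) set"
  where "cmat_basis = (SOME B. finite B \<and> cmat.independent B \<and> cmat.span B = UNIV)"

lemma cmat_basis: "finite cmat_basis" "cmat.independent cmat_basis" "cmat.span cmat_basis = UNIV"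
proof -
  let ?E = "\<lambda>(a, b). (\<chi> i j. if i = a \<and> j = b then 1 else 0) :: complex^'n^'m"
  have span: "cmat.span (range ?E) = UNIV"
  proof -
    have "A \<in> cmat.span (range ?E)" for A :: "complex^'n^'m"
    proof -
      have "A = (\<Sum>p\<in>UNIV. cscale (A $ fst p $ snd p) (?E p))"
      proof (rule matrix_eqI)
        fix i j
        have "(\<Sum>p\<in>UNIV. cscale (A $ fst p $ snd p) (?E p)) $ i $ j
          = (\<Sum>p\<in>UNIV. if p = (i, j) then A $ i $ j else 0)"
          unfolding sum_component by (rule sum.cong) (auto split: prod.splits)
        then show "A $ i $ j = (\<Sum>p\<in>UNIV. cscale (A $ fst p $ snd p) (?E p)) $ i $ j" by simp
      qed
      moreover have "(\<Sum>p\<in>UNIV. cscale (A $ fst p $ snd p) (?E p)) \<in> cmat.span (range ?E)"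
        by (intro cmat.span_sum cmat.span_scale cmat.span_base) blast
      ultimately show ?thesis by simp
    qed
    then show ?thesis by blast
  qed
  obtain B :: "(complex^'n^'m) set" where B: "cmat.independent B" "UNIV \<subseteq> cmat.span B"
    by (rule cmat.basis_exists [of UNIV])
  have "finite B"
    using cmat.independent_span_bound [of "range ?E" B] B(1) unfolding span by simp
  with B have "\<exists>B :: (complex^'n^'m) set. finite B \<and> cmat.independent B \<and> cmat.span B = UNIV" by blast
  from someI_ex [OF this]
  show "finite (cmat_basis :: (complex^'n^'m) set)" "cmat.independent (cmat_basis :: (complex^'n^'m) set)"
    "cmat.span (cmat_basis :: (complex^'n^'m) set) = UNIV"
    unfolding cmat_basis_def by blast+
qed

global_interpretation cmatf: complex_vector_space "cscale :: complex \<Rightarrow> complex^'n^'m \<Rightarrow> complex^'n^'m" cmat_basis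
  by unfold_locales (simp_all add: cmat_basis)

global_interpretation vecf: complex_vector_space "(*s) :: complex \<Rightarrow> complex^'n \<Rightarrow> complex^'n" cart_basis
  by unfold_locales

section \<open>Self-adjoint Lie algebras\<close>

text \<open>\<open>h\<close> will be the Hermitian form of the polarization and \<open>star\<close>
  the adjoint for it, lifted to \<gg>. \<open>maximal\<close> will come from the dimension of \<tt>
  being the rank, \<open>centreless\<close> from the isomorphism with \<open>g2\<close>.\<close>

locale selfadjoint_rep =
  fixes \<gg> \<tt> :: "(complex^'N^'N) set" and \<rho> :: "complex^'N^'N \<Rightarrow> complex^'n^'n"
    and star :: "complex^'N^'N \<Rightarrow> complex^'N^'N" and h :: "complex^'n \<Rightarrow> complex^'n \<Rightarrow> complex"
  assumes g_subspace: "cmat.subspace \<gg>" and g_bracket: "X \<in> \<gg> \<Longrightarrow> Y \<in> \<gg> \<Longrightarrow> bracket X Y \<in> \<gg>"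
    and t_subspace: "cmat.subspace \<tt>" and t_g: "\<tt> \<subseteq> \<gg>"
    and t_abelian: "H \<in> \<tt> \<Longrightarrow> H' \<in> \<tt> \<Longrightarrow> bracket H H' = 0"
    and rho_add: "\<rho> (X + Y) = \<rho> X + \<rho> Y" and rho_cscale: "\<rho> (cscale c X) = cscale c (\<rho> X)"
    and rho_bracket: "X \<in> \<gg> \<Longrightarrow> Y \<in> \<gg> \<Longrightarrow> \<rho> (bracket X Y) = bracket (\<rho> X) (\<rho> Y)"
    and rho_inj: "inj_on \<rho> \<gg>"
    and star_g: "X \<in> \<gg> \<Longrightarrow> star X \<in> \<gg>" and star_t: "H \<in> \<tt> \<Longrightarrow> star H \<in> \<tt>"
    and h_add: "h (u + v) w = h u w + h v w" and h_scale: "h (c *s u) w = c * h u w"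
    and h_sym: "h v u = cnj (h u v)"
    and h_pos: "v \<noteq> 0 \<Longrightarrow> \<exists>r>0. h v v = complex_of_real r"
    and h_adjoint: "X \<in> \<gg> \<Longrightarrow> h (\<rho> X *v u) v = h u (\<rho> (star X) *v v)"
    and maximal: "toral_subalgebra \<gg> \<aa> \<Longrightarrow> \<tt> \<subseteq> \<aa> \<Longrightarrow> \<aa> = \<tt>"
    and centreless: "Z \<in> \<gg> \<Longrightarrow> (\<And>Y. Y \<in> \<gg> \<Longrightarrow> bracket Z Y = 0) \<Longrightarrow> Z = 0"
begin

sublocale hf: hermitian_form "(*s)" cart_basis UNIV h
proof
  show "h x x \<noteq> 0" if "x \<noteq> 0" for x using h_pos [OF that] by auto
qed (simp_all add: h_add h_scale h_sym [symmetric] vec.subspace_UNIV)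

lemma g_add: "X \<in> \<gg> \<Longrightarrow> Y \<in> \<gg> \<Longrightarrow> X + Y \<in> \<gg>"
  and g_cscale: "X \<in> \<gg> \<Longrightarrow> cscale c X \<in> \<gg>"
  and g_diff: "X \<in> \<gg> \<Longrightarrow> Y \<in> \<gg> \<Longrightarrow> X - Y \<in> \<gg>"
  and g_zero: "0 \<in> \<gg>"
  using g_subspace by (auto intro: cmat.subspace_add cmat.subspace_scale cmat.subspace_diff
      cmat.subspace_0)

lemma t_add: "X \<in> \<tt> \<Longrightarrow> Y \<in> \<tt> \<Longrightarrow> X + Y \<in> \<tt>"
  and t_cscale: "X \<in> \<tt> \<Longrightarrow> cscale c X \<in> \<tt>"
  and t_diff: "X \<in> \<tt> \<Longrightarrow> Y \<in> \<tt> \<Longrightarrow> X - Y \<in> \<tt>"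
  using t_subspace by (auto intro: cmat.subspace_add cmat.subspace_scale cmat.subspace_diff)

lemma t_in_g: "H \<in> \<tt> \<Longrightarrow> H \<in> \<gg>"
  using t_g by blast

lemma rho_zero: "\<rho> 0 = 0"
  using rho_cscale [of 0 0] by simp

lemma rho_minus: "\<rho> (- X) = - \<rho> X"
  using rho_cscale [of "- 1" X] by simp

lemma rho_eq_0: "X \<in> \<gg> \<Longrightarrow> \<rho> X = 0 \<Longrightarrow> X = 0"
  using inj_onD [OF rho_inj, of X 0] by (simp add: rho_zero g_zero)

lemma h_zero_right: "h u 0 = 0"
  using hf.ip_zero by simp

lemma h_add_right: "h u (v + w) = h u v + h u w"
  using hf.ip_add_right by simp

lemma h_scale_right: "h u (c *s v) = cnj c * h u v"
  using hf.ip_scale_right by simp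

lemma h_diff_right: "h u (v - w) = h u v - h u w"
  using h_add_right [of u v "(- 1) *s w"] h_scale_right [of u "- 1" w] by simp

lemma adjoint_unique:
  assumes "\<And>u v. h u (A *v v) = h u (B *v v)"
  shows "A = B"
proof -
  have "A *v v = B *v v" for v
    using h_pos [of "A *v v - B *v v"] assms [of "A *v v - B *v v" v] by (force simp: h_diff_right)
  then show ?thesis by (simp add: matrix_eq)
qed

text \<open>Faithfulness of \<rho> on \<gg> allows an adjoint to be recognized inside \<gg>; the
  algebraic rules for \<open>star\<close> are derived through this criterion.\<close>

lemma star_eqI:
  assumes "X \<in> \<gg>" "Y \<in> \<gg>" "\<And>u v. h (\<rho> X *v u) v = h u (\<rho> Y *v v)"
  shows "star X = Y"
proof -
  have "\<rho> (star X) = \<rho> Y" by (rule adjoint_unique) (metis assms(1,3) h_adjoint)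
  then show ?thesis using rho_inj star_g [OF assms(1)] assms(2) by (simp add: inj_on_eq_iff)
qed

lemma star_adjoint: "X \<in> \<gg> \<Longrightarrow> h (\<rho> (star X) *v u) v = h u (\<rho> X *v v)"
  by (metis h_adjoint h_sym)

lemma star_star: "X \<in> \<gg> \<Longrightarrow> star (star X) = X"
  by (rule star_eqI) (simp_all add: star_g star_adjoint)

lemma star_add: "X \<in> \<gg> \<Longrightarrow> Y \<in> \<gg> \<Longrightarrow> star (X + Y) = star X + star Y"
  by (rule star_eqI) (simp_all add: star_g g_add rho_add matrix_vector_mult_add_rdistrib h_add
      h_add_right h_adjoint)

lemma star_cscale: "X \<in> \<gg> \<Longrightarrow> star (cscale c X) = cscale (cnj c) (star X)"
  by (rule star_eqI) (simp_all add: star_g g_cscale rho_cscale cscale_vector h_scale h_scale_right h_adjoint)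

lemma star_bracket:
  assumes "X \<in> \<gg>" "Y \<in> \<gg>"
  shows "star (bracket X Y) = bracket (star Y) (star X)"
proof (rule star_eqI)
  fix u v
  show "h (\<rho> (bracket X Y) *v u) v = h u (\<rho> (bracket (star Y) (star X)) *v v)"
    unfolding rho_bracket [OF assms] rho_bracket [OF star_g star_g, OF assms(2,1)]
    unfolding bracket_def using assms
    by (simp add: matrix_vector_mult_diff_rdistrib hf.ip_diff h_diff_right
        matrix_vector_mul_assoc [symmetric] h_adjoint)
qed (use assms star_g g_bracket in auto)

text \<open>Orthogonal but not normalized, whence the quotients by \<open>h a a\<close>
  below.\<close>

definition onb :: "(complex^'n) set"
  where "onb = (SOME A. finite A \<and> 0 \<notin> A \<and> pairwise (\<lambda>a b. h a b = 0) A \<and> vec.span A = UNIV)"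

lemma onb: "finite onb" "0 \<notin> onb" "pairwise (\<lambda>a b. h a b = 0) onb" "vec.span onb = UNIV"
proof -
  have "\<exists>A. finite A \<and> 0 \<notin> A \<and> pairwise (\<lambda>a b. h a b = 0) A \<and> vec.span A = UNIV"
    using hf.subspace_orthogonal_basis [OF vec.subspace_UNIV] by blast
  from someI_ex [OF this]
  show "finite onb" "0 \<notin> onb" "pairwise (\<lambda>a b. h a b = 0) onb" "vec.span onb = UNIV"
    unfolding onb_def by blast+
qed

lemma onb_expansion: "v = (\<Sum>a\<in>onb. (h v a / h a a) *s a)"
proof -
  have "v \<in> vec.span onb" by (simp add: onb)
  then obtain u where u: "v = (\<Sum>a\<in>onb. u a *s a)"
    using vec.span_finite [OF onb(1)] by auto
  have "h v b = u b * h b b" if b: "b \<in> onb" for b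
  proof -
    have "h v b = (\<Sum>a\<in>onb. h (u a *s a) b)" unfolding u by (rule hf.ip_sum) auto
    also have "\<dots> = (\<Sum>a\<in>onb. if a = b then u b * h b b else 0)"
      using onb(3) b by (intro sum.cong) (auto simp: h_scale pairwise_def)
    finally show ?thesis using b onb(1) by simp
  qed
  moreover have "h b b \<noteq> 0" if "b \<in> onb" for b
    using hf.ip_definite [of b] that onb(2) by (metis UNIV_I)
  ultimately have "(\<Sum>a\<in>onb. (h v a / h a a) *s a) = (\<Sum>a\<in>onb. u a *s a)"
    by (intro sum.cong) auto
  with u show ?thesis by simp
qed

text \<open>Computing the trace in an orthogonal basis will turn \<open>ip X X\<close> into a sum of
  quotients of squared norms.\<close>

lemma trace_onb: "trace M = (\<Sum>a\<in>onb. h (M *v a) a / h a a)"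
proof -
  have vec: "w = (\<Sum>j\<in>UNIV. (w $ j) *s axis j 1)" for w :: "complex^'n"
    by (simp add: vec_eq_iff sum_component axis_def if_distrib cong: if_cong)
  have "h (M *v a) a = (\<Sum>j\<in>UNIV. (M *v a) $ j * h (axis j 1) a)" for a
  proof -
    have "h (M *v a) a = h (\<Sum>j\<in>UNIV. ((M *v a) $ j) *s axis j 1) a" using vec by simp
    also have "\<dots> = (\<Sum>j\<in>UNIV. h (((M *v a) $ j) *s axis j 1) a)" by (rule hf.ip_sum) auto
    finally show ?thesis by (simp add: h_scale)
  qed
  then have "(\<Sum>a\<in>onb. h (M *v a) a / h a a)
      = (\<Sum>a\<in>onb. \<Sum>j\<in>UNIV. \<Sum>k\<in>UNIV. M $ j $ k * (h (axis j 1) a / h a a * a $ k))"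
    by (simp add: matrix_vector_mult_def sum_distrib_left sum_distrib_right sum_divide_distrib mult.commute mult.left_commute)
  also have "\<dots> = (\<Sum>j\<in>UNIV. \<Sum>k\<in>UNIV. M $ j $ k * (\<Sum>a\<in>onb. h (axis j 1) a / h a a * a $ k))"
    by (simp add: sum_distrib_left sum.swap [of _ onb])
  also have "\<dots> = (\<Sum>j\<in>UNIV. \<Sum>k\<in>UNIV. M $ j $ k * (axis j 1 :: complex^'n) $ k)"
  proof (intro sum.cong refl arg_cong2 [of _ _ _ _ "(*)"])
    fix j k
    show "(\<Sum>a\<in>onb. h (axis j 1) a / h a a * a $ k) = (axis j 1 :: complex^'n) $ k"
      by (subst (2) onb_expansion) (simp add: sum_component)
  qed
  also have "\<dots> = trace M"
    by (simp add: trace_def axis_def if_distrib [of "(*) _"] cong: if_cong)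
  finally show ?thesis by simp
qed

text \<open>The Frobenius form of \<rho>. On \<gg> it is positive definite, and it makes ad (star X)
  the adjoint of ad X.\<close>

definition ip :: "complex^'N^'N \<Rightarrow> complex^'N^'N \<Rightarrow> complex"
  where "ip X Y = trace (\<rho> (star Y) ** \<rho> X)"

lemma ip_pos:
  assumes "X \<in> \<gg>" "X \<noteq> 0"
  obtains r where "r > 0" "ip X X = complex_of_real r"
proof -
  have terms: "\<exists>r\<ge>0. h (\<rho> X *v a) (\<rho> X *v a) / h a a = complex_of_real r
      \<and> (r = 0 \<longrightarrow> \<rho> X *v a = 0)" if "a \<in> onb" for a
  proof -
    have "a \<noteq> 0" using that onb(2) by metis
    then obtain s where s: "s > 0" "h a a = complex_of_real s" using h_pos by blast
    show ?thesis
    proof (cases "\<rho> X *v a = 0")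
      case True
      then show ?thesis using h_zero_right by (intro exI [of _ 0]) simp
    next
      case False
      then obtain r where "r > 0" "h (\<rho> X *v a) (\<rho> X *v a) = complex_of_real r" using h_pos by blast
      then show ?thesis using s by (intro exI [of _ "r / s"]) auto
    qed
  qed
  then obtain r where r: "\<And>a. a \<in> onb \<Longrightarrow> r a \<ge> 0 \<and> h (\<rho> X *v a) (\<rho> X *v a) / h a a = complex_of_real (r a)
      \<and> (r a = 0 \<longrightarrow> \<rho> X *v a = 0)" by metis
  have ip: "ip X X = complex_of_real (\<Sum>a\<in>onb. r a)"
    unfolding ip_def trace_onb of_real_sum
    using r by (intro sum.cong) (simp_all add: matrix_vector_mul_assoc [symmetric] star_adjoint assms(1))
  have "(\<Sum>a\<in>onb. r a) \<noteq> 0"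
  proof
    assume "(\<Sum>a\<in>onb. r a) = 0"
    then have "\<forall>a\<in>onb. r a = 0" using sum_nonneg_eq_0_iff [OF onb(1)] r by blast
    then have 0: "\<And>a. a \<in> onb \<Longrightarrow> \<rho> X *v a = 0" using r by blast
    have "\<rho> X *v v = 0" for v
    proof -
      have "\<rho> X *v v = \<rho> X *v (\<Sum>a\<in>onb. (h v a / h a a) *s a)" by (subst onb_expansion [of v]) (rule refl)
      also have "\<dots> = (\<Sum>a\<in>onb. (h v a / h a a) *s (\<rho> X *v a))"
        unfolding vec.linear_sum [OF matrix_vector_mul_linear_gen] vec.linear_scale [OF matrix_vector_mul_linear_gen] ..
      also have "\<dots> = 0" using 0 by simp
      finally show ?thesis .
    qed
    then have "\<rho> X = 0" by (simp add: matrix_eq)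
    then show False using rho_eq_0 assms by blast
  qed
  moreover have "(\<Sum>a\<in>onb. r a) \<ge> 0" using r by (intro sum_nonneg) blast
  ultimately have "(\<Sum>a\<in>onb. r a) > 0" by simp
  then show thesis using ip by (rule that)
qed

lemma trace_adjoint: "X \<in> \<gg> \<Longrightarrow> Y \<in> \<gg> \<Longrightarrow> trace (\<rho> (star X) ** \<rho> Y) = cnj (trace (\<rho> (star Y) ** \<rho> X))"
proof -
  assume XY: "X \<in> \<gg>" "Y \<in> \<gg>"
  have real: "cnj (h a a) = h a a" for a using h_sym [of a a] by simp
  show ?thesis
    unfolding trace_onb cnj_sum complex_cnj_divide real
    by (intro sum.cong refl) (simp add: matrix_vector_mul_assoc [symmetric] star_adjoint XY h_sym [symmetric])
qed

lemma trace_add: "trace (A + B :: complex^'n^'n) = trace A + trace B"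
  by (simp add: trace_def sum.distrib)

lemma trace_cscale: "trace (cscale c A :: complex^'n^'n) = c * trace A"
  by (simp add: trace_def sum_distrib_left)

lemma trace_diff: "trace (A - B :: complex^'n^'n) = trace A - trace B"
  by (simp add: trace_def sum_subtractf)

sublocale gf: hermitian_form "cscale :: complex \<Rightarrow> complex^'N^'N \<Rightarrow> complex^'N^'N" cmat_basis \<gg> ip
proof
  show "cmat.subspace \<gg>" by (rule g_subspace)
  show "ip (x + y) z = ip x z + ip y z" for x y z
    by (simp add: ip_def rho_add matrix_add_right trace_add)
  show "ip (cscale c x) z = c * ip x z" for c x z
    by (simp add: ip_def rho_cscale cscale_mult_right trace_cscale)
  show "ip y x = cnj (ip x y)" if "x \<in> \<gg>" "y \<in> \<gg>" for x y
    unfolding ip_def by (rule trace_adjoint [OF that])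
  show "ip x x \<noteq> 0" if "x \<in> \<gg>" "x \<noteq> 0" for x
    using ip_pos [OF that] by (metis less_irrefl of_real_eq_0_iff)
qed

text \<open>Cyclicity of the trace, together with the rule that \<open>star\<close> reverses
  brackets.\<close>

lemma ip_bracket:
  assumes "X \<in> \<gg>" "Y \<in> \<gg>" "Z \<in> \<gg>"
  shows "ip (bracket X Y) Z = ip Y (bracket (star X) Z)"
proof -
  have "ip (bracket X Y) Z = trace (\<rho> (star Z) ** \<rho> X ** \<rho> Y) - trace (\<rho> (star Z) ** (\<rho> Y ** \<rho> X))"
    unfolding ip_def rho_bracket [OF assms(1,2)]
    unfolding bracket_def by (simp add: matrix_diff_right trace_diff matrix_mul_assoc)
  also have "trace (\<rho> (star Z) ** (\<rho> Y ** \<rho> X)) = trace (\<rho> X ** \<rho> (star Z) ** \<rho> Y)"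
    using trace_mul_sym [of "\<rho> (star Z) ** \<rho> Y" "\<rho> X"] by (simp add: matrix_mul_assoc)
  also have "trace (\<rho> (star Z) ** \<rho> X ** \<rho> Y) - trace (\<rho> X ** \<rho> (star Z) ** \<rho> Y)
      = trace (bracket (\<rho> (star Z)) (\<rho> X) ** \<rho> Y)"
    by (simp add: bracket_def matrix_diff_left trace_diff)
  also have "bracket (\<rho> (star Z)) (\<rho> X) = \<rho> (star (bracket (star X) Z))"
    using assms by (simp add: star_bracket star_g star_star rho_bracket)
  finally show ?thesis by (simp add: ip_def)
qed

lemma ad_linear_on: "X \<in> \<gg> \<Longrightarrow> cmatf.linear_on \<gg> (bracket X)"
  by (simp add: cmatf.linear_on_def g_bracket bracket_add_right bracket_cscale_right)

text \<open>By the Jacobi identity the operators ad X for X in \<aa> commute, and closure of \<aa>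
  under \<open>star\<close> is closure of these operators under adjoints.\<close>

lemma ad_diagonalizable:
  assumes "\<aa> \<subseteq> \<gg>" "\<And>X. X \<in> \<aa> \<Longrightarrow> star X \<in> \<aa>" "\<And>X Y. X \<in> \<aa> \<Longrightarrow> Y \<in> \<aa> \<Longrightarrow> bracket X Y = 0"
  shows "\<gg> \<subseteq> cmat.span {X \<in> \<gg>. \<forall>H\<in>\<aa>. \<exists>c. bracket H X = cscale c X}"
proof -
  have "\<gg> \<subseteq> cmat.span {X \<in> \<gg>. \<forall>T\<in>bracket ` \<aa>. \<exists>c. T X = cscale c X}"
  proof (rule gf.joint_diagonalization)
    fix T assume T: "T \<in> bracket ` \<aa>"
    then show "cmatf.linear_on \<gg> T" using ad_linear_on assms(1) by blast
    obtain X where X: "X \<in> \<aa>" "T = bracket X" using T by blast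
    then show "\<exists>T'\<in>bracket ` \<aa>. \<forall>x\<in>\<gg>. \<forall>y\<in>\<gg>. ip (T x) y = ip x (T' y)"
      using ip_bracket [of X] assms(1,2) by (intro bexI [of _ "bracket (star X)"]) auto
  next
    fix T U x assume TU: "T \<in> bracket ` \<aa>" "U \<in> bracket ` \<aa>"
    then obtain X Y where "X \<in> \<aa>" "Y \<in> \<aa>" "T = bracket X" "U = bracket Y" by blast
    then show "T (U x) = U (T x)" using bracket_jacobi [of X Y x] assms(3) by simp
  qed
  then show ?thesis by simp
qed

lemma toral_if_star_closed:
  assumes "cmat.subspace \<aa>" "\<aa> \<subseteq> \<gg>" "\<And>X. X \<in> \<aa> \<Longrightarrow> star X \<in> \<aa>"
    and "\<And>X Y. X \<in> \<aa> \<Longrightarrow> Y \<in> \<aa> \<Longrightarrow> bracket X Y = 0"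
  shows "toral_subalgebra \<gg> \<aa>"
  unfolding toral_subalgebra_def lie_subalgebra_def
proof (intro conjI ballI)
  fix X assume X: "X \<in> \<aa>"
  have "{Y \<in> \<gg>. \<forall>H\<in>\<aa>. \<exists>c. bracket H Y = cscale c Y} \<subseteq> {Y \<in> \<gg>. \<exists>c. bracket X Y = cscale c Y}"
    using X by blast
  from cmat.span_mono [OF this] ad_diagonalizable [OF assms(2-4)]
  show "\<gg> \<subseteq> cmat.span {Y \<in> \<gg>. \<exists>c. bracket X Y = cscale c Y}" by blast
qed (use assms cmat.subspace_0 in auto)

text \<open>For a self-adjoint Z the span of \<tt> and Z is abelian and closed under
  \<open>star\<close>, hence toral, and maximality of \<tt> absorbs Z. A general Y is combined from
  the self-adjoint elements Y + star Y and i (Y - star Y).\<close>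

lemma centralizer_t:
  assumes "Y \<in> \<gg>" "\<And>H. H \<in> \<tt> \<Longrightarrow> bracket H Y = 0"
  shows "Y \<in> \<tt>"
proof -
  have hermitian: "Z \<in> \<tt>" if Z: "Z \<in> \<gg>" "star Z = Z" "\<And>H. H \<in> \<tt> \<Longrightarrow> bracket H Z = 0" for Z
  proof -
    define \<aa> where "\<aa> = {H + cscale c Z | H c. H \<in> \<tt>}"
    have Z\<aa>: "Z \<in> \<aa>"
    proof -
      have "Z = 0 + cscale 1 Z" by simp
      then show ?thesis unfolding \<aa>_def using cmat.subspace_0 [OF t_subspace] by blast
    qed
    have t\<aa>: "\<tt> \<subseteq> \<aa>"
    proof
      fix H assume "H \<in> \<tt>"
      moreover have "H = H + cscale 0 Z" by simp
      ultimately show "H \<in> \<aa>" unfolding \<aa>_def by blast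
    qed
    have HZ: "bracket Z H = 0" if "H \<in> \<tt>" for H
      using Z(3) [OF that] bracket_swap [of Z H] by simp
    have "toral_subalgebra \<gg> \<aa>"
    proof (rule toral_if_star_closed)
      show "cmat.subspace \<aa>"
        unfolding cmat.subspace_def
      proof (intro conjI ballI allI)
        show "0 \<in> \<aa>" using t\<aa> cmat.subspace_0 [OF t_subspace] by blast
      next
        fix x y assume "x \<in> \<aa>" "y \<in> \<aa>"
        then obtain H c H' c' where xy: "H \<in> \<tt>" "x = H + cscale c Z" "H' \<in> \<tt>" "y = H' + cscale c' Z"
          unfolding \<aa>_def by blast
        then have "x + y = (H + H') + cscale (c + c') Z" by (simp add: cmat.scale_left_distrib)
        then show "x + y \<in> \<aa>" unfolding \<aa>_def using t_add xy by blast
      next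
        fix d x assume "x \<in> \<aa>"
        then obtain H c where "H \<in> \<tt>" "x = H + cscale c Z" unfolding \<aa>_def by blast
        moreover from this have "cscale d x = cscale d H + cscale (d * c) Z"
          by (simp add: cmat.scale_right_distrib)
        ultimately show "cscale d x \<in> \<aa>" unfolding \<aa>_def using t_cscale by blast
      qed
      show "\<aa> \<subseteq> \<gg>" unfolding \<aa>_def using t_g Z(1) g_add g_cscale by blast
      show "star x \<in> \<aa>" if x: "x \<in> \<aa>" for x
      proof -
        obtain H c where "H \<in> \<tt>" "x = H + cscale c Z" using x unfolding \<aa>_def by blast
        moreover from this have "star x = star H + cscale (cnj c) Z"
          using Z by (simp add: star_add star_cscale t_in_g g_cscale)
        ultimately show ?thesis unfolding \<aa>_def using star_t by blast
      qed
      show "bracket x y = 0" if "x \<in> \<aa>" "y \<in> \<aa>" for x y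
        using that t_abelian Z(3) HZ unfolding \<aa>_def
        by (auto simp: bracket_add_left bracket_add_right bracket_cscale_left bracket_cscale_right)
    qed
    then have "\<aa> = \<tt>" using maximal t\<aa> by blast
    with Z\<aa> show ?thesis by simp
  qed
  have star0: "bracket H (star Y) = 0" if "H \<in> \<tt>" for H
  proof -
    have "star (bracket (star H) Y) = bracket (star Y) H"
      using that assms(1) by (simp add: star_bracket star_star star_g t_in_g)
    moreover have "bracket (star H) Y = 0" using assms(2) star_t that by blast
    moreover have "star 0 = 0" using star_cscale [OF g_zero, of 0] by simp
    ultimately show ?thesis using bracket_swap [of H "star Y"] by simp
  qed
  have 1: "Y + star Y \<in> \<tt>"
    using assms star0 by (intro hermitian)
      (simp_all add: g_add star_g star_add star_star bracket_add_right add.commute)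
  have "star (cscale \<i> (Y - star Y)) = cscale \<i> (Y - star Y)"
  proof -
    have "Y - star Y = Y + cscale (- 1) (star Y)" by simp
    then have "star (Y - star Y) = star Y - Y"
      using assms(1) by (simp only: star_add star_cscale g_cscale star_g star_star) simp
    then have "star (cscale \<i> (Y - star Y)) = cscale (- \<i>) (star Y - Y)"
      using assms(1) by (simp add: star_cscale g_diff star_g)
    also have "\<dots> = cscale \<i> (Y - star Y)"
      by (simp add: vec_eq_iff algebra_simps)
    finally show ?thesis .
  qed
  moreover have "bracket H (Y - star Y) = 0" if "H \<in> \<tt>" for H
    using bracket_add_right [of H "Y - star Y" "star Y"] assms(2) star0 that by simp
  ultimately have 2: "cscale \<i> (Y - star Y) \<in> \<tt>"
    using assms by (intro hermitian) (simp_all add: g_cscale g_diff star_g bracket_cscale_right)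
  have "cscale (1/2) (Y + star Y) + cscale (- \<i> / 2) (cscale \<i> (Y - star Y)) \<in> \<tt>"
    by (intro t_add t_cscale 1 2)
  also have "cscale (1/2) (Y + star Y) + cscale (- \<i> / 2) (cscale \<i> (Y - star Y)) = Y"
    by (simp add: vec_eq_iff algebra_simps)
  finally show ?thesis .
qed

end

section \<open>Roots\<close>

lemma bracket_minus_right: "bracket X (- Y) = - bracket X Y"
  and bracket_minus_left: "bracket (- X) Y = - bracket X Y"
  by (simp_all add: bracket_def matrix_minus_left matrix_minus_right)

context selfadjoint_rep
begin

lemma root_spaceD:
  assumes "X \<in> root_space \<gg> \<tt> \<alpha>"
  shows "X \<in> \<gg>" "H \<in> \<tt> \<Longrightarrow> bracket H X = cscale (\<alpha> H) X"
  using assms by (auto simp: root_space_def)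

lemma root_vector_exists:
  assumes "\<alpha> \<in> roots \<gg> \<tt>"
  shows "\<exists>X. X \<in> root_space \<gg> \<tt> \<alpha> \<and> X \<noteq> 0"
proof -
  have "0 \<in> root_space \<gg> \<tt> \<alpha>" by (simp add: root_space_def g_zero)
  moreover have "root_space \<gg> \<tt> \<alpha> \<noteq> {0}" using assms by (simp add: roots_def)
  ultimately show ?thesis by blast
qed

lemma rootsI:
  assumes "X \<in> \<gg>" "X \<noteq> 0" "\<And>H. H \<in> \<tt> \<Longrightarrow> bracket H X = cscale (\<alpha> H) X"
    and "\<And>H. H \<notin> \<tt> \<Longrightarrow> \<alpha> H = 0" "H \<in> \<tt>" "\<alpha> H \<noteq> 0"
  shows "\<alpha> \<in> roots \<gg> \<tt>"
proof -
  have "X \<in> root_space \<gg> \<tt> \<alpha>" using assms(1,3) by (simp add: root_space_def)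
  then show ?thesis using assms(2,4-6) unfolding roots_def by blast
qed

lemma cscale_cancel: "X \<noteq> 0 \<Longrightarrow> cscale a X = cscale b X \<Longrightarrow> a = b"
  by (simp add: cmat.scale_cancel_right)

lemma root_add:
  assumes "\<alpha> \<in> roots \<gg> \<tt>" "H \<in> \<tt>" "H' \<in> \<tt>"
  shows "\<alpha> (H + H') = \<alpha> H + \<alpha> H'"
proof -
  obtain X where X: "X \<in> root_space \<gg> \<tt> \<alpha>" "X \<noteq> 0" using root_vector_exists [OF assms(1)] by blast
  have "cscale (\<alpha> (H + H')) X = cscale (\<alpha> H + \<alpha> H') X"
    using root_spaceD(2) [OF X(1)] assms(2,3) t_add bracket_add_left [of H H' X]
    by (simp add: cmat.scale_left_distrib)
  then show ?thesis using cscale_cancel X(2) by blast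
qed

lemma root_cscale:
  assumes "\<alpha> \<in> roots \<gg> \<tt>" "H \<in> \<tt>"
  shows "\<alpha> (cscale c H) = c * \<alpha> H"
proof -
  obtain X where X: "X \<in> root_space \<gg> \<tt> \<alpha>" "X \<noteq> 0" using root_vector_exists [OF assms(1)] by blast
  have "cscale (\<alpha> (cscale c H)) X = cscale (c * \<alpha> H) X"
    using root_spaceD(2) [OF X(1)] assms(2) t_cscale bracket_cscale_left [of c H X] by simp
  then show ?thesis using cscale_cancel X(2) by blast
qed

text \<open>A root vector is an eigenvector of ad H and of its adjoint ad (star H), so the two
  eigenvalues are conjugate.\<close>

lemma root_star:
  assumes "\<alpha> \<in> roots \<gg> \<tt>" "H \<in> \<tt>"
  shows "\<alpha> (star H) = cnj (\<alpha> H)"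
proof -
  obtain X where X: "X \<in> root_space \<gg> \<tt> \<alpha>" "X \<noteq> 0" using root_vector_exists [OF assms(1)] by blast
  note Xg = root_spaceD(1) [OF X(1)]
  have "\<alpha> H * ip X X = ip (bracket H X) X"
    using root_spaceD(2) [OF X(1) assms(2)] gf.ip_scale Xg by simp
  also have "\<dots> = ip X (bracket (star H) X)"
    using ip_bracket Xg t_in_g [OF assms(2)] by simp
  also have "\<dots> = cnj (\<alpha> (star H)) * ip X X"
    using root_spaceD(2) [OF X(1) star_t [OF assms(2)]] gf.ip_scale_right Xg by simp
  finally have "\<alpha> H = cnj (\<alpha> (star H))" using gf.ip_definite [OF Xg X(2)] by simp
  then show ?thesis by simp
qed

lemma star_root_vector:
  assumes "\<alpha> \<in> roots \<gg> \<tt>" "X \<in> root_space \<gg> \<tt> \<alpha>"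
  shows "star X \<in> root_space \<gg> \<tt> (\<lambda>H. - \<alpha> H)"
proof -
  have "bracket H (star X) = cscale (- \<alpha> H) (star X)" if H: "H \<in> \<tt>" for H
  proof -
    note Xg = root_spaceD(1) [OF assms(2)]
    have "bracket H (star X) = - bracket (star X) H" by (rule bracket_swap)
    also have "bracket (star X) H = star (bracket (star H) X)"
      using Xg t_in_g [OF H] by (simp add: star_bracket star_g star_star)
    also have "\<dots> = star (cscale (cnj (\<alpha> H)) X)"
      using root_spaceD(2) [OF assms(2) star_t [OF H]] root_star [OF assms(1) H] by simp
    also have "\<dots> = cscale (\<alpha> H) (star X)" by (simp add: star_cscale Xg)
    finally show ?thesis by simp
  qed
  then show ?thesis using star_g root_spaceD(1) [OF assms(2)] by (simp add: root_space_def)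
qed

lemma star_nonzero: "X \<in> \<gg> \<Longrightarrow> X \<noteq> 0 \<Longrightarrow> star X \<noteq> 0"
  using star_star [of X] star_cscale [OF g_zero, of 0] by auto

lemma neg_root:
  assumes "\<alpha> \<in> roots \<gg> \<tt>"
  shows "(\<lambda>H. - \<alpha> H) \<in> roots \<gg> \<tt>"
proof -
  obtain X where X: "X \<in> root_space \<gg> \<tt> \<alpha>" "X \<noteq> 0" using root_vector_exists [OF assms] by blast
  obtain H where "H \<in> \<tt>" "\<alpha> H \<noteq> 0" using assms by (auto simp: roots_def)
  moreover have "H \<notin> \<tt> \<Longrightarrow> \<alpha> H = 0" for H using assms by (simp add: roots_def)
  moreover note star_root_vector [OF assms X(1)] star_nonzero [OF root_spaceD(1) [OF X(1)] X(2)]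
  ultimately show ?thesis by (intro rootsI [of "star X"]) (auto simp: root_space_def)
qed

text \<open>A joint eigenvector of ad \<tt> is a root vector when its eigenvalue functional is
  nonzero; otherwise it centralizes \<tt> and so lies in it.\<close>

lemma root_decomposition:
  "\<gg> \<subseteq> cmat.span (\<tt> \<union> (\<Union>\<alpha>\<in>roots \<gg> \<tt>. root_space \<gg> \<tt> \<alpha>))" (is "_ \<subseteq> cmat.span ?R")
proof -
  have "X \<in> ?R" if X: "X \<in> \<gg>" "\<forall>H\<in>\<tt>. \<exists>c. bracket H X = cscale c X" for X
  proof (cases "X = 0")
    case True
    then show ?thesis using cmat.subspace_0 [OF t_subspace] by blast
  next
    case False
    obtain c where c: "\<And>H. H \<in> \<tt> \<Longrightarrow> bracket H X = cscale (c H) X" using X(2) by metis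
    \<comment> \<open>Extended by zero off \<tt>, as \<open>roots\<close> demands.\<close>
    define \<alpha> where "\<alpha> H = (if H \<in> \<tt> then c H else 0)" for H
    show ?thesis
    proof (cases "\<exists>H\<in>\<tt>. \<alpha> H \<noteq> 0")
      case True
      then have "\<alpha> \<in> roots \<gg> \<tt>"
        using X(1) False c by (auto intro: rootsI [of X] simp: \<alpha>_def)
      moreover have "X \<in> root_space \<gg> \<tt> \<alpha>" using X(1) c by (simp add: root_space_def \<alpha>_def)
      ultimately show ?thesis by blast
    next
      case False
      then have "X \<in> \<tt>" using c by (intro centralizer_t [OF X(1)]) (simp add: \<alpha>_def)
      then show ?thesis by blast
    qed
  qed
  then have "{X \<in> \<gg>. \<forall>H\<in>\<tt>. \<exists>c. bracket H X = cscale c X} \<subseteq> ?R" by blast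
  from cmat.span_mono [OF this] show ?thesis
    using ad_diagonalizable [OF t_g star_t t_abelian] by blast
qed

section \<open>Coroots and the copies of sl2 attached to roots\<close>

definition root_vec :: "(complex^'N^'N \<Rightarrow> complex) \<Rightarrow> complex^'N^'N"
  where "root_vec \<alpha> = (SOME X. X \<in> root_space \<gg> \<tt> \<alpha> \<and> X \<noteq> 0)"

text \<open>Represents \<alpha> on \<tt> with respect to \<open>ip\<close>, up to the positive
  factor \<open>ip e e\<close> for the chosen root vector e.\<close>

definition dual_vec :: "(complex^'N^'N \<Rightarrow> complex) \<Rightarrow> complex^'N^'N"
  where "dual_vec \<alpha> = bracket (root_vec \<alpha>) (star (root_vec \<alpha>))"

text \<open>Scaled so that \<alpha> takes the value 2 on it; \<open>opp_vec\<close> carries the same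
  factor, so that it completes the triple.\<close>

definition coroot :: "(complex^'N^'N \<Rightarrow> complex) \<Rightarrow> complex^'N^'N"
  where "coroot \<alpha> = cscale (2 / \<alpha> (dual_vec \<alpha>)) (dual_vec \<alpha>)"

definition opp_vec :: "(complex^'N^'N \<Rightarrow> complex) \<Rightarrow> complex^'N^'N"
  where "opp_vec \<alpha> = cscale (2 / \<alpha> (dual_vec \<alpha>)) (star (root_vec \<alpha>))"

context
  fixes \<alpha> :: "complex^'N^'N \<Rightarrow> complex"
  assumes \<alpha>: "\<alpha> \<in> roots \<gg> \<tt>"
begin

lemma root_vec: "root_vec \<alpha> \<in> root_space \<gg> \<tt> \<alpha>" "root_vec \<alpha> \<noteq> 0" "root_vec \<alpha> \<in> \<gg>"
  using someI_ex [OF root_vector_exists [OF \<alpha>]] unfolding root_vec_def by (auto simp: root_space_def)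

lemma dual_vec_t: "dual_vec \<alpha> \<in> \<tt>"
proof (rule centralizer_t)
  show "dual_vec \<alpha> \<in> \<gg>" unfolding dual_vec_def by (intro g_bracket star_g root_vec)
  fix H assume H: "H \<in> \<tt>"
  show "bracket H (dual_vec \<alpha>) = 0"
    unfolding dual_vec_def bracket_jacobi [of H "root_vec \<alpha>" "star (root_vec \<alpha>)"]
    using root_spaceD(2) [OF root_vec(1) H] root_spaceD(2) [OF star_root_vector [OF \<alpha> root_vec(1)] H]
    by (simp add: bracket_cscale_left bracket_cscale_right bracket_minus_right)
qed

text \<open>One factor of the bracket moves across \<open>ip\<close> and leaves the bracket of the
  root vector with H. Since \<alpha> is not 0 on \<tt>, \<open>dual_vec\<close> cannot vanish, and
  taking it for H shows that \<alpha> is nonzero on it.\<close>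

lemma ip_dual_vec:
  assumes H: "H \<in> \<tt>"
  shows "ip H (dual_vec \<alpha>) = \<alpha> H * ip (root_vec \<alpha>) (root_vec \<alpha>)"
proof -
  let ?e = "root_vec \<alpha>"
  have "ip H (dual_vec \<alpha>) = cnj (ip (dual_vec \<alpha>) H)"
    by (rule gf.ip_sym [OF t_in_g [OF dual_vec_t] t_in_g [OF H]])
  also have "ip (dual_vec \<alpha>) H = - ip (bracket (star ?e) ?e) H"
    unfolding dual_vec_def bracket_swap [of ?e "star ?e"]
    using gf.ip_scale [of "bracket (star ?e) ?e" H "- 1"] g_bracket star_g root_vec t_in_g H by simp
  also have "ip (bracket (star ?e) ?e) H = ip ?e (bracket ?e H)"
    using ip_bracket [of "star ?e" ?e H] star_g star_star root_vec t_in_g H by simp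
  also have "bracket ?e H = cscale (- \<alpha> H) ?e"
    using root_spaceD(2) [OF root_vec(1) H] bracket_swap [of ?e H] by simp
  also have "cnj (- ip ?e (cscale (- \<alpha> H) ?e)) = \<alpha> H * cnj (ip ?e ?e)"
    using gf.ip_scale_right [OF root_vec(3) root_vec(3), of "- \<alpha> H"] by simp
  also have "cnj (ip ?e ?e) = ip ?e ?e" by (rule gf.ip_sym [OF root_vec(3) root_vec(3), symmetric])
  finally show ?thesis .
qed

lemma dual_vec_nonzero: "dual_vec \<alpha> \<noteq> 0"
proof
  assume 0: "dual_vec \<alpha> = 0"
  obtain H where H: "H \<in> \<tt>" "\<alpha> H \<noteq> 0" using \<alpha> by (auto simp: roots_def)
  then show False
    using ip_dual_vec [OF H(1)] gf.ip_definite [OF root_vec(3,2)] gf.ip_zero(2) [OF t_in_g [OF H(1)]]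
    by (simp add: 0)
qed

lemma root_dual_vec: "\<alpha> (dual_vec \<alpha>) \<noteq> 0"
  using ip_dual_vec [OF dual_vec_t] gf.ip_definite [OF t_in_g [OF dual_vec_t] dual_vec_nonzero] by auto

lemma coroot_t: "coroot \<alpha> \<in> \<tt>"
  unfolding coroot_def by (rule t_cscale [OF dual_vec_t])

lemma opp_vec: "opp_vec \<alpha> \<in> root_space \<gg> \<tt> (\<lambda>H. - \<alpha> H)" "opp_vec \<alpha> \<in> \<gg>"
  using star_root_vector [OF \<alpha> root_vec(1)] unfolding opp_vec_def root_space_def
  by (auto simp: g_cscale bracket_cscale_right mult.commute)

lemma root_coroot: "\<alpha> (coroot \<alpha>) = 2"
  unfolding coroot_def using root_cscale [OF \<alpha> dual_vec_t] root_dual_vec by simp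

lemma bracket_root_opp: "bracket (root_vec \<alpha>) (opp_vec \<alpha>) = coroot \<alpha>"
  by (simp add: opp_vec_def coroot_def dual_vec_def bracket_cscale_right)

lemma bracket_coroot_root: "bracket (coroot \<alpha>) (root_vec \<alpha>) = cscale 2 (root_vec \<alpha>)"
  using root_spaceD(2) [OF root_vec(1) coroot_t] by (simp add: root_coroot)

lemma bracket_coroot_opp: "bracket (coroot \<alpha>) (opp_vec \<alpha>) = cscale (- 2) (opp_vec \<alpha>)"
  using root_spaceD(2) [OF opp_vec(1) coroot_t] by (simp add: root_coroot)

lemma ad_sl2: "sl2_module cscale cmat_basis \<gg> (bracket (root_vec \<alpha>)) (bracket (opp_vec \<alpha>)) (bracket (coroot \<alpha>))"
proof
  fix X assume X: "X \<in> \<gg>"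
  show "bracket (coroot \<alpha>) (bracket (root_vec \<alpha>) X)
      = bracket (root_vec \<alpha>) (bracket (coroot \<alpha>) X) + cscale 2 (bracket (root_vec \<alpha>) X)"
    using bracket_jacobi [of "coroot \<alpha>" "root_vec \<alpha>" X] by (simp add: bracket_coroot_root bracket_cscale_left)
  show "bracket (coroot \<alpha>) (bracket (opp_vec \<alpha>) X)
      = bracket (opp_vec \<alpha>) (bracket (coroot \<alpha>) X) - cscale 2 (bracket (opp_vec \<alpha>) X)"
    using bracket_jacobi [of "coroot \<alpha>" "opp_vec \<alpha>" X] by (simp add: bracket_coroot_opp bracket_cscale_left bracket_minus_left)
  show "bracket (root_vec \<alpha>) (bracket (opp_vec \<alpha>) X)
      = bracket (opp_vec \<alpha>) (bracket (root_vec \<alpha>) X) + bracket (coroot \<alpha>) X"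
    using bracket_jacobi [of "root_vec \<alpha>" "opp_vec \<alpha>" X] by (simp add: bracket_root_opp)
qed (use g_subspace ad_linear_on root_vec opp_vec t_in_g coroot_t in auto)

end

lemma root_coroot_integral:
  assumes "\<alpha> \<in> roots \<gg> \<tt>" "\<beta> \<in> roots \<gg> \<tt>"
  shows "\<exists>k :: int. \<beta> (coroot \<alpha>) = of_int k"
proof -
  interpret sl2_module cscale cmat_basis \<gg> "bracket (root_vec \<alpha>)" "bracket (opp_vec \<alpha>)" "bracket (coroot \<alpha>)"
    by (rule ad_sl2 [OF assms(1)])
  show ?thesis
    using weight_integral [OF root_vec(3) [OF assms(2)] root_vec(2) [OF assms(2)]
        root_spaceD(2) [OF root_vec(1) [OF assms(2)] coroot_t [OF assms(1)]]] by metis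
qed

text \<open>Strictness excludes the value 4 for a product of Cartan integers of independent
  roots.\<close>

lemma cauchy_schwarz_strict:
  assumes "x \<in> \<gg>" "y \<in> \<gg>" "\<And>c. y \<noteq> cscale c x" "x \<noteq> 0"
    and A: "ip x x = complex_of_real A" "A > 0" and B: "ip y y = complex_of_real B"
  shows "(cmod (ip x y))\<^sup>2 < A * B"
proof -
  define c where "c = ip y x / A"
  let ?z = "y - cscale c x"
  have cx: "cscale c x \<in> \<gg>" using g_cscale assms(1) by blast
  have zg: "?z \<in> \<gg>" using g_diff assms(2) cx by blast
  have "?z \<noteq> 0" using assms(3) by simp
  then obtain r where r: "r > 0" "ip ?z ?z = complex_of_real r" using ip_pos [OF zg] by metis
  have zx: "ip ?z x = 0"
    unfolding gf.ip_diff [OF assms(2) cx assms(1)] gf.ip_scale [OF assms(1,1)] using A by (simp add: c_def)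
  have yx: "ip y x = cnj (ip x y)" using gf.ip_sym assms(1,2) by blast
  have "ip ?z ?z = ip ?z y - ip ?z (cscale c x)"
  proof -
    have "ip ?z y = ip ?z (?z + cscale c x)" by simp
    also have "\<dots> = ip ?z ?z + ip ?z (cscale c x)" by (rule gf.ip_add_right [OF zg zg cx])
    finally show ?thesis by simp
  qed
  also have "ip ?z (cscale c x) = 0" using gf.ip_scale_right [OF zg assms(1)] zx by simp
  also have "ip ?z y = ip y y - c * ip x y"
    unfolding gf.ip_diff [OF assms(2) cx assms(2)] gf.ip_scale [OF assms(1,2)] ..
  also have "c * ip x y = complex_of_real ((cmod (ip x y))\<^sup>2 / A)"
    by (simp add: c_def yx complex_norm_square [symmetric] mult.commute [of "cnj _"])
  finally have "complex_of_real r = complex_of_real (B - (cmod (ip x y))\<^sup>2 / A)"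
    using r(2) B by simp
  then have "r = B - (cmod (ip x y))\<^sup>2 / A" using of_real_eq_iff by blast
  with r(1) A(2) show ?thesis by (simp add: field_simps)
qed

text \<open>The product of the two Cartan integers is 4 cos^2 of the angle between the dual vectors.
  One integer is proportional to their inner product and the other to its conjugate, so they vanish
  together.\<close>

lemma root_pair:
  assumes \<alpha>: "\<alpha> \<in> roots \<gg> \<tt>" and \<beta>: "\<beta> \<in> roots \<gg> \<tt>"
    and indep: "\<And>c. \<exists>H\<in>\<tt>. \<beta> H \<noteq> c * \<alpha> H"
  obtains a b :: int where "\<beta> (coroot \<alpha>) = of_int a" "\<alpha> (coroot \<beta>) = of_int b"
    "0 \<le> a * b" "a * b < 4" "a = 0 \<longleftrightarrow> b = 0"
proof -
  obtain a b :: int where ab: "\<beta> (coroot \<alpha>) = of_int a" "\<alpha> (coroot \<beta>) = of_int b"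
    using root_coroot_integral \<alpha> \<beta> by metis
  let ?x = "dual_vec \<alpha>" and ?y = "dual_vec \<beta>"
  note x = dual_vec_t [OF \<alpha>] and y = dual_vec_t [OF \<beta>]
  note xg = t_in_g [OF x] and yg = t_in_g [OF y]
  obtain A where A: "A > 0" "ip ?x ?x = complex_of_real A" using ip_pos [OF xg dual_vec_nonzero [OF \<alpha>]] by metis
  obtain B where B: "B > 0" "ip ?y ?y = complex_of_real B" using ip_pos [OF yg dual_vec_nonzero [OF \<beta>]] by metis
  define k where "k = ip (root_vec \<alpha>) (root_vec \<alpha>)"
  define l where "l = ip (root_vec \<beta>) (root_vec \<beta>)"
  have k0: "k \<noteq> 0" and l0: "l \<noteq> 0"
    using gf.ip_definite root_vec \<alpha> \<beta> unfolding k_def l_def by blast+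
  have "?y \<noteq> cscale c ?x" for c
  proof
    assume c: "?y = cscale c ?x"
    obtain H where H: "H \<in> \<tt>" "\<beta> H \<noteq> (cnj c * k / l) * \<alpha> H" using indep by blast
    have "\<beta> H * l = ip H ?y" using ip_dual_vec [OF \<beta> H(1)] by (simp add: l_def)
    also have "\<dots> = cnj c * ip H ?x" unfolding c by (rule gf.ip_scale_right [OF t_in_g [OF H(1)] xg])
    also have "\<dots> = cnj c * (\<alpha> H * k)" using ip_dual_vec [OF \<alpha> H(1)] by (simp add: k_def)
    finally show False using H(2) l0 by (simp add: field_simps)
  qed
  from cauchy_schwarz_strict [OF xg yg this dual_vec_nonzero [OF \<alpha>] A(2,1) B(2)]
  have CS: "(cmod (ip ?x ?y))\<^sup>2 < A * B" .
  have 1: "\<alpha> ?x * k = A" "\<beta> ?y * l = B" "\<beta> ?x * l = ip ?x ?y" "\<alpha> ?y * k = ip ?y ?x"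
    using ip_dual_vec [OF \<alpha> x] ip_dual_vec [OF \<beta> y] ip_dual_vec [OF \<beta> x] ip_dual_vec [OF \<alpha> y] A B
    by (simp_all add: k_def l_def)
  have a: "of_int a = 2 * \<beta> ?x / \<alpha> ?x" and b: "of_int b = 2 * \<alpha> ?y / \<beta> ?y"
    unfolding ab [symmetric] coroot_def root_cscale [OF \<beta> x] root_cscale [OF \<alpha> y] by simp_all
  have nz: "\<alpha> ?x \<noteq> 0" "\<beta> ?y \<noteq> 0" using root_dual_vec \<alpha> \<beta> by auto
  have yx: "ip ?y ?x = cnj (ip ?x ?y)" using gf.ip_sym xg yg by blast
  \<comment> \<open>The factors \<open>k\<close> and \<open>l\<close> turn values of roots into
    inner products and cancel in the quotient.\<close>
  have "complex_of_int (a * b) = 4 * (\<beta> ?x * l) * (\<alpha> ?y * k) / ((\<alpha> ?x * k) * (\<beta> ?y * l))"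
    using nz k0 l0 by (simp add: a b field_simps)
  also have "\<dots> = complex_of_real (4 * (cmod (ip ?x ?y))\<^sup>2 / (A * B))"
    unfolding 1 yx by (simp add: complex_norm_square [symmetric])
  finally have "complex_of_real (of_int (a * b)) = complex_of_real (4 * (cmod (ip ?x ?y))\<^sup>2 / (A * B))"
    by simp
  then have eq: "real_of_int (a * b) = 4 * (cmod (ip ?x ?y))\<^sup>2 / (A * B)" using of_real_eq_iff by blast
  have "0 \<le> real_of_int (a * b)" unfolding eq using A B by simp
  moreover have "real_of_int (a * b) < 4" unfolding eq using A B CS by (simp add: field_simps)
  ultimately have "0 \<le> a * b" "a * b < 4" by linarith+
  moreover have "a = 0 \<longleftrightarrow> b = 0"
  proof -
    have "a = 0 \<longleftrightarrow> \<beta> ?x = 0" using a nz of_int_eq_0_iff [of a, where 'a = complex] by auto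
    also have "\<dots> \<longleftrightarrow> ip ?x ?y = 0" using 1(3) l0 by auto
    also have "\<dots> \<longleftrightarrow> \<alpha> ?y = 0" using 1(4) k0 yx by auto
    also have "\<dots> \<longleftrightarrow> b = 0" using b nz of_int_eq_0_iff [of b, where 'a = complex] by auto
    finally show ?thesis .
  qed
  ultimately show thesis using that ab by blast
qed

section \<open>Submodules and strings of weights\<close>

definition submodule :: "(complex^'n) set \<Rightarrow> bool"
  where "submodule W \<longleftrightarrow> vec.subspace W \<and> (\<forall>X\<in>\<gg>. \<forall>v\<in>W. \<rho> X *v v \<in> W)"

lemma submodule_UNIV: "submodule UNIV"
  by (simp add: submodule_def vec.subspace_UNIV)

lemma rho_commute:
  assumes "X \<in> \<gg>" "Y \<in> \<gg>"
  shows "\<rho> X *v (\<rho> Y *v v) = \<rho> Y *v (\<rho> X *v v) + \<rho> (bracket X Y) *v v"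
  using assms by (simp add: rho_bracket) (simp add: bracket_def matrix_vector_mult_diff_rdistrib
    matrix_vector_mul_assoc)

lemma matrix_vector_mult_minus: "(- A :: complex^'n^'n) *v v = - (A *v v)"
  by (simp add: vec_eq_iff matrix_vector_mult_def sum_negf)

lemma rho_linear_on: "submodule W \<Longrightarrow> X \<in> \<gg> \<Longrightarrow> vecf.linear_on W ((*v) (\<rho> X))"
  by (simp add: vecf.linear_on_def submodule_def matrix_vector_right_distrib vector_scalar_commute)

lemma rho_sl2:
  assumes \<alpha>: "\<alpha> \<in> roots \<gg> \<tt>" and W: "submodule W"
  shows "sl2_module (*s) cart_basis W ((*v) (\<rho> (root_vec \<alpha>))) ((*v) (\<rho> (opp_vec \<alpha>))) ((*v) (\<rho> (coroot \<alpha>)))"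
proof
  fix v assume "v \<in> W"
  note g = root_vec(3) [OF \<alpha>] opp_vec(2) [OF \<alpha>] t_in_g [OF coroot_t [OF \<alpha>]]
  show "\<rho> (coroot \<alpha>) *v (\<rho> (root_vec \<alpha>) *v v)
      = \<rho> (root_vec \<alpha>) *v (\<rho> (coroot \<alpha>) *v v) + 2 *s (\<rho> (root_vec \<alpha>) *v v)"
    unfolding rho_commute [OF g(3,1)] bracket_coroot_root [OF \<alpha>] by (simp add: rho_cscale cscale_vector)
  show "\<rho> (coroot \<alpha>) *v (\<rho> (opp_vec \<alpha>) *v v)
      = \<rho> (opp_vec \<alpha>) *v (\<rho> (coroot \<alpha>) *v v) - 2 *s (\<rho> (opp_vec \<alpha>) *v v)"
    unfolding rho_commute [OF g(3,2)] bracket_coroot_opp [OF \<alpha>]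
    by (simp add: rho_minus rho_cscale cscale_vector matrix_vector_mult_minus)
  show "\<rho> (root_vec \<alpha>) *v (\<rho> (opp_vec \<alpha>) *v v)
      = \<rho> (opp_vec \<alpha>) *v (\<rho> (root_vec \<alpha>) *v v) + \<rho> (coroot \<alpha>) *v v"
    unfolding rho_commute [OF g(1,2)] bracket_root_opp [OF \<alpha>] ..
qed (use W rho_linear_on root_vec opp_vec t_in_g coroot_t \<alpha> in \<open>auto simp: submodule_def\<close>)

lemma rho_root_vector_weight:
  assumes "X \<in> root_space \<gg> \<tt> \<alpha>" "H \<in> \<tt>" "\<rho> H *v v = c *s v"
  shows "\<rho> H *v (\<rho> X *v v) = (c + \<alpha> H) *s (\<rho> X *v v)"
  unfolding rho_commute [OF t_in_g [OF assms(2)] root_spaceD(1) [OF assms(1)]]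
    root_spaceD(2) [OF assms(1,2)]
  by (simp add: assms(3) rho_cscale cscale_vector vector_scalar_commute vec.scale_left_distrib)

lemma rho_root_vector_weight_power:
  assumes "X \<in> root_space \<gg> \<tt> \<alpha>" "H \<in> \<tt>" "\<rho> H *v v = c *s v"
  shows "\<rho> H *v (((*v) (\<rho> X) ^^ k) v) = (c + of_nat k * \<alpha> H) *s (((*v) (\<rho> X) ^^ k) v)"
proof (induction k)
  case (Suc k)
  then show ?case using rho_root_vector_weight [OF assms(1,2) Suc] by (simp add: algebra_simps)
qed (simp add: assms)

text \<open>The weight of \<open>u\<close> is described for every H that has \<open>v\<close> as an
  eigenvector, so one \<open>u\<close> serves both coroots and the grading element at once, and no
  weight functional has to be named.\<close>

lemma root_string:
  assumes \<alpha>: "\<alpha> \<in> roots \<gg> \<tt>" and W: "submodule W" and v: "v \<in> W" "v \<noteq> 0"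
    and n: "\<rho> (coroot \<alpha>) *v v = of_nat n *s v" "j \<le> n"
  obtains u where "u \<in> W" "u \<noteq> 0"
    "\<And>H c. H \<in> \<tt> \<Longrightarrow> \<rho> H *v v = c *s v \<Longrightarrow> \<rho> H *v u = (c - of_nat j * \<alpha> H) *s u"
proof -
  interpret sl2_module "(*s)" cart_basis W "(*v) (\<rho> (root_vec \<alpha>))" "(*v) (\<rho> (opp_vec \<alpha>))" "(*v) (\<rho> (coroot \<alpha>))"
    by (rule rho_sl2 [OF \<alpha> W])
  obtain s where s: "((*v) (\<rho> (opp_vec \<alpha>)) ^^ (j + s)) (((*v) (\<rho> (root_vec \<alpha>)) ^^ s) v) \<noteq> 0"
    using weight_string_down [OF v n] by blast
  show thesis
  proof (rule that [OF _ s])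
    show "((*v) (\<rho> (opp_vec \<alpha>)) ^^ (j + s)) (((*v) (\<rho> (root_vec \<alpha>)) ^^ s) v) \<in> W"
      using f_closed e_closed v by blast
    fix H c assume H: "H \<in> \<tt>" "\<rho> H *v v = c *s v"
    from rho_root_vector_weight_power [OF opp_vec(1) [OF \<alpha>] H(1)
        rho_root_vector_weight_power [OF root_vec(1) [OF \<alpha>] H], of "j + s" s]
    show "\<rho> H *v (((*v) (\<rho> (opp_vec \<alpha>)) ^^ (j + s)) (((*v) (\<rho> (root_vec \<alpha>)) ^^ s) v))
        = (c - of_nat j * \<alpha> H) *s (((*v) (\<rho> (opp_vec \<alpha>)) ^^ (j + s)) (((*v) (\<rho> (root_vec \<alpha>)) ^^ s) v))"
      by (simp add: algebra_simps)
  qed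
qed

lemma root_string_up:
  assumes \<alpha>: "\<alpha> \<in> roots \<gg> \<tt>" and W: "submodule W" and v: "v \<in> W" "v \<noteq> 0"
    and n: "\<rho> (coroot \<alpha>) *v v = (- of_nat n) *s v" "j \<le> n"
  obtains u where "u \<in> W" "u \<noteq> 0"
    "\<And>H c. H \<in> \<tt> \<Longrightarrow> \<rho> H *v v = c *s v \<Longrightarrow> \<rho> H *v u = (c + of_nat j * \<alpha> H) *s u"
proof -
  interpret sl2_module "(*s)" cart_basis W "(*v) (\<rho> (opp_vec \<alpha>))" "(*v) (\<rho> (root_vec \<alpha>))" "\<lambda>v. - (\<rho> (coroot \<alpha>) *v v)"
    using sl2_module.opposite [OF rho_sl2 [OF \<alpha> W]] .
  have n': "- (\<rho> (coroot \<alpha>) *v v) = of_nat n *s v" using n(1) by simp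
  obtain s where s: "((*v) (\<rho> (root_vec \<alpha>)) ^^ (j + s)) (((*v) (\<rho> (opp_vec \<alpha>)) ^^ s) v) \<noteq> 0"
    using weight_string_down [OF v n' n(2)] by blast
  show thesis
  proof (rule that [OF _ s])
    show "((*v) (\<rho> (root_vec \<alpha>)) ^^ (j + s)) (((*v) (\<rho> (opp_vec \<alpha>)) ^^ s) v) \<in> W"
      using f_closed e_closed v by blast
    fix H c assume H: "H \<in> \<tt>" "\<rho> H *v v = c *s v"
    from rho_root_vector_weight_power [OF root_vec(1) [OF \<alpha>] H(1)
        rho_root_vector_weight_power [OF opp_vec(1) [OF \<alpha>] H], of "j + s" s]
    show "\<rho> H *v (((*v) (\<rho> (root_vec \<alpha>)) ^^ (j + s)) (((*v) (\<rho> (opp_vec \<alpha>)) ^^ s) v))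
        = (c + of_nat j * \<alpha> H) *s (((*v) (\<rho> (root_vec \<alpha>)) ^^ (j + s)) (((*v) (\<rho> (opp_vec \<alpha>)) ^^ s) v))"
      by (simp add: algebra_simps)
  qed
qed

end

section \<open>The weight combinatorics\<close>

text \<open>
  \<open>Q i j\<close> stands for: \<open>\<lambda> - i \<sigma>\<^sub>1 - j \<sigma>\<^sub>2\<close> is a weight, where \<open>\<lambda> = p \<omega>\<^sub>1 + q \<omega>\<^sub>2\<close>. Whenever
  \<open>(p, q, n\<^sub>1, n\<^sub>2)\<close> is not the expected tuple, two different weights have the same eigenvalue.
\<close>

lemma weight_combinatorics:
  fixes Q :: "int \<Rightarrow> int \<Rightarrow> bool" and p q n1 n2 :: int
  assumes top: "Q 0 0"
    and S1: "\<And>i j k. Q i j \<Longrightarrow> 0 \<le> k \<Longrightarrow> k \<le> p - 2 * i + 3 * j \<Longrightarrow> Q (i + k) j"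
    and S2: "\<And>i j k. Q i j \<Longrightarrow> 0 \<le> k \<Longrightarrow> k \<le> q + i - 2 * j \<Longrightarrow> Q i (j + k)"
    and U1: "\<And>i j k. Q i j \<Longrightarrow> 0 \<le> k \<Longrightarrow> k \<le> - (p - 2 * i + 3 * j) \<Longrightarrow> Q (i - k) j"
    and U2: "\<And>i j k. Q i j \<Longrightarrow> 0 \<le> k \<Longrightarrow> k \<le> - (q + i - 2 * j) \<Longrightarrow> Q i (j - k)"
    and max: "\<And>i j. Q i j \<Longrightarrow> 0 \<le> i * n1 + j * n2"
    and inj: "\<And>i j i' j'. Q i j \<Longrightarrow> Q i' j' \<Longrightarrow> i * n1 + j * n2 = i' * n1 + j' * n2 \<Longrightarrow> i = i' \<and> j = j'"
    and cov: "\<And>k. 0 \<le> k \<Longrightarrow> k \<le> n1 + n2 \<Longrightarrow> \<exists>i j. 0 \<le> i \<and> 0 \<le> j \<and> i * n1 + j * n2 = k \<and> Q i j"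
    and pos: "n1 \<ge> 1" "n2 \<ge> 1" and pq: "p \<ge> 0" "q \<ge> 0" "p \<noteq> 0 \<or> q \<noteq> 0"
  shows "p = 1 \<and> q = 0 \<and> n1 = 1 \<and> n2 = 1"
proof -
  \<comment> \<open>The reflection in \<sigma>1 would send a weight (k, 0) with k > p to (p - k, 0),
    which lies above the highest weight.\<close>
  have R1: "k \<le> p" if "Q k 0" "0 \<le> k" for k
  proof (rule ccontr)
    assume "\<not> k \<le> p"
    moreover from this have "Q (k - (2 * k - p)) 0" using U1 [OF that(1), of "2 * k - p"] that pq by simp
    then have "0 \<le> (p - k) * n1" using max by fastforce
    ultimately show False using pos(1) by (simp add: zero_le_mult_iff)
  qed
  have R2: "k \<le> q" if "Q 0 k" "0 \<le> k" for k
  proof (rule ccontr)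
    assume "\<not> k \<le> q"
    moreover from this have "Q 0 (k - (2 * k - q))" using U2 [OF that(1), of "2 * k - q"] that pq by simp
    then have "0 \<le> (q - k) * n2" using max by fastforce
    ultimately show False using pos(2) by (simp add: zero_le_mult_iff)
  qed
  have row0: "Q i 0" if "0 \<le> i" "i \<le> p" for i using S1 [OF top, of i] that by simp
  have col0: "Q 0 j" if "0 \<le> j" "j \<le> q" for j using S2 [OF top, of j] that by simp
  \<comment> \<open>The eigenvalue just below the top is attained, which forces the smaller of n1
    and n2 to be 1.\<close>
  obtain i j where ij: "0 \<le> i" "0 \<le> j" "i * n1 + j * n2 = 1" using cov [of 1] pos by auto
  have "n1 = 1 \<or> n2 = 1"
  proof (rule ccontr)
    assume "\<not> ?thesis"
    then have n: "n1 \<ge> 2" "n2 \<ge> 2" using pos by auto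
    have "i \<ge> 1 \<or> j \<ge> 1" using ij by (cases "i = 0"; cases "j = 0") auto
    moreover have "i * n1 \<ge> i * 2" "j * n2 \<ge> j * 2"
      using mult_left_mono n ij by blast+
    ultimately show False using ij by linarith
  qed
  then consider (A) "n1 = 1" "n2 = 1" | (B) "n1 = 1" "n2 \<ge> 2" | (C) "n2 = 1" "n1 \<ge> 2"
    using pos by linarith
  then show ?thesis
  proof cases
    \<comment> \<open>The colliding pairs are (1, 0) and (0, 1) if p, q \<ge> 1, (2, 0) and (1, 1)
      if q = 0 and p \<ge> 2, and (3, 1) and (2, 2) if p = 0 and q \<ge> 1.\<close>
    case A
    have "\<not> (p \<ge> 1 \<and> q \<ge> 1)" using inj [OF row0 [of 1] col0 [of 1]] A by auto
    moreover have "\<not> (q = 0 \<and> p \<ge> 2)"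
      using inj [OF row0 [of 2] S2 [OF row0 [of 1], of 1]] A by auto
    moreover have "\<not> (p = 0 \<and> q \<ge> 1)"
      using inj [OF S1 [OF col0 [of 1], of 3] S2 [OF S1 [OF col0 [of 1], of 2], of 1]] A by auto
    ultimately show ?thesis using pq A by linarith
  next
    \<comment> \<open>Here (i, j) has depth i + j N. The collisions used are (N, 0) with (0, 1), (N,
      1) with (0, 2), (N + 1, 0) with (1, 1), and (N + 2, 1) with (2, 2).\<close>
    case B
    define N where "N = n2"
    have N: "N \<ge> 2" "n2 = N" using B by (auto simp: N_def)
    \<comment> \<open>A depth below N can only be filled by j = 0, and depth N only by (N, 0) or (0,
      1); together with \<open>R1\<close> this bounds p from below.\<close>
    have reach: "Q k 0 \<or> (k = N \<and> Q 0 1)" if k: "0 \<le> k" "k \<le> N" for k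
    proof -
      obtain i j where ij: "0 \<le> i" "0 \<le> j" "i + j * N = k" "Q i j" using cov [of k] k B N by auto
      show ?thesis
      proof (cases "j = 0")
        case False
        then have "j * N \<ge> N" using ij(2) N(1) by (simp add: mult_le_cancel_right1)
        then have "i = 0" "j * N = N" using ij k by linarith+
        then have "j = 1" using N by simp
        with \<open>i = 0\<close> ij show ?thesis by auto
      qed (use ij in auto)
    qed
    have p: "p \<ge> N - 1" using reach [of "N - 1"] R1 [of "N - 1"] N by auto
    show ?thesis
    proof (cases "q \<ge> 1")
      case True
      have "p < N"
      proof (rule ccontr)
        assume "\<not> p < N"
        then show False using inj [OF row0 [of N] col0 [of 1]] True B N by auto
      qed
      then have p: "p = N - 1" using p by simp
      show ?thesis
      proof (cases "q \<ge> 2")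
        case True
        have "Q N 1" using S1 [OF col0 [of 1], of N] True N p by simp
        then show ?thesis using inj [OF _ col0 [of 2], of N 1] True N B by simp
      next
        case False
        then have q: "q = 1" using \<open>q \<ge> 1\<close> by simp
        have "Q 1 1" using S1 [OF col0 [of 1], of 1] q p N by simp
        have "Q 2 1" using S1 [OF col0 [of 1], of 2] q p N by simp
        then have "Q 2 2" using S2 [of 2 1 1] q by simp
        moreover have "Q (N + 2) 1" using S1 [OF col0 [of 1], of "N + 2"] q p N by simp
        ultimately show ?thesis using inj [of 2 2 "N + 2" 1] N B by simp
      qed
    next
      case False
      then have q: "q = 0" using pq by simp
      have "\<not> Q 0 1" using R2 [of 1] q by auto
      then have "p \<ge> N" using reach [of N] R1 [of N] N by auto
      have O11: "Q 1 1" using S2 [OF row0 [of 1], of 1] q \<open>p \<ge> N\<close> N by simp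
      have "p < N + 1"
      proof (rule ccontr)
        assume "\<not> p < N + 1"
        then show False using inj [OF row0 [of "N + 1"] O11] B N by auto
      qed
      then have p: "p = N" using \<open>p \<ge> N\<close> by simp
      have "Q (N + 2) 1" using S1 [OF O11, of "N + 1"] p N by (simp add: add.commute)
      moreover have "Q 2 2" using S2 [OF row0 [of 2], of 2] q p N by simp
      ultimately show ?thesis using inj [of "N + 2" 1 2 2] N B by simp
    qed
  next
    \<comment> \<open>Now (i, j) has depth i N + j. The collisions used are (1, 0) with (0, N), (2,
      0) with (1, N), (4, 1) with (3, N + 1), (1, 1) with (0, N + 1), and (3, 1) with (2, N +
      1).\<close>
    case C
    define N where "N = n1"
    have N: "N \<ge> 2" "n1 = N" using C by (auto simp: N_def)
    have reach: "Q 0 k \<or> (k = N \<and> Q 1 0)" if k: "0 \<le> k" "k \<le> N" for k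
    proof -
      obtain i j where ij: "0 \<le> i" "0 \<le> j" "i * N + j = k" "Q i j" using cov [of k] k C N by auto
      show ?thesis
      proof (cases "i = 0")
        case False
        then have "i * N \<ge> N" using ij(1) N(1) by (simp add: mult_le_cancel_right1)
        then have "j = 0" "i * N = N" using ij k by linarith+
        then have "i = 1" using N by simp
        with \<open>j = 0\<close> ij show ?thesis by auto
      qed (use ij in auto)
    qed
    have q: "q \<ge> N - 1" using reach [of "N - 1"] R2 [of "N - 1"] N by auto
    show ?thesis
    proof (cases "p \<ge> 1")
      case True
      have "q < N"
      proof (rule ccontr)
        assume "\<not> q < N"
        then show False using inj [OF row0 [of 1] col0 [of N]] True C N by auto
      qed
      then have q: "q = N - 1" using q by simp
      show ?thesis
      proof (cases "p \<ge> 2")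
        case True
        have "Q 1 N" using S2 [OF row0 [of 1], of N] True N q by simp
        then show ?thesis using inj [OF _ row0 [of 2], of 1 N] True N C by simp
      next
        case False
        then have p: "p = 1" using \<open>p \<ge> 1\<close> by simp
        have O31: "Q 3 1" using S1 [OF col0 [of 1], of 3] q p N by simp
        have "Q 4 1" using S1 [OF col0 [of 1], of 4] q p N by simp
        moreover have "Q 3 (N + 1)" using S2 [OF O31, of N] q N by (simp add: add.commute)
        ultimately show ?thesis using inj [of 4 1 3 "N + 1"] N C by simp
      qed
    next
      case False
      then have p: "p = 0" using pq by simp
      have "\<not> Q 1 0" using R1 [of 1] p by auto
      then have "q \<ge> N" using reach [of N] R2 [of N] N by auto
      have O11: "Q 1 1" using S1 [OF col0 [of 1], of 1] p \<open>q \<ge> N\<close> N by simp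
      have "q < N + 1"
      proof (rule ccontr)
        assume "\<not> q < N + 1"
        then show False using inj [OF col0 [of "N + 1"] O11] C N by auto
      qed
      then have q: "q = N" using \<open>q \<ge> N\<close> by simp
      have O21: "Q 2 1" using S1 [OF col0 [of 1], of 2] p q N by simp
      have "Q 2 (N + 1)" using S2 [OF O21, of N] q N by (simp add: add.commute)
      moreover have "Q 3 1" using S1 [OF col0 [of 1], of 3] p q N by simp
      ultimately show ?thesis using inj [of 2 "N + 1" 3 1] N C by simp
    qed
  qed
qed

section \<open>Eigenvalues of the grading element\<close>

lemma mat_vector_mult: "mat c *v u = c *s (u :: complex^'n)"
  unfolding vec_eq_iff
proof
  fix i
  have "(mat c *v u) $ i = (\<Sum>j\<in>UNIV. if j = i then c * u $ i else 0)"
    unfolding matrix_vector_mult_def mat_def vec_lambda_beta by (intro sum.cong) auto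
  then show "(mat c *v u) $ i = (c *s u) $ i" by simp
qed

text \<open>If c were missing from \<open>L\<close>, every eigenvector of the spanning set would lie
  in the image of A - c. This map would be surjective, hence injective, although it kills v.\<close>

lemma eigenvalue_of_span:
  fixes A :: "complex^'n^'n"
  assumes span: "vec.span {u. \<exists>l\<in>L. A *v u = l *s u} = UNIV" and v: "v \<noteq> 0" "A *v v = c *s v"
  shows "c \<in> L"
proof (rule ccontr)
  assume c: "c \<notin> L"
  let ?B = "A - mat c"
  have B: "?B *v u = A *v u - c *s u" for u
    by (simp add: matrix_vector_mult_diff_rdistrib mat_vector_mult)
  have "u \<in> range ((*v) ?B)" if u: "u \<in> {u. \<exists>l\<in>L. A *v u = l *s u}" for u
  proof -
    obtain l where l: "l \<in> L" "A *v u = l *s u" using u by blast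
    have "?B *v (inverse (l - c) *s u) = inverse (l - c) *s ((l - c) *s u)"
      unfolding vector_scalar_commute B l(2) by (simp add: vec.scale_left_diff_distrib)
    also have "\<dots> = (inverse (l - c) * (l - c)) *s u" by (rule vec.scale_scale)
    also have "inverse (l - c) * (l - c) = 1" using l(1) c by (intro left_inverse) auto
    also have "1 *s u = u" by simp
    finally show ?thesis by (rule range_eqI [OF sym])
  qed
  moreover have "vec.subspace (range ((*v) ?B))"
    by (rule vec.linear_subspace_image [OF matrix_vector_mul_linear_gen vec.subspace_UNIV])
  ultimately have "vec.span {u. \<exists>l\<in>L. A *v u = l *s u} \<subseteq> range ((*v) ?B)"
    by (intro vec.span_minimal) auto
  then have "surj ((*v) ?B)" using span by auto
  then obtain C where "?B ** C = mat 1" using matrix_right_invertible_surjective [of ?B] by auto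
  then have "C ** ?B = mat 1" by (simp add: matrix_left_right_inverse)
  then have "v = C *v (?B *v v)" by (simp add: matrix_vector_mul_assoc)
  also have "?B *v v = 0" using B v(2) by simp
  finally show False using v(1) by simp
qed

text \<open>The real \<open>w\<close> is an offset of the eigenvalues, to be instantiated with minus
  half the Hodge weight: on the (p, q)-part (p - q)/2 equals p minus half the weight.
  \<open>E_sym\<close> will come from complex conjugation.\<close>

locale g2_hodge = selfadjoint_rep \<gg> \<tt> \<rho> star h
  for \<gg> \<tt> :: "(complex^'N^'N) set" and \<rho> :: "complex^'N^'N \<Rightarrow> complex^'n^'n" and star h +
  fixes \<bb> :: "(complex^'N^'N) set" and \<sigma>1 \<sigma>2 :: "complex^'N^'N \<Rightarrow> complex" and T1 T2 E :: "complex^'N^'N"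
    and w :: real
  assumes borel: "borel_subalgebra \<gg> \<bb>" and t_b: "\<tt> \<subseteq> \<bb>" and b_nonneg: "\<bb> \<subseteq> nonneg_part \<gg> E"
    and simple: "simple_roots \<gg> \<tt> \<bb> = {\<sigma>1, \<sigma>2}" and long: "(\<lambda>H. 3 * \<sigma>1 H + \<sigma>2 H) \<in> roots \<gg> \<tt>"
    and dual: "dual_basis \<tt> \<sigma>1 \<sigma>2 T1 T2"
    and E_t: "E \<in> \<tt>"
    and E_span: "vec.span {v. \<exists>l\<in>{l. \<exists>k :: int. l = complex_of_real (w + of_int k)}. \<rho> E *v v = l *s v} = UNIV"
    and E_sym: "\<rho> E *v v = complex_of_real l *s v \<Longrightarrow> v \<noteq> 0 \<Longrightarrow>
        \<exists>u. u \<noteq> 0 \<and> \<rho> E *v u = complex_of_real (- l) *s u"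
begin

lemma positive: "\<sigma>1 \<in> positive_roots \<gg> \<tt> \<bb>" "\<sigma>2 \<in> positive_roots \<gg> \<tt> \<bb>"
  using simple by (auto simp: simple_roots_def)

lemma roots: "\<sigma>1 \<in> roots \<gg> \<tt>" "\<sigma>2 \<in> roots \<gg> \<tt>"
  using positive by (auto simp: positive_roots_def)

lemma dual_values: "T1 \<in> \<tt>" "T2 \<in> \<tt>" "\<sigma>1 T1 = 1" "\<sigma>1 T2 = 0" "\<sigma>2 T1 = 0" "\<sigma>2 T2 = 1"
  using dual by (auto simp: dual_basis_def)

abbreviation h1 where "h1 \<equiv> coroot \<sigma>1"
abbreviation h2 where "h2 \<equiv> coroot \<sigma>2"

lemma h_t: "h1 \<in> \<tt>" "h2 \<in> \<tt>"
  by (rule coroot_t [OF roots(1)], rule coroot_t [OF roots(2)])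

text \<open>For x = \<sigma>2(h1), the pair \<sigma>1, \<sigma>2 bounds x by 3 in absolute value,
  and the pair \<sigma>1, 3 \<sigma>1 + \<sigma>2 bounds x + 6 in the same way. This leaves x = -3,
  and since the product with the other integer is positive and below 4, that integer is -1.\<close>

lemma cartan_integers: "\<sigma>2 h1 = - 3" "\<sigma>1 h2 = - 1"
proof -
  have small: "a \<le> 3 \<and> a \<ge> - 3" if "0 \<le> a * b" "a * b < 4" "a = 0 \<longleftrightarrow> b = 0" for a b :: int
  proof (cases "b = 0")
    case False
    then have "\<bar>b\<bar> \<ge> 1" by simp
    then have "\<bar>a\<bar> * \<bar>b\<bar> \<ge> \<bar>a\<bar>" using mult_left_mono [of 1 "\<bar>b\<bar>" "\<bar>a\<bar>"] by simp
    moreover have "\<bar>a\<bar> * \<bar>b\<bar> = a * b" using that(1) by (simp add: abs_mult [symmetric])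
    ultimately show ?thesis using that(2) by linarith
  qed (use that in auto)
  let ?\<beta> = "\<lambda>H. 3 * \<sigma>1 H + \<sigma>2 H"
  have "\<exists>H\<in>\<tt>. ?\<beta> H \<noteq> c * \<sigma>1 H" for c using dual_values by (intro bexI [of _ T2]) auto
  then obtain a b :: int where ab: "?\<beta> h1 = of_int a" "0 \<le> a * b" "a * b < 4" "a = 0 \<longleftrightarrow> b = 0"
    using root_pair [OF roots(1) long] by metis
  have "\<exists>H\<in>\<tt>. \<sigma>2 H \<noteq> c * \<sigma>1 H" for c using dual_values by (intro bexI [of _ T2]) auto
  then obtain x y :: int where xy: "\<sigma>2 h1 = of_int x" "\<sigma>1 h2 = of_int y" "0 \<le> x * y" "x * y < 4" "x = 0 \<longleftrightarrow> y = 0"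
    using root_pair [OF roots] by metis
  have "complex_of_int (6 + x) = of_int a" using ab(1) xy(1) root_coroot [OF roots(1)] by simp
  then have "6 + x = a" using of_int_eq_iff by blast
  then have x: "x = - 3" using small [OF ab(2-4)] small [OF xy(3-5)] by linarith
  then have "y = - 1" using xy(3-5) by auto
  with x xy show "\<sigma>2 h1 = - 3" "\<sigma>1 h2 = - 1" by auto
qed

lemma coroot_values: "\<sigma>1 h1 = 2" "\<sigma>2 h2 = 2"
  by (rule root_coroot [OF roots(1)], rule root_coroot [OF roots(2)])

text \<open>(a, b) are the coordinates of a weight with respect to the fundamental weights. The
  eigenvalue of \<open>E\<close> is carried along separately; it becomes a function of a and b once
  \<open>h1\<close> and \<open>h2\<close> are known to span \<tt>.\<close>

definition wt :: "(complex^'n) set \<Rightarrow> int \<Rightarrow> int \<Rightarrow> complex \<Rightarrow> bool"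
  where "wt W a b c \<longleftrightarrow> (\<exists>v\<in>W. v \<noteq> 0 \<and> \<rho> h1 *v v = of_int a *s v \<and> \<rho> h2 *v v = of_int b *s v
    \<and> \<rho> E *v v = c *s v)"

text \<open>The increments of a and b, here and in the next three lemmas, are the values of the
  simple root on \<open>h1\<close> and \<open>h2\<close>.\<close>

lemma string1:
  assumes "submodule W" "wt W a b c" "0 \<le> j" "j \<le> a"
  shows "wt W (a - 2 * j) (b + j) (c - of_int j * \<sigma>1 E)"
proof -
  obtain v where v: "v \<in> W" "v \<noteq> 0" "\<rho> h1 *v v = of_int a *s v" "\<rho> h2 *v v = of_int b *s v" "\<rho> E *v v = c *s v"
    using assms(2) unfolding wt_def by blast
  have n: "\<rho> h1 *v v = of_nat (nat a) *s v" "nat j \<le> nat a" using v(3) assms(3,4) by auto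
  obtain u where u: "u \<in> W" "u \<noteq> 0"
    "\<And>H d. H \<in> \<tt> \<Longrightarrow> \<rho> H *v v = d *s v \<Longrightarrow> \<rho> H *v u = (d - of_nat (nat j) * \<sigma>1 H) *s u"
    using root_string [OF roots(1) assms(1) v(1,2) n] by metis
  show ?thesis
    unfolding wt_def using u(1,2) u(3) [OF h_t(1) v(3)] u(3) [OF h_t(2) v(4)] u(3) [OF E_t v(5)] assms(3)
    by (intro bexI [of _ u]) (simp_all add: coroot_values cartan_integers mult.commute)
qed

lemma string2:
  assumes "submodule W" "wt W a b c" "0 \<le> j" "j \<le> b"
  shows "wt W (a + 3 * j) (b - 2 * j) (c - of_int j * \<sigma>2 E)"
proof -
  obtain v where v: "v \<in> W" "v \<noteq> 0" "\<rho> h1 *v v = of_int a *s v" "\<rho> h2 *v v = of_int b *s v" "\<rho> E *v v = c *s v"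
    using assms(2) unfolding wt_def by blast
  have n: "\<rho> h2 *v v = of_nat (nat b) *s v" "nat j \<le> nat b" using v(4) assms(3,4) by auto
  obtain u where u: "u \<in> W" "u \<noteq> 0"
    "\<And>H d. H \<in> \<tt> \<Longrightarrow> \<rho> H *v v = d *s v \<Longrightarrow> \<rho> H *v u = (d - of_nat (nat j) * \<sigma>2 H) *s u"
    using root_string [OF roots(2) assms(1) v(1,2) n] by metis
  show ?thesis
    unfolding wt_def using u(1,2) u(3) [OF h_t(1) v(3)] u(3) [OF h_t(2) v(4)] u(3) [OF E_t v(5)] assms(3)
    by (intro bexI [of _ u]) (simp_all add: coroot_values cartan_integers mult.commute)
qed

lemma string1_up:
  assumes "submodule W" "wt W a b c" "0 \<le> j" "j \<le> - a"
  shows "wt W (a + 2 * j) (b - j) (c + of_int j * \<sigma>1 E)"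
proof -
  obtain v where v: "v \<in> W" "v \<noteq> 0" "\<rho> h1 *v v = of_int a *s v" "\<rho> h2 *v v = of_int b *s v" "\<rho> E *v v = c *s v"
    using assms(2) unfolding wt_def by blast
  have n: "\<rho> h1 *v v = (- of_nat (nat (- a))) *s v" "nat j \<le> nat (- a)" using v(3) assms(3,4) by auto
  obtain u where u: "u \<in> W" "u \<noteq> 0"
    "\<And>H d. H \<in> \<tt> \<Longrightarrow> \<rho> H *v v = d *s v \<Longrightarrow> \<rho> H *v u = (d + of_nat (nat j) * \<sigma>1 H) *s u"
    using root_string_up [OF roots(1) assms(1) v(1,2) n] by metis
  show ?thesis
    unfolding wt_def using u(1,2) u(3) [OF h_t(1) v(3)] u(3) [OF h_t(2) v(4)] u(3) [OF E_t v(5)] assms(3)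
    by (intro bexI [of _ u]) (simp_all add: coroot_values cartan_integers mult.commute)
qed

lemma string2_up:
  assumes "submodule W" "wt W a b c" "0 \<le> j" "j \<le> - b"
  shows "wt W (a - 3 * j) (b + 2 * j) (c + of_int j * \<sigma>2 E)"
proof -
  obtain v where v: "v \<in> W" "v \<noteq> 0" "\<rho> h1 *v v = of_int a *s v" "\<rho> h2 *v v = of_int b *s v" "\<rho> E *v v = c *s v"
    using assms(2) unfolding wt_def by blast
  have n: "\<rho> h2 *v v = (- of_nat (nat (- b))) *s v" "nat j \<le> nat (- b)" using v(4) assms(3,4) by auto
  obtain u where u: "u \<in> W" "u \<noteq> 0"
    "\<And>H d. H \<in> \<tt> \<Longrightarrow> \<rho> H *v v = d *s v \<Longrightarrow> \<rho> H *v u = (d + of_nat (nat j) * \<sigma>2 H) *s u"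
    using root_string_up [OF roots(2) assms(1) v(1,2) n] by metis
  show ?thesis
    unfolding wt_def using u(1,2) u(3) [OF h_t(1) v(3)] u(3) [OF h_t(2) v(4)] u(3) [OF E_t v(5)] assms(3)
    by (intro bexI [of _ u]) (simp_all add: coroot_values cartan_integers mult.commute)
qed

text \<open>Together with (1, 0) these are the weights of the representation of dimension seven,
  from top to bottom. Both (0, 0) and (-2, 1) are reached from (2, -1), because the string lemmas
  make no step from (0, 0).\<close>

lemma seven_weights:
  assumes "wt UNIV 1 0 c"
  shows "wt UNIV (- 1) 1 (c - \<sigma>1 E)" "wt UNIV 2 (- 1) (c - \<sigma>1 E - \<sigma>2 E)" "wt UNIV 0 0 (c - 2 * \<sigma>1 E - \<sigma>2 E)"
    "wt UNIV (- 2) 1 (c - 3 * \<sigma>1 E - \<sigma>2 E)" "wt UNIV 1 (- 1) (c - 3 * \<sigma>1 E - 2 * \<sigma>2 E)"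
    "wt UNIV (- 1) 0 (c - 4 * \<sigma>1 E - 2 * \<sigma>2 E)"
proof -
  note U = submodule_UNIV
  show 1: "wt UNIV (- 1) 1 (c - \<sigma>1 E)" using string1 [OF U assms, of 1] by simp
  show 2: "wt UNIV 2 (- 1) (c - \<sigma>1 E - \<sigma>2 E)" using string2 [OF U 1, of 1] by simp
  show "wt UNIV 0 0 (c - 2 * \<sigma>1 E - \<sigma>2 E)" using string1 [OF U 2, of 1] by (simp add: algebra_simps)
  show 3: "wt UNIV (- 2) 1 (c - 3 * \<sigma>1 E - \<sigma>2 E)" using string1 [OF U 2, of 2] by (simp add: algebra_simps)
  show 4: "wt UNIV 1 (- 1) (c - 3 * \<sigma>1 E - 2 * \<sigma>2 E)" using string2 [OF U 3, of 1] by (simp add: algebra_simps)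
  show "wt UNIV (- 1) 0 (c - 4 * \<sigma>1 E - 2 * \<sigma>2 E)" using string1 [OF U 4, of 1] by (simp add: algebra_simps)
qed

lemma eigenvectors_basis:
  fixes A :: "complex^'n^'n"
  assumes C: "finite C" "card C = CARD('n)" and f: "\<And>c. c \<in> C \<Longrightarrow> f c \<noteq> 0 \<and> A *v f c = c *s f c"
    and x: "x \<noteq> 0" "A *v x = d *s x"
  shows "d \<in> C" "\<exists>k. x = k *s f d"
proof -
  have lin: "vecf.linear_on UNIV ((*v) A)"
    by (simp add: vecf.linear_on_def matrix_vector_right_distrib vector_scalar_commute)
  have ind: "inj_on f C" "vec.independent (f ` C)"
    using vecf.independent_eigenvectors [OF vec.subspace_UNIV lin C(1), of f] f by auto
  have span: "vec.span (f ` C) = UNIV"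
  proof -
    have "card (f ` C) = vec.dim (UNIV :: (complex^'n) set)"
      using C card_image [OF ind(1)] by (simp add: vec.dim_UNIV card_cart_basis)
    then have "UNIV \<subseteq> vec.span (f ` C)"
      using vec.card_ge_dim_independent [of "f ` C" UNIV] ind(2) by simp
    then show ?thesis by blast
  qed
  have "vec.span {u. \<exists>l\<in>C. A *v u = l *s u} = UNIV"
    using vec.span_mono [of "f ` C" "{u. \<exists>l\<in>C. A *v u = l *s u}"] f span by blast
  from eigenvalue_of_span [OF this x] show d: "d \<in> C" .
  show "\<exists>k. x = k *s f d"
  proof -
    obtain u where u: "x = (\<Sum>v\<in>f ` C. u v *s v)"
    proof -
      have "x \<in> range (\<lambda>u. \<Sum>v\<in>f ` C. u v *s v)"
        using vec.span_finite [OF finite_imageI [OF C(1)], of f] span by simp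
      then show thesis using that by blast
    qed
    then have u': "x = (\<Sum>c\<in>C. u (f c) *s f c)" using sum.reindex [OF ind(1), of "\<lambda>v. u v *s v"] by simp
    have "(\<Sum>c\<in>C. (u (f c) * (c - d)) *s f c) = A *v x - d *s x"
    proof -
      have "A *v x = (\<Sum>c\<in>C. A *v (u (f c) *s f c))"
        unfolding u' by (rule vecf.linear_on_sum [OF lin vec.subspace_UNIV]) simp
      also have "\<dots> = (\<Sum>c\<in>C. (u (f c) * c) *s f c)"
        using f by (intro sum.cong) (auto simp: vector_scalar_commute)
      finally show ?thesis
        by (simp add: u' vec.scale_sum_right sum_subtractf [symmetric] vec.scale_left_diff_distrib
          right_diff_distrib left_diff_distrib mult.commute)
    qed
    also have "\<dots> = 0" using x(2) by simp
    finally have "\<forall>c\<in>C. u (f c) * (c - d) = 0"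
      using vecf.eigenvectors_independent [OF vec.subspace_UNIV lin, of C f C "\<lambda>c. u (f c) * (c - d)"] f C(1)
      by auto
    then have "x = (\<Sum>c\<in>C. if c = d then u (f d) *s f d else 0)"
      unfolding u' by (intro sum.cong) auto
    also have "\<dots> = u (f d) *s f d" using d C(1) by simp
    finally show ?thesis by blast
  qed
qed

text \<open>Seven distinct eigenvalues in dimension seven leave one line for each and no room for
  others.\<close>

lemma principal_if_standard:
  assumes n: "CARD('n) = 7" and hw: "has_highest_weight \<gg> \<tt> \<bb> \<rho> (\<lambda>H. 2 * \<sigma>1 H + \<sigma>2 H)" and E: "E = T1 + T2"
  shows "\<exists>m. eigenspace (\<rho> E) m \<noteq> {0} \<and> (\<forall>l. eigenspace (\<rho> E) l \<noteq> {0} \<longrightarrow> l \<le> m)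
    \<and> (\<forall>k::nat. real k \<le> 2 * m \<longrightarrow> vec.dim (eigenspace (\<rho> E) (m - real k)) = 1)"
proof -
  have s: "\<sigma>1 E = 1" "\<sigma>2 E = 1"
    unfolding E root_add [OF roots(1) dual_values(1,2)] root_add [OF roots(2) dual_values(1,2)]
    by (simp_all add: dual_values)
  obtain v where v: "v \<noteq> 0" "\<And>H. H \<in> \<tt> \<Longrightarrow> \<rho> H *v v = (2 * \<sigma>1 H + \<sigma>2 H) *s v"
    using hw unfolding has_highest_weight_def by blast
  \<comment> \<open>By the Cartan integers 2 \<sigma>1 + \<sigma>2 takes the values 1 and 0 on
    \<open>h1\<close> and \<open>h2\<close>; on \<open>E\<close> it is 3 since both simple roots are
    1 there.\<close>
  have "wt UNIV 1 0 3"
    unfolding wt_def using v(1) v(2) [OF h_t(1)] v(2) [OF h_t(2)] v(2) [OF E_t]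
    by (intro bexI [of _ v]) (simp_all add: s coroot_values cartan_integers)
  note ws = this seven_weights [OF this]
  define C where "C = complex_of_real ` {- 3, - 2, - 1, 0, 1, 2, 3}"
  have "\<exists>u. u \<noteq> 0 \<and> \<rho> E *v u = c *s u" if "c \<in> C" for c
    using that ws unfolding C_def wt_def s by auto
  then obtain f where f: "\<And>c. c \<in> C \<Longrightarrow> f c \<noteq> 0 \<and> \<rho> E *v f c = c *s f c" by metis
  have C: "finite C" "card C = CARD('n)"
    unfolding n C_def by (simp_all add: card_image inj_on_def)
  have basis: "d \<in> C" "\<exists>k. x = k *s f d" if "x \<noteq> 0" "\<rho> E *v x = d *s x" for x d
    using eigenvectors_basis [OF C, of f "\<rho> E" x d] f that by blast+
  have eig: "eigenspace (\<rho> E) l \<noteq> {0} \<longleftrightarrow> l \<in> {- 3, - 2, - 1, 0, 1, 2, 3}" for l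
  proof
    assume "eigenspace (\<rho> E) l \<noteq> {0}"
    moreover have "0 \<in> eigenspace (\<rho> E) l" by (simp add: eigenspace_def)
    ultimately obtain x where "x \<noteq> 0" "\<rho> E *v x = complex_of_real l *s x"
      unfolding eigenspace_def by blast
    then have "complex_of_real l \<in> C" by (rule basis(1))
    then show "l \<in> {- 3, - 2, - 1, 0, 1, 2, 3}" unfolding C_def image_iff of_real_eq_iff by blast
  next
    assume "l \<in> {- 3, - 2, - 1, 0, 1, 2, 3}"
    then have "complex_of_real l \<in> C" unfolding C_def by blast
    from f [OF this] show "eigenspace (\<rho> E) l \<noteq> {0}" unfolding eigenspace_def by blast
  qed
  have dim: "vec.dim (eigenspace (\<rho> E) l) = 1" if l: "l \<in> {- 3, - 2, - 1, 0, 1, 2, 3}" for l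
  proof -
    have lC: "complex_of_real l \<in> C" using l unfolding C_def by blast
    have "eigenspace (\<rho> E) l = vec.span {f (complex_of_real l)}"
    proof (rule antisym)
      show "eigenspace (\<rho> E) l \<subseteq> vec.span {f (complex_of_real l)}"
      proof
        fix x assume x: "x \<in> eigenspace (\<rho> E) l"
        show "x \<in> vec.span {f (complex_of_real l)}"
        proof (cases "x = 0")
          case False
          with x show ?thesis using basis(2) [of x "complex_of_real l"]
            by (auto simp: eigenspace_def vec.span_singleton)
        qed (simp add: vec.span_zero)
      qed
      show "vec.span {f (complex_of_real l)} \<subseteq> eigenspace (\<rho> E) l"
        using f [OF lC] by (auto simp: eigenspace_def vec.span_singleton vector_scalar_commute mult.commute)
    qed
    then show ?thesis using f [OF lC] by (simp add: vec.dim_span vec.dim_singleton)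
  qed
  show ?thesis
  proof (intro exI [of _ 3] conjI allI impI)
    show "eigenspace (\<rho> E) 3 \<noteq> {0}" unfolding eig by simp
    show "l \<le> 3" if "eigenspace (\<rho> E) l \<noteq> {0}" for l using that unfolding eig by auto
    fix k :: nat assume "real k \<le> 2 * 3"
    then have "k \<in> {0, 1, 2, 3, 4, 5, 6}" by auto
    then show "vec.dim (eigenspace (\<rho> E) (3 - real k)) = 1" by (intro dim) auto
  qed
qed

end

section \<open>Principal representations\<close>

lemma span_bracket:
  assumes S: "cmat.subspace S" and gen: "\<And>X Y. X \<in> A \<Longrightarrow> Y \<in> B \<Longrightarrow> bracket X Y \<in> S"
    and XY: "X \<in> cmat.span A" "Y \<in> cmat.span B"
  shows "bracket X Y \<in> S"
proof -
  have 1: "bracket X Y \<in> S" if "X \<in> A" for X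
    using XY(2)
  proof (induction rule: cmat.span_induct)
    show "cmat.subspace {Y. bracket X Y \<in> S}"
      using S by (simp add: cmat.subspace_def bracket_add_right bracket_cscale_right)
  qed (use gen that in blast)
  show ?thesis
    using XY(1)
  proof (induction rule: cmat.span_induct)
    show "cmat.subspace {X. bracket X Y \<in> S}"
      using S by (simp add: cmat.subspace_def bracket_add_left bracket_cscale_left)
  qed (use 1 in blast)
qed

locale principal_g2 = g2_hodge \<gg> \<tt> \<rho> star h \<bb> \<sigma>1 \<sigma>2 T1 T2 E w
  for \<gg> \<tt> :: "(complex^'N^'N) set" and \<rho> :: "complex^'N^'N \<Rightarrow> complex^'n^'n" and star h \<bb> \<sigma>1 \<sigma>2 T1 T2 E w +
  fixes m :: real
  assumes E_star: "star E = E"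
    and m_eigenvalue: "eigenspace (\<rho> E) m \<noteq> {0}"
    and m_max: "eigenspace (\<rho> E) l \<noteq> {0} \<Longrightarrow> l \<le> m"
    and m_dim: "real k \<le> 2 * m \<Longrightarrow> vec.dim (eigenspace (\<rho> E) (m - real k)) = 1"
begin

lemma E_g: "E \<in> \<gg>"
  using t_in_g E_t .

lemma top_exists: "\<exists>v. v \<noteq> 0 \<and> \<rho> E *v v = complex_of_real m *s v"
proof -
  have "0 \<in> eigenspace (\<rho> E) m" by (simp add: eigenspace_def)
  with m_eigenvalue show ?thesis unfolding eigenspace_def by blast
qed

lemma eigenvalue_le:
  assumes "v \<noteq> 0" "\<rho> E *v v = complex_of_real l *s v"
  shows "l \<le> m"
proof (rule m_max)
  show "eigenspace (\<rho> E) l \<noteq> {0}" using assms unfolding eigenspace_def by blast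
qed

text \<open>\<open>E_span\<close> puts all eigenvalues into one coset of the integers, m is the
  largest of them, and \<open>E_sym\<close> makes -m a lower bound.\<close>

lemma eigenvalue_form:
  assumes v: "v \<noteq> 0" "\<rho> E *v v = c *s v"
  obtains k :: nat where "c = complex_of_real (m - real k)" "real k \<le> 2 * m"
proof -
  obtain u where u: "u \<noteq> 0" "\<rho> E *v u = complex_of_real m *s u" using top_exists by blast
  obtain i j :: int where ij: "c = complex_of_real (w + of_int i)" "complex_of_real m = complex_of_real (w + of_int j)"
    using eigenvalue_of_span [OF E_span v] eigenvalue_of_span [OF E_span u] by blast
  then have m: "m = w + of_int j" using of_real_eq_iff by blast
  have le: "w + of_int i \<le> m" using eigenvalue_le [OF v(1)] v(2) ij(1) by simp
  obtain x where "x \<noteq> 0" "\<rho> E *v x = complex_of_real (- (w + of_int i)) *s x"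
    using E_sym [OF v(2) [unfolded ij(1)] v(1)] by blast
  then have ge: "- (w + of_int i) \<le> m" by (rule eigenvalue_le)
  have "real (nat (j - i)) = of_int (j - i)" using le m by simp
  then show thesis using that [of "nat (j - i)"] ij(1) m le ge by simp
qed

lemma eigenspace_line:
  assumes "x \<noteq> 0" "\<rho> E *v x = c *s x" "\<rho> E *v y = c *s y"
  shows "\<exists>k. y = k *s x"
proof -
  obtain k where k: "c = complex_of_real (m - real k)" "real k \<le> 2 * m"
    using eigenvalue_form [OF assms(1,2)] by blast
  let ?V = "eigenspace (\<rho> E) (m - real k)"
  have "x \<in> ?V" "y \<in> ?V" using assms k(1) by (simp_all add: eigenspace_def)
  moreover have "vec.independent {x}" using assms(1) by simp
  ultimately have "?V \<subseteq> vec.span {x}"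
    using vec.card_ge_dim_independent [of "{x}" ?V] m_dim [OF k(2)] by simp
  with \<open>y \<in> ?V\<close> show ?thesis by (auto simp: vec.span_singleton)
qed

lemma matrix_zero:
  fixes A :: "complex^'n^'n"
  assumes "\<And>v c. v \<noteq> 0 \<Longrightarrow> \<rho> E *v v = c *s v \<Longrightarrow> A *v v = 0"
  shows "A = 0"
proof -
  have "vec.span {v. \<exists>l\<in>{l. \<exists>k :: int. l = complex_of_real (w + of_int k)}. \<rho> E *v v = l *s v} \<subseteq> {v. A *v v = 0}"
  proof (rule vec.span_minimal)
    show "{v. \<exists>l\<in>{l. \<exists>k :: int. l = complex_of_real (w + of_int k)}. \<rho> E *v v = l *s v} \<subseteq> {v. A *v v = 0}"
    proof
      fix v assume "v \<in> {v. \<exists>l\<in>{l. \<exists>k :: int. l = complex_of_real (w + of_int k)}. \<rho> E *v v = l *s v}"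
      then obtain l where "\<rho> E *v v = l *s v" by blast
      then show "v \<in> {v. A *v v = 0}" using assms by (cases "v = 0") auto
    qed
    show "vec.subspace {v. A *v v = 0}"
      by (simp add: vec.subspace_def matrix_vector_right_distrib vector_scalar_commute)
  qed
  then have "A *v v = 0" for v unfolding E_span by blast
  then show ?thesis by (simp add: matrix_eq)
qed

lemma eigenvector_shift:
  assumes "X \<in> \<gg>" "bracket E X = cscale d X" "\<rho> E *v v = c *s v"
  shows "\<rho> E *v (\<rho> X *v v) = (c + d) *s (\<rho> X *v v)"
  unfolding rho_commute [OF E_g assms(1)] assms(2)
  by (simp add: assms(3) rho_cscale cscale_vector vector_scalar_commute vec.scale_left_distrib)

text \<open>X and every H in \<tt> commute with \<open>E\<close>, so both are scalar on each
  eigenline of \<open>E\<close>; thus X centralizes \<tt>.\<close>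

lemma centralizer_E:
  assumes X: "X \<in> \<gg>" "bracket E X = 0"
  shows "X \<in> \<tt>"
proof (rule centralizer_t [OF X(1)])
  fix H assume H: "H \<in> \<tt>"
  have scalar: "\<exists>a. \<rho> Y *v v = a *s v"
    if "Y \<in> \<gg>" "bracket E Y = 0" "v \<noteq> 0" "\<rho> E *v v = c *s v" for Y v c
    using eigenspace_line [OF that(3,4)] eigenvector_shift [OF that(1) _ that(4), of 0] that(2) by simp
  have "\<rho> (bracket H X) = 0"
  proof (rule matrix_zero)
    fix v c assume v: "v \<noteq> 0" "\<rho> E *v v = c *s v"
    obtain a where a: "\<rho> X *v v = a *s v" using scalar [OF X v] by blast
    obtain b where b: "\<rho> H *v v = b *s v" using scalar [OF t_in_g [OF H] t_abelian [OF E_t H] v] by blast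
    show "\<rho> (bracket H X) *v v = 0"
      using rho_commute [OF t_in_g [OF H] X(1), of v] a b
      by (simp add: vector_scalar_commute mult.commute)
  qed
  then show "bracket H X = 0" by (rule rho_eq_0 [OF g_bracket [OF t_in_g [OF H] X(1)]])
qed

text \<open>X carries some eigenvector of \<open>E\<close> to another one, and c is the difference
  of the two eigenvalues, both of which lie between -m and m.\<close>

lemma ad_E_eigenvalue:
  assumes X: "X \<in> \<gg>" "X \<noteq> 0" "bracket E X = cscale c X"
  obtains k :: int where "c = of_int k" "of_int k \<le> 2 * m"
proof -
  have "\<rho> X \<noteq> 0" using rho_eq_0 X by blast
  then obtain v d where v: "v \<noteq> 0" "\<rho> E *v v = d *s v" "\<rho> X *v v \<noteq> 0" using matrix_zero by metis
  obtain i :: nat where i: "d = complex_of_real (m - real i)" "real i \<le> 2 * m"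
    using eigenvalue_form [OF v(1,2)] by blast
  obtain j :: nat where j: "d + c = complex_of_real (m - real j)" "real j \<le> 2 * m"
    using eigenvalue_form [OF v(3) eigenvector_shift [OF X(1,3) v(2)]] by blast
  have "c = (d + c) - d" by simp
  also have "\<dots> = complex_of_real (m - real j) - complex_of_real (m - real i)" by (simp only: j(1)) (simp only: i(1))
  also have "\<dots> = of_int (int i - int j)" by simp
  finally show thesis using that [of "int i - int j"] i(2) by simp
qed

text \<open>A filtration by eigenvalues of ad E, which are integers here. \<open>filt 0\<close> will
  turn out to be \<bb>, and its derived series descends through the later terms.\<close>

definition filt :: "int \<Rightarrow> (complex^'N^'N) set"
  where "filt k = cmat.span {X \<in> \<gg>. \<exists>c\<ge>k. bracket E X = cscale (of_int c) X}"

lemma bracket_E_bracket: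
  assumes "bracket E X = cscale c X" "bracket E Y = cscale d Y"
  shows "bracket E (bracket X Y) = cscale (c + d) (bracket X Y)"
  unfolding bracket_jacobi [of E X Y]
  by (simp add: assms bracket_cscale_left bracket_cscale_right cmat.scale_left_distrib)

lemma filt_g: "filt k \<subseteq> \<gg>"
  unfolding filt_def by (rule cmat.span_minimal [OF _ g_subspace]) blast

text \<open>Eigenvalues add, so the degree rises unless k = 0 and both factors have degree 0. Such
  factors centralize \<open>E\<close>, so they lie in \<tt> and commute.\<close>

lemma filt_bracket:
  assumes "0 \<le> k" "X \<in> filt k" "Y \<in> filt k"
  shows "bracket X Y \<in> filt (k + 1)"
  using assms(2,3) unfolding filt_def
proof (rule span_bracket [rotated 2])
  fix X Y
  assume "X \<in> {X \<in> \<gg>. \<exists>c\<ge>k. bracket E X = cscale (of_int c) X}"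
    and "Y \<in> {X \<in> \<gg>. \<exists>c\<ge>k. bracket E X = cscale (of_int c) X}"
  then obtain c d where X: "X \<in> \<gg>" "c \<ge> k" "bracket E X = cscale (of_int c) X"
    and Y: "Y \<in> \<gg>" "d \<ge> k" "bracket E Y = cscale (of_int d) Y" by blast
  show "bracket X Y \<in> cmat.span {X \<in> \<gg>. \<exists>c\<ge>k + 1. bracket E X = cscale (of_int c) X}"
  proof (cases "c + d \<ge> k + 1")
    case True
    have "bracket E (bracket X Y) = cscale (of_int (c + d)) (bracket X Y)"
      using bracket_E_bracket [OF X(3) Y(3)] by simp
    then show ?thesis using True g_bracket [OF X(1) Y(1)] by (intro cmat.span_base) blast
  next
    case False
    then have "c = 0" "d = 0" using X(2) Y(2) assms(1) by linarith+
    then have "X \<in> \<tt>" "Y \<in> \<tt>" using centralizer_E X Y by auto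
    then show ?thesis using t_abelian by (simp add: cmat.span_zero)
  qed
qed (rule cmat.subspace_span)

lemma filt_mono: "k \<le> l \<Longrightarrow> filt l \<subseteq> filt k"
  unfolding filt_def by (rule cmat.span_mono) (blast intro: order_trans)

lemma filt_zero:
  assumes "2 * m < of_int k"
  shows "filt k \<subseteq> {0}"
proof -
  have "X = 0" if X: "X \<in> \<gg>" "c \<ge> k" "bracket E X = cscale (of_int c) X" for X c
  proof (rule ccontr)
    assume "X \<noteq> 0"
    then obtain l :: int where l: "complex_of_int c = of_int l" "of_int l \<le> 2 * m"
      using ad_E_eigenvalue [OF X(1) _ X(3)] by blast
    then have "c = l" using of_int_eq_iff by blast
    then show False using l(2) X(2) assms by linarith
  qed
  then show ?thesis unfolding filt_def by (intro cmat.span_minimal) (auto simp: cmat.subspace_single_0)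
qed

lemma nonneg_part_filt: "nonneg_part \<gg> E = filt 0"
proof -
  have "{X \<in> \<gg>. \<exists>c\<in>\<real>\<^sub>\<ge>\<^sub>0. bracket E X = cscale c X} = {X \<in> \<gg>. \<exists>c\<ge>0. bracket E X = cscale (of_int c) X}"
  proof (intro set_eqI iffI)
    fix X assume "X \<in> {X \<in> \<gg>. \<exists>c\<in>\<real>\<^sub>\<ge>\<^sub>0. bracket E X = cscale c X}"
    then obtain c where X: "X \<in> \<gg>" "c \<in> \<real>\<^sub>\<ge>\<^sub>0" "bracket E X = cscale c X" by blast
    show "X \<in> {X \<in> \<gg>. \<exists>c\<ge>0. bracket E X = cscale (of_int c) X}"
    proof (cases "X = 0")
      case True
      then show ?thesis using g_zero by auto
    next
      case False
      then obtain k where k: "c = of_int k" using ad_E_eigenvalue [OF X(1) _ X(3)] by blast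
      with X(2) have "0 \<le> k" by (auto simp: complex_nonneg_Reals_iff)
      with X k show ?thesis by blast
    qed
  next
    fix X assume "X \<in> {X \<in> \<gg>. \<exists>c\<ge>0. bracket E X = cscale (of_int c) X}"
    then obtain c where "X \<in> \<gg>" "c \<ge> 0" "bracket E X = cscale (of_int c) X" by blast
    moreover have "complex_of_int c \<in> \<real>\<^sub>\<ge>\<^sub>0" using \<open>c \<ge> 0\<close> by (simp add: complex_nonneg_Reals_iff)
    ultimately show "X \<in> {X \<in> \<gg>. \<exists>c\<in>\<real>\<^sub>\<ge>\<^sub>0. bracket E X = cscale c X}" by blast
  qed
  then show ?thesis by (simp add: nonneg_part_def filt_def)
qed

lemma derived_filt:
  assumes "0 \<le> k" "A \<subseteq> filt k"
  shows "derived_algebra A \<subseteq> filt (k + 1)"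
  unfolding derived_algebra_def
proof (rule cmat.span_minimal)
  show "cmat.subspace (filt (k + 1))" by (simp add: filt_def cmat.subspace_span)
qed (use filt_bracket assms in blast)

text \<open>Eigenvalues of ad E are at most 2 m, so the filtration reaches 0.\<close>

lemma solvable_filt: "solvable_subalgebra \<gg> (filt 0)"
  unfolding solvable_subalgebra_def lie_subalgebra_def
proof (intro conjI ballI)
  show "cmat.subspace (filt 0)" by (simp add: filt_def cmat.subspace_span)
  show "filt 0 \<subseteq> \<gg>" by (rule filt_g)
  show "bracket X Y \<in> filt 0" if "X \<in> filt 0" "Y \<in> filt 0" for X Y
    using filt_bracket [OF _ that] filt_mono [of 0 1] by auto
  have der: "(derived_algebra ^^ k) (filt 0) \<subseteq> filt (int k)" for k
  proof (induction k)
    case (Suc k)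
    then show ?case using derived_filt [of "int k"] by (simp add: add.commute)
  qed simp
  obtain K :: nat where K: "2 * m < real K" using reals_Archimedean2 by blast
  have "(derived_algebra ^^ Suc K) (filt 0) \<subseteq> {0}"
    using der [of "Suc K"] filt_zero [of "int (Suc K)"] K by simp
  moreover have "0 \<in> (derived_algebra ^^ Suc K) (filt 0)"
    by (simp add: derived_algebra_def cmat.span_zero)
  ultimately show "\<exists>k. (derived_algebra ^^ k) (filt 0) = {0}" by blast
qed

text \<open>A Borel subalgebra is maximal among the solvable ones, and the solvable
  \<open>filt 0\<close> contains \<bb>.\<close>

lemma borel_eq: "\<bb> = filt 0"
  using borel b_nonneg solvable_filt unfolding borel_subalgebra_def nonneg_part_filt by blast

lemma root_E:
  assumes \<alpha>: "\<alpha> \<in> roots \<gg> \<tt>"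
  obtains k :: int where "\<alpha> E = of_int k" "k \<noteq> 0"
proof -
  note X = root_vec [OF \<alpha>]
  note EX = root_spaceD(2) [OF X(1) E_t]
  obtain k where k: "\<alpha> E = of_int k" using ad_E_eigenvalue [OF X(3,2) EX] by blast
  have "k \<noteq> 0"
  proof
    assume "k = 0"
    then have "root_vec \<alpha> \<in> \<tt>" using centralizer_E X EX k by simp
    then have "\<alpha> H = 0" if "H \<in> \<tt>" for H
      using root_spaceD(2) [OF X(1) that] t_abelian [OF that] X(2) by (simp add: cmat.scale_eq_0_iff)
    then show False using \<alpha> by (auto simp: roots_def)
  qed
  with k show thesis using that by blast
qed

lemma root_pos:
  assumes "\<alpha> \<in> roots \<gg> \<tt>" "\<alpha> E = of_int k" "k > 0"
  shows "\<alpha> \<in> positive_roots \<gg> \<tt> \<bb>"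
proof -
  have "root_space \<gg> \<tt> \<alpha> \<subseteq> filt 0"
  proof
    fix X assume X: "X \<in> root_space \<gg> \<tt> \<alpha>"
    have "bracket E X = cscale (of_int k) X" using root_spaceD(2) [OF X E_t] assms(2) by simp
    then show "X \<in> filt 0"
      unfolding filt_def using root_spaceD(1) [OF X] assms(3) by (intro cmat.span_base) (auto intro: exI [of _ k])
  qed
  then show ?thesis using assms(1) borel_eq by (simp add: positive_roots_def)
qed

text \<open>\<open>E\<close> is self-adjoint, so eigenvectors of ad E with different eigenvalues are
  orthogonal. A root vector of negative degree would be orthogonal to \<open>filt 0\<close>, which
  contains it.\<close>

lemma positive_root_E:
  assumes \<alpha>: "\<alpha> \<in> positive_roots \<gg> \<tt> \<bb>"
  obtains k :: nat where "\<alpha> E = of_nat k" "k \<ge> 1"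
proof -
  have root: "\<alpha> \<in> roots \<gg> \<tt>" and sub: "root_space \<gg> \<tt> \<alpha> \<subseteq> filt 0"
    using \<alpha> borel_eq by (auto simp: positive_roots_def)
  obtain k where k: "\<alpha> E = of_int k" "k \<noteq> 0" using root_E [OF root] by blast
  let ?X = "root_vec \<alpha>"
  note X = root_vec [OF root]
  have EX: "bracket E ?X = cscale (of_int k) ?X" using root_spaceD(2) [OF X(1) E_t] k by simp
  have "k > 0"
  proof (rule ccontr)
    assume "\<not> k > 0"
    then have k: "k < 0" using k(2) by simp
    have orth: "ip ?X Y = 0" if Y: "Y \<in> {X \<in> \<gg>. \<exists>c\<ge>0. bracket E X = cscale (of_int c) X}" for Y
    proof -
      obtain c where c: "Y \<in> \<gg>" "c \<ge> 0" "bracket E Y = cscale (of_int c) Y" using Y by blast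
      have "of_int k * ip ?X Y = ip (bracket E ?X) Y"
        unfolding EX by (rule gf.ip_scale [OF X(3) c(1), symmetric])
      also have "\<dots> = ip ?X (bracket E Y)" using ip_bracket [OF E_g X(3) c(1)] E_star by simp
      also have "\<dots> = of_int c * ip ?X Y"
        unfolding c(3) using gf.ip_scale_right [OF X(3) c(1)] by simp
      finally show ?thesis using k c(2) by (simp add: algebra_simps)
    qed
    have "?X \<in> filt 0" using sub X(1) by blast
    then have "ip ?X ?X = 0"
      unfolding filt_def by (rule gf.orthogonal_span [OF _ X(3) orth, rotated 2]) auto
    then show False using gf.ip_definite [OF X(3,2)] by simp
  qed
  then show thesis using that [of "nat k"] k by simp
qed

text \<open>Induction on the value at \<open>E\<close>: a positive root that is not simple is a sum
  of two positive roots, both of smaller value.\<close>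

lemma positive_root_combination:
  assumes "\<alpha> \<in> positive_roots \<gg> \<tt> \<bb>" "\<alpha> E = of_nat k"
  shows "\<exists>a b :: nat. \<alpha> = (\<lambda>H. of_nat a * \<sigma>1 H + of_nat b * \<sigma>2 H)"
  using assms
proof (induction k arbitrary: \<alpha> rule: less_induct)
  case (less k)
  show ?case
  proof (cases "\<alpha> \<in> simple_roots \<gg> \<tt> \<bb>")
    case True
    then consider "\<alpha> = \<sigma>1" | "\<alpha> = \<sigma>2" using simple by auto
    then show ?thesis
    proof cases
      case 1
      then show ?thesis by (intro exI [of _ 1] exI [of _ 0]) simp
    next
      case 2
      then show ?thesis by (intro exI [of _ 0] exI [of _ 1]) simp
    qed
  next
    case False
    then obtain \<beta> \<gamma> where bc: "\<beta> \<in> positive_roots \<gg> \<tt> \<bb>" "\<gamma> \<in> positive_roots \<gg> \<tt> \<bb>" "\<alpha> = (\<lambda>H. \<beta> H + \<gamma> H)"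
      using less.prems(1) unfolding simple_roots_def by blast
    obtain i where i: "\<beta> E = of_nat i" "i \<ge> 1" using positive_root_E [OF bc(1)] by blast
    obtain j where j: "\<gamma> E = of_nat j" "j \<ge> 1" using positive_root_E [OF bc(2)] by blast
    have "complex_of_nat k = of_nat (i + j)" using less.prems(2) bc(3) i j by simp
    then have "k = i + j" using of_nat_eq_iff by blast
    then have "i < k" "j < k" using i(2) j(2) by auto
    then obtain a b a' b' :: nat where ab: "\<beta> = (\<lambda>H. of_nat a * \<sigma>1 H + of_nat b * \<sigma>2 H)"
      "\<gamma> = (\<lambda>H. of_nat a' * \<sigma>1 H + of_nat b' * \<sigma>2 H)"
      using less.IH [of i \<beta>] less.IH [of j \<gamma>] bc(1,2) i(1) j(1) by blast
    have "\<alpha> = (\<lambda>H. of_nat (a + a') * \<sigma>1 H + of_nat (b + b') * \<sigma>2 H)"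
      unfolding bc(3) ab by (simp add: algebra_simps)
    then show ?thesis by blast
  qed
qed

lemma root_sign:
  assumes \<alpha>: "\<alpha> \<in> roots \<gg> \<tt>"
  shows "\<alpha> \<in> positive_roots \<gg> \<tt> \<bb> \<or> (\<lambda>H. - \<alpha> H) \<in> positive_roots \<gg> \<tt> \<bb>"
proof -
  obtain k where k: "\<alpha> E = of_int k" "k \<noteq> 0" using root_E [OF \<alpha>] by blast
  then consider "k > 0" | "- k > 0" by linarith
  then show ?thesis
  proof cases
    case 2
    have "- \<alpha> E = of_int (- k)" using k by simp
    then show ?thesis using root_pos [OF neg_root [OF \<alpha>] _ 2] by blast
  qed (use root_pos \<alpha> k in blast)
qed

text \<open>All roots are combinations of \<sigma>1 and \<sigma>2 and so vanish at H; by the root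
  decomposition H is central.\<close>

lemma t_eq_0:
  assumes H: "H \<in> \<tt>" "\<sigma>1 H = 0" "\<sigma>2 H = 0"
  shows "H = 0"
proof (rule centreless [OF t_in_g [OF H(1)]])
  have root0: "\<alpha> H = 0" if \<alpha>: "\<alpha> \<in> roots \<gg> \<tt>" for \<alpha>
  proof -
    have pos: "\<beta> H = 0" if \<beta>: "\<beta> \<in> positive_roots \<gg> \<tt> \<bb>" for \<beta>
    proof -
      obtain k where "\<beta> E = of_nat k" using positive_root_E [OF \<beta>] by blast
      then obtain a b :: nat where "\<beta> = (\<lambda>H. of_nat a * \<sigma>1 H + of_nat b * \<sigma>2 H)"
        using positive_root_combination [OF \<beta>] by blast
      then show ?thesis using H by simp
    qed
    show ?thesis using root_sign [OF \<alpha>] pos by force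
  qed
  fix Y assume "Y \<in> \<gg>"
  then have "Y \<in> cmat.span (\<tt> \<union> (\<Union>\<alpha>\<in>roots \<gg> \<tt>. root_space \<gg> \<tt> \<alpha>))" using root_decomposition by blast
  then show "bracket H Y = 0"
  proof (induction rule: cmat.span_induct)
    show "cmat.subspace {Y. bracket H Y = 0}"
      by (simp add: cmat.subspace_def bracket_add_right bracket_cscale_right)
  next
    fix Y assume "Y \<in> \<tt> \<union> (\<Union>\<alpha>\<in>roots \<gg> \<tt>. root_space \<gg> \<tt> \<alpha>)"
    then show "bracket H Y = 0"
      using t_abelian H(1) root_spaceD(2) root0 by (metis UN_E Un_iff cmat.scale_zero_left)
  qed
qed

text \<open>The coefficients come from inverting the Cartan matrix, of determinant 1; they are the
  fundamental weights \<omega>1 = 2 \<sigma>1 + \<sigma>2 and \<omega>2 = 3 \<sigma>1 + 2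
  \<sigma>2.\<close>

lemma t_expand:
  assumes H: "H \<in> \<tt>"
  shows "H = cscale (2 * \<sigma>1 H + \<sigma>2 H) h1 + cscale (3 * \<sigma>1 H + 2 * \<sigma>2 H) h2"
proof -
  let ?K = "cscale (2 * \<sigma>1 H + \<sigma>2 H) h1 + cscale (3 * \<sigma>1 H + 2 * \<sigma>2 H) h2"
  have K: "cscale a h1 \<in> \<tt>" "cscale a h2 \<in> \<tt>" for a using t_cscale h_t by auto
  have Kt: "?K \<in> \<tt>" using t_add K by blast
  have lin: "\<alpha> (H - ?K) = \<alpha> H - ((2 * \<sigma>1 H + \<sigma>2 H) * \<alpha> h1 + (3 * \<sigma>1 H + 2 * \<sigma>2 H) * \<alpha> h2)"
    if \<alpha>: "\<alpha> \<in> roots \<gg> \<tt>" for \<alpha>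
  proof -
    have "\<alpha> (H - ?K + ?K) = \<alpha> (H - ?K) + \<alpha> ?K" by (rule root_add [OF \<alpha> t_diff [OF H Kt] Kt])
    moreover have "\<alpha> ?K = (2 * \<sigma>1 H + \<sigma>2 H) * \<alpha> h1 + (3 * \<sigma>1 H + 2 * \<sigma>2 H) * \<alpha> h2"
      unfolding root_add [OF \<alpha> K] root_cscale [OF \<alpha> h_t(1)] root_cscale [OF \<alpha> h_t(2)] ..
    ultimately show ?thesis by simp
  qed
  have "H - ?K = 0"
    by (rule t_eq_0 [OF t_diff [OF H Kt]])
      (simp_all add: lin roots coroot_values cartan_integers)
  then show ?thesis by simp
qed

definition n1 :: int where "n1 = (SOME k. \<sigma>1 E = of_int k)"
definition n2 :: int where "n2 = (SOME k. \<sigma>2 E = of_int k)"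

lemma n12: "\<sigma>1 E = of_int n1" "n1 \<ge> 1" "\<sigma>2 E = of_int n2" "n2 \<ge> 1"
proof -
  have *: "\<exists>k :: int. \<alpha> E = of_int k \<and> k \<ge> 1" if "\<alpha> \<in> positive_roots \<gg> \<tt> \<bb>" for \<alpha>
    using positive_root_E [OF that] by (metis of_int_of_nat_eq of_nat_1 of_nat_mono)
  obtain k where k: "\<sigma>1 E = of_int k" "k \<ge> 1" using * [OF positive(1)] by blast
  then have "n1 = k" unfolding n1_def by simp
  with k show "\<sigma>1 E = of_int n1" "n1 \<ge> 1" by auto
  obtain k where k: "\<sigma>2 E = of_int k" "k \<ge> 1" using * [OF positive(2)] by blast
  then have "n2 = k" unfolding n2_def by simp
  with k show "\<sigma>2 E = of_int n2" "n2 \<ge> 1" by auto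
qed

lemma weight_values:
  assumes "\<rho> h1 *v v = a *s v" "\<rho> h2 *v v = b *s v" "H \<in> \<tt>"
  shows "\<rho> H *v v = ((2 * \<sigma>1 H + \<sigma>2 H) * a + (3 * \<sigma>1 H + 2 * \<sigma>2 H) * b) *s v"
proof -
  have "\<rho> H = cscale (2 * \<sigma>1 H + \<sigma>2 H) (\<rho> h1) + cscale (3 * \<sigma>1 H + 2 * \<sigma>2 H) (\<rho> h2)"
    by (subst t_expand [OF assms(3)]) (simp add: rho_add rho_cscale)
  then show ?thesis
    by (simp add: matrix_vector_mult_add_rdistrib cscale_vector assms(1,2) vec.scale_left_distrib)
qed

text \<open>The value of the weight a \<omega>1 + b \<omega>2 at \<open>E\<close>.\<close>

definition ev :: "int \<Rightarrow> int \<Rightarrow> int"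
  where "ev a b = (2 * n1 + n2) * a + (3 * n1 + 2 * n2) * b"

lemma wt_E: "wt W a b c \<Longrightarrow> c = of_int (ev a b)"
proof -
  assume "wt W a b c"
  then obtain v where v: "v \<noteq> 0" "\<rho> h1 *v v = of_int a *s v" "\<rho> h2 *v v = of_int b *s v" "\<rho> E *v v = c *s v"
    unfolding wt_def by blast
  have "c *s v = of_int (ev a b) *s v"
    using weight_values [OF v(2,3) E_t] v(4) by (simp add: n12 ev_def)
  then show ?thesis using v(1) by (simp add: vec.scale_cancel_right)
qed

lemma wt_le: "wt W a b c \<Longrightarrow> of_int (ev a b) \<le> m"
  using wt_E [of W a b c] eigenvalue_le unfolding wt_def by (metis of_real_of_int_eq)

text \<open>Weight vectors with the same value at \<open>E\<close> lie on the same
  eigenline.\<close>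

lemma wt_unique:
  assumes "wt W a b c" "wt W' a' b' c'" "ev a b = ev a' b'"
  shows "a = a' \<and> b = b'"
proof -
  obtain v where v: "v \<noteq> 0" "\<rho> h1 *v v = of_int a *s v" "\<rho> h2 *v v = of_int b *s v" "\<rho> E *v v = c *s v"
    using assms(1) unfolding wt_def by blast
  obtain u where u: "u \<noteq> 0" "\<rho> h1 *v u = of_int a' *s u" "\<rho> h2 *v u = of_int b' *s u" "\<rho> E *v u = c' *s u"
    using assms(2) unfolding wt_def by blast
  have "c = c'" using wt_E assms by metis
  then obtain k where k: "u = k *s v" using eigenspace_line [OF v(1,4)] u(4) by blast
  have "of_int a *s u = of_int a' *s u" using u(2) v(2) k by (simp add: vector_scalar_commute mult.commute)
  moreover have "of_int b *s u = of_int b' *s u" using u(3) v(3) k by (simp add: vector_scalar_commute mult.commute)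
  ultimately show ?thesis using u(1) by (simp add: vec.scale_cancel_right)
qed

lemma raise_zero:
  assumes v: "v \<noteq> 0" "\<rho> E *v v = c *s v"
    and top: "\<And>j :: nat. j \<ge> 1 \<Longrightarrow> \<rho> E *v (\<rho> X *v v) = (c + of_nat j) *s (\<rho> X *v v) \<Longrightarrow> \<rho> X *v v = 0"
    and \<alpha>: "\<alpha> \<in> positive_roots \<gg> \<tt> \<bb>" "X \<in> root_space \<gg> \<tt> \<alpha>"
  shows "\<rho> X *v v = 0"
proof -
  obtain j where j: "\<alpha> E = of_nat j" "j \<ge> 1" using positive_root_E [OF \<alpha>(1)] by blast
  show ?thesis
    by (rule top [OF j(2)], rule eigenvector_shift [OF root_spaceD(1) [OF \<alpha>(2)] _ v(2)])
      (use root_spaceD(2) [OF \<alpha>(2) E_t] j in simp)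
qed

text \<open>An eigenvector of \<open>E\<close> in W with the largest eigenvalue, that is, the
  smallest k. Positive root vectors would raise the eigenvalue by at least 1. Coroots commute with
  \<open>E\<close>, hence act on its eigenline by a scalar, and \<open>primitive_vector\<close>
  makes this scalar a natural number.\<close>

lemma highest_vector:
  assumes W: "submodule W" "W \<noteq> {0}"
  obtains v k and p q :: nat where "v \<in> W" "v \<noteq> 0" "\<rho> E *v v = complex_of_real (m - real k) *s v"
    "\<And>u c. u \<in> W \<Longrightarrow> u \<noteq> 0 \<Longrightarrow> \<rho> E *v u = complex_of_real c *s u \<Longrightarrow> c \<le> m - real k"
    "\<And>\<alpha> X. \<alpha> \<in> positive_roots \<gg> \<tt> \<bb> \<Longrightarrow> X \<in> root_space \<gg> \<tt> \<alpha> \<Longrightarrow> \<rho> X *v v = 0"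
    "\<rho> h1 *v v = of_nat p *s v" "\<rho> h2 *v v = of_nat q *s v"
proof -
  have sub: "vec.subspace W" using W(1) by (simp add: submodule_def)
  obtain x c where x: "x \<in> W" "x \<noteq> 0" "\<rho> E *v x = c *s x"
    using vecf.eigenvector_exists [OF sub W(2) rho_linear_on [OF W(1) E_g]] by blast
  let ?P = "\<lambda>k. \<exists>v\<in>W. v \<noteq> 0 \<and> \<rho> E *v v = complex_of_real (m - real k) *s v"
  have "\<exists>k. ?P k" using eigenvalue_form [OF x(2,3)] x by metis
  define k where "k = (LEAST k. ?P k)"
  have "?P k" unfolding k_def by (rule LeastI_ex) fact
  then obtain v where v: "v \<in> W" "v \<noteq> 0" "\<rho> E *v v = complex_of_real (m - real k) *s v" by blast
  have max: "c \<le> m - real k" if u: "u \<in> W" "u \<noteq> 0" "\<rho> E *v u = complex_of_real c *s u" for u c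
  proof -
    obtain l where l: "complex_of_real c = complex_of_real (m - real l)" using eigenvalue_form [OF u(2,3)] by blast
    then have c: "c = m - real l" using of_real_eq_iff by blast
    have "?P l" using u c by blast
    then have "k \<le> l" unfolding k_def by (rule Least_le)
    with c show ?thesis by simp
  qed
  have kill: "\<rho> X *v v = 0" if \<alpha>: "\<alpha> \<in> positive_roots \<gg> \<tt> \<bb>" and X: "X \<in> root_space \<gg> \<tt> \<alpha>" for \<alpha> X
  proof (rule raise_zero [OF v(2,3) _ \<alpha> X], rule ccontr)
    fix j :: nat assume j: "j \<ge> 1" and nz: "\<rho> X *v v \<noteq> 0"
      and eq: "\<rho> E *v (\<rho> X *v v) = (complex_of_real (m - real k) + of_nat j) *s (\<rho> X *v v)"
    have "\<rho> X *v v \<in> W" using W(1) v(1) root_spaceD(1) [OF X] by (simp add: submodule_def)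
    moreover have "\<rho> E *v (\<rho> X *v v) = complex_of_real (m - real k + real j) *s (\<rho> X *v v)" using eq by simp
    ultimately have "m - real k + real j \<le> m - real k" using max nz by blast
    with j show False by simp
  qed
  have cartan: "\<exists>n :: nat. \<rho> (coroot \<alpha>) *v v = of_nat n *s v" if \<alpha>: "\<alpha> \<in> positive_roots \<gg> \<tt> \<bb>" for \<alpha>
  proof -
    have root: "\<alpha> \<in> roots \<gg> \<tt>" using \<alpha> by (simp add: positive_roots_def)
    interpret sl2_module "(*s)" cart_basis W "(*v) (\<rho> (root_vec \<alpha>))" "(*v) (\<rho> (opp_vec \<alpha>))" "(*v) (\<rho> (coroot \<alpha>))"
      by (rule rho_sl2 [OF root W(1)])
    note ct = coroot_t [OF root]
    have "\<rho> E *v (\<rho> (coroot \<alpha>) *v v) = (complex_of_real (m - real k) + 0) *s (\<rho> (coroot \<alpha>) *v v)"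
      by (rule eigenvector_shift [OF t_in_g [OF ct] _ v(3)]) (simp add: t_abelian [OF E_t ct])
    then obtain c where c: "\<rho> (coroot \<alpha>) *v v = c *s v" using eigenspace_line [OF v(2,3)] by auto
    obtain n :: nat where "c = of_nat n"
      by (rule primitive_vector [OF v(1,2) kill [OF \<alpha> root_vec(1) [OF root]] c])
    with c show ?thesis by blast
  qed
  obtain p q :: nat where pq: "\<rho> h1 *v v = of_nat p *s v" "\<rho> h2 *v v = of_nat q *s v"
    using cartan [OF positive(1)] cartan [OF positive(2)] by blast
  show thesis
  proof (rule that [of v k p q])
    show "\<rho> X *v v = 0" if "\<alpha> \<in> positive_roots \<gg> \<tt> \<bb>" "X \<in> root_space \<gg> \<tt> \<alpha>" for \<alpha> X
      using kill that .
    show "c \<le> m - real k" if "u \<in> W" "u \<noteq> 0" "\<rho> E *v u = complex_of_real c *s u" for u c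
      using max that .
  qed (fact v pq)+
qed

text \<open>Induction on the height: \<omega>1 and \<omega>2 are sums of 3 and 5 simple roots, so 3
  p + 5 q drops by 1 whenever a simple root is subtracted.\<close>

lemma zero_weight_of_dominant:
  assumes W: "submodule W" and pq: "wt W (int p) (int q) c"
  shows "\<exists>c. wt W 0 0 c"
  using pq
proof (induction "3 * p + 5 * q" arbitrary: p q c rule: less_induct)
  case less
  note S1 = string1 [OF W] and S2 = string2 [OF W]
  consider "p \<ge> 2" | "p \<le> 1" "q \<ge> 2" | "p = 1" "q = 1" | "p = 0" "q = 1" | "p = 1" "q = 0" | "p = 0" "q = 0"
  proof -
    note cases = that
    show thesis
    proof (cases "p \<ge> 2")
      case True
      then show thesis by (rule cases(1))
    next
      case False
      then have p: "p \<le> 1" "p = 0 \<or> p = 1" by auto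
      show thesis
      proof (cases "q \<ge> 2")
        case True
        with p(1) show thesis by (rule cases(2))
      next
        case False
        then have "q = 0 \<or> q = 1" by auto
        with p(2) consider "p = 0" "q = 0" | "p = 0" "q = 1" | "p = 1" "q = 0" | "p = 1" "q = 1" by blast
        then show thesis
        proof cases
          case 1 then show thesis by (rule cases(6))
        next
          case 2 then show thesis by (rule cases(4))
        next
          case 3 then show thesis by (rule cases(5))
        next
          case 4 then show thesis by (rule cases(3))
        qed
      qed
    qed
  qed
  then show ?case
  proof cases
    case 1
    have eq: "int p - 2 * 1 = int (p - 2)" "int q + 1 = int (q + 1)" using 1 by auto
    have "wt W (int p - 2 * 1) (int q + 1) (c - of_int 1 * \<sigma>1 E)"
      by (rule S1 [OF less.prems]) (use 1 in auto)
    then have "wt W (int (p - 2)) (int (q + 1)) (c - of_int 1 * \<sigma>1 E)" unfolding eq .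
    moreover have "3 * (p - 2) + 5 * (q + 1) < 3 * p + 5 * q" using 1 by arith
    ultimately show ?thesis using less.hyps by blast
  next
    case 2
    have eq: "int p + 3 * 1 = int (p + 3)" "int q - 2 * 1 = int (q - 2)" using 2 by auto
    have "wt W (int p + 3 * 1) (int q - 2 * 1) (c - of_int 1 * \<sigma>2 E)"
      by (rule S2 [OF less.prems]) (use 2 in auto)
    then have "wt W (int (p + 3)) (int (q - 2)) (c - of_int 1 * \<sigma>2 E)" unfolding eq .
    moreover have "3 * (p + 3) + 5 * (q - 2) < 3 * p + 5 * q" using 2 by arith
    ultimately show ?thesis using less.hyps by blast
  next
    \<comment> \<open>In the small cases the path leaves the dominant chamber for a while: (1, 1),
      (-1, 2), (2, 0); next (0, 1), (3, -1), (1, 0); and lastly (1, 0), (-1, 1), (2, -1), (0,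
      0).\<close>
    case 3
    have "wt W (- 1) 2 (c - \<sigma>1 E)" using S1 [OF less.prems, of 1] 3 by simp
    from S2 [OF this, of 1] have "wt W (int 2) (int 0) (c - \<sigma>1 E - \<sigma>2 E)" by simp
    moreover have "3 * 2 + 5 * 0 < 3 * p + 5 * q" using 3 by simp
    ultimately show ?thesis using less.hyps by blast
  next
    case 4
    have "wt W 3 (- 1) (c - \<sigma>2 E)" using S2 [OF less.prems, of 1] 4 by simp
    from S1 [OF this, of 1] have "wt W (int 1) (int 0) (c - \<sigma>2 E - \<sigma>1 E)" by simp
    moreover have "3 * 1 + 5 * 0 < 3 * p + 5 * q" using 4 by simp
    ultimately show ?thesis using less.hyps by blast
  next
    case 5
    have "wt W (- 1) 1 (c - \<sigma>1 E)" using S1 [OF less.prems, of 1] 5 by simp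
    from S2 [OF this, of 1] have "wt W 2 (- 1) (c - \<sigma>1 E - \<sigma>2 E)" by simp
    from S1 [OF this, of 1] show ?thesis by auto
  next
    case 6
    then show ?thesis using less.prems by auto
  qed
qed

lemma zero_weight_vector:
  assumes W: "submodule W" "W \<noteq> {0}"
  shows "\<exists>v\<in>W. v \<noteq> 0 \<and> \<rho> E *v v = 0 *s v"
proof -
  obtain v k p q where v: "v \<in> W" "v \<noteq> 0" "\<rho> E *v v = complex_of_real (m - real k) *s v"
    "\<rho> h1 *v v = of_nat p *s v" "\<rho> h2 *v v = of_nat q *s v"
    using highest_vector [OF W] by metis
  then have "wt W (int p) (int q) (complex_of_real (m - real k))"
    unfolding wt_def by auto
  then obtain c where c: "wt W 0 0 c" using zero_weight_of_dominant [OF W(1)] by blast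
  then have "c = 0" using wt_E by (force simp: ev_def)
  with c show ?thesis unfolding wt_def by blast
qed

text \<open>The orthogonal complement of W is a submodule because \<open>star\<close> preserves
  \<gg>. W and its complement would share the eigenline of \<open>E\<close> for 0, whose vectors
  would be orthogonal to themselves.\<close>

lemma irreducible:
  assumes W: "submodule W" "W \<noteq> {0}"
  shows "W = UNIV"
proof (rule ccontr)
  assume "W \<noteq> UNIV"
  define W' where "W' = {x. \<forall>y\<in>W. h x y = 0}"
  have Wsub: "vec.subspace W" using W(1) by (simp add: submodule_def)
  obtain x where "x \<noteq> 0" "\<And>y. y \<in> W \<Longrightarrow> h x y = 0"
    using hf.orthogonal_vector_exists [OF Wsub] \<open>W \<noteq> UNIV\<close> by auto
  then have "W' \<noteq> {0}" unfolding W'_def by blast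
  moreover have "submodule W'"
    unfolding submodule_def
  proof (intro conjI ballI)
    show "vec.subspace W'"
      unfolding W'_def vec.subspace_def using hf.ip_zero by (simp add: h_add h_scale)
    fix X v assume X: "X \<in> \<gg>" and v: "v \<in> W'"
    have "\<rho> (star X) *v y \<in> W" if "y \<in> W" for y
      using W(1) star_g [OF X] that by (simp add: submodule_def)
    then show "\<rho> X *v v \<in> W'" using v unfolding W'_def by (simp add: h_adjoint [OF X])
  qed
  ultimately obtain u where u: "u \<in> W'" "u \<noteq> 0" "\<rho> E *v u = 0 *s u" using zero_weight_vector by blast
  obtain v where v: "v \<in> W" "v \<noteq> 0" "\<rho> E *v v = 0 *s v" using zero_weight_vector [OF W] by blast
  obtain k where "u = k *s v" using eigenspace_line [OF v(2,3) u(3)] by blast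
  then have "u \<in> W" using v(1) Wsub by (simp add: vec.subspace_scale)
  then have "h u u = 0" using u(1) unfolding W'_def by blast
  then show False using h_pos [OF u(2)] by auto
qed

end

section \<open>The module generated by a highest weight vector\<close>

context principal_g2
begin

text \<open>Words in negative root vectors applied to v; their span plays the role of the module
  generated by v under the lower nilpotent subalgebra.\<close>

inductive_set descendants :: "complex^'n \<Rightarrow> (complex^'n) set" for v where
  base: "v \<in> descendants v"
| lower: "u \<in> descendants v \<Longrightarrow> \<alpha> \<in> positive_roots \<gg> \<tt> \<bb> \<Longrightarrow> X \<in> root_space \<gg> \<tt> (\<lambda>H. - \<alpha> H)
    \<Longrightarrow> \<rho> X *v u \<in> descendants v"

lemma descendants_weight:
  assumes "u \<in> descendants v"
    and v: "\<rho> h1 *v v = a *s v" "\<rho> h2 *v v = b *s v" "\<rho> E *v v = c *s v"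
  shows "\<exists>i j :: nat. \<rho> h1 *v u = (a - 2 * of_nat i + 3 * of_nat j) *s u
    \<and> \<rho> h2 *v u = (b + of_nat i - 2 * of_nat j) *s u
    \<and> \<rho> E *v u = (c - of_nat i * of_int n1 - of_nat j * of_int n2) *s u"
  using assms(1)
proof induction
  case base
  then show ?case using v by (intro exI [of _ 0]) simp
next
  case (lower u \<alpha> X)
  then obtain i j :: nat where ij: "\<rho> h1 *v u = (a - 2 * of_nat i + 3 * of_nat j) *s u"
    "\<rho> h2 *v u = (b + of_nat i - 2 * of_nat j) *s u"
    "\<rho> E *v u = (c - of_nat i * of_int n1 - of_nat j * of_int n2) *s u" by blast
  obtain k where "\<alpha> E = of_nat k" using positive_root_E [OF lower.hyps(2)] by blast
  then obtain r s :: nat where \<alpha>: "\<alpha> = (\<lambda>H. of_nat r * \<sigma>1 H + of_nat s * \<sigma>2 H)"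
    using positive_root_combination [OF lower.hyps(2)] by blast
  note shift = rho_root_vector_weight [OF lower.hyps(3)]
  show ?case
    using shift [OF h_t(1) ij(1)] shift [OF h_t(2) ij(2)] shift [OF E_t ij(3)]
    by (intro exI [of _ "i + r"] exI [of _ "j + s"])
      (simp add: \<alpha> coroot_values cartan_integers n12 algebra_simps)
qed

lemma lower_span:
  assumes \<alpha>: "\<alpha> \<in> positive_roots \<gg> \<tt> \<bb>" "X \<in> root_space \<gg> \<tt> (\<lambda>H. - \<alpha> H)"
    and u: "u \<in> vec.span (descendants v)"
  shows "\<rho> X *v u \<in> vec.span (descendants v)"
  using u
proof (induction rule: vec.span_induct)
  show "vec.subspace {u. \<rho> X *v u \<in> vec.span (descendants v)}"
    by (simp add: vec.subspace_def matrix_vector_right_distrib vector_scalar_commute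
        vec.span_zero vec.span_add vec.span_scale)
qed (use \<alpha> descendants.lower vec.span_base in blast)

text \<open>Induction on words: a new factor X is moved past the last letter at the cost of a
  bracket, which again lies in \<gg>. On v itself the root decomposition is used: \<tt> acts by
  scalars, positive roots kill v, negative ones lower it.\<close>

lemma descendants_submodule:
  assumes v: "v \<noteq> 0" "\<rho> E *v v = c *s v"
    and kill: "\<And>\<alpha> X. \<alpha> \<in> positive_roots \<gg> \<tt> \<bb> \<Longrightarrow> X \<in> root_space \<gg> \<tt> \<alpha> \<Longrightarrow> \<rho> X *v v = 0"
  shows "submodule (vec.span (descendants v))"
proof -
  let ?S = "vec.span (descendants v)"
  have vS: "v \<in> ?S" by (rule vec.span_base [OF descendants.base])
  have base: "\<rho> X *v v \<in> ?S" if "X \<in> \<gg>" for X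
  proof -
    have "X \<in> cmat.span (\<tt> \<union> (\<Union>\<alpha>\<in>roots \<gg> \<tt>. root_space \<gg> \<tt> \<alpha>))" using root_decomposition that by blast
    then show ?thesis
    proof (induction rule: cmat.span_induct)
      show "cmat.subspace {X. \<rho> X *v v \<in> ?S}"
        by (simp add: cmat.subspace_def rho_zero rho_add rho_cscale matrix_vector_mult_add_rdistrib
            cscale_vector vec.span_zero vec.span_add vec.span_scale)
    next
      fix X assume "X \<in> \<tt> \<union> (\<Union>\<alpha>\<in>roots \<gg> \<tt>. root_space \<gg> \<tt> \<alpha>)"
      then consider (t) "X \<in> \<tt>" | (r) \<alpha> where "\<alpha> \<in> roots \<gg> \<tt>" "X \<in> root_space \<gg> \<tt> \<alpha>" by blast
      then show "\<rho> X *v v \<in> ?S"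
      proof cases
        case t
        have "\<rho> E *v (\<rho> X *v v) = (c + 0) *s (\<rho> X *v v)"
          by (rule eigenvector_shift [OF t_in_g [OF t] _ v(2)]) (simp add: t_abelian [OF E_t t])
        then obtain k where "\<rho> X *v v = k *s v" using eigenspace_line [OF v] by auto
        then show ?thesis using vS by (simp add: vec.span_scale)
      next
        case r
        show ?thesis
        proof (cases "\<alpha> \<in> positive_roots \<gg> \<tt> \<bb>")
          case True
          then show ?thesis using kill r(2) by (simp add: vec.span_zero)
        next
          case False
          then have neg: "(\<lambda>H. - \<alpha> H) \<in> positive_roots \<gg> \<tt> \<bb>" using root_sign [OF r(1)] by blast
          show ?thesis by (rule lower_span [OF neg _ vS]) (use r(2) in simp)
        qed
      qed
    qed
  qed
  have words: "\<forall>X\<in>\<gg>. \<rho> X *v u \<in> ?S" if "u \<in> descendants v" for u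
    using that
  proof induction
    case base
    then show ?case using \<open>\<And>X. X \<in> \<gg> \<Longrightarrow> \<rho> X *v v \<in> ?S\<close> by blast
  next
    case (lower u \<alpha> Y)
    show ?case
    proof
      fix X assume X: "X \<in> \<gg>"
      note Y = root_spaceD(1) [OF lower.hyps(3)]
      have "\<rho> Y *v (\<rho> X *v u) \<in> ?S" using lower_span [OF lower.hyps(2,3)] lower.IH X by blast
      moreover have "\<rho> (bracket X Y) *v u \<in> ?S" using lower.IH g_bracket [OF X Y] by blast
      ultimately show "\<rho> X *v (\<rho> Y *v u) \<in> ?S"
        unfolding rho_commute [OF X Y] by (rule vec.span_add)
    qed
  qed
  have "\<rho> X *v u \<in> ?S" if X: "X \<in> \<gg>" and u: "u \<in> ?S" for X u
    using u
  proof (induction rule: vec.span_induct)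
    show "vec.subspace {u. \<rho> X *v u \<in> ?S}"
      by (simp add: vec.subspace_def matrix_vector_right_distrib vector_scalar_commute
          vec.span_zero vec.span_add vec.span_scale)
  qed (use words X in blast)
  then show ?thesis by (simp add: submodule_def vec.subspace_span)
qed

lemma wt_scaled:
  assumes "v \<in> W" "v \<noteq> 0" "\<rho> h1 *v v = complex_of_int a *s v" "\<rho> h2 *v v = complex_of_int b *s v"
    "\<rho> E *v v = c *s v"
  shows "wt W a b c"
  using assms unfolding wt_def by blast

text \<open>If 0 were the only eigenvalue of \<open>E\<close>, the root vector of \<sigma>1, which
  raises eigenvalues by n1 \<ge> 1, would act as 0, against faithfulness.\<close>

lemma nontrivial:
  assumes "m = 0" shows False
proof -
  have "\<rho> (root_vec \<sigma>1) = 0"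
  proof (rule matrix_zero)
    fix v c assume v: "v \<noteq> 0" "\<rho> E *v v = c *s v"
    obtain k where "c = complex_of_real (m - real k)" "real k \<le> 2 * m" using eigenvalue_form [OF v] by blast
    then have c: "c = 0" using assms by simp
    note e = root_vec [OF roots(1)]
    have Ee: "bracket E (root_vec \<sigma>1) = cscale (of_int n1) (root_vec \<sigma>1)"
      using root_spaceD(2) [OF e(1) E_t] n12 by simp
    show "\<rho> (root_vec \<sigma>1) *v v = 0"
    proof (rule ccontr)
      assume nz: "\<rho> (root_vec \<sigma>1) *v v \<noteq> 0"
      have "\<rho> E *v (\<rho> (root_vec \<sigma>1) *v v) = complex_of_real (of_int n1) *s (\<rho> (root_vec \<sigma>1) *v v)"
        using eigenvector_shift [OF e(3) Ee v(2)] c by simp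
      then have "real_of_int n1 \<le> m" by (rule eigenvalue_le [OF nz])
      then show False using n12(2) assms by simp
    qed
  qed
  then show False using rho_eq_0 root_vec roots(1) by blast
qed

lemma eigenvector_exists:
  assumes "real k \<le> 2 * m"
  obtains x where "x \<noteq> 0" "\<rho> E *v x = complex_of_real (m - real k) *s x"
proof -
  let ?V = "eigenspace (\<rho> E) (m - real k)"
  have "?V \<noteq> {0}"
  proof
    assume V: "?V = {0}"
    have "vec.dim ?V \<le> card ({} :: (complex^'n) set)"
      unfolding V by (rule vec.dim_le_card) (simp_all add: vec.span_zero)
    then show False unfolding m_dim [OF assms] by simp
  qed
  moreover have "0 \<in> ?V" by (simp add: eigenspace_def)
  ultimately obtain x where "x \<in> ?V" "x \<noteq> 0" by blast
  then show thesis using that by (simp add: eigenspace_def)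
qed

lemma standard_if_principal:
  "CARD('n) = 7 \<and> irreducible_rep \<gg> \<rho> \<and> has_highest_weight \<gg> \<tt> \<bb> \<rho> (\<lambda>H. 2 * \<sigma>1 H + \<sigma>2 H) \<and> E = T1 + T2"
proof -
  obtain v0 :: "complex^'n" where "v0 \<noteq> 0" using top_exists by blast
  then have "(UNIV :: (complex^'n) set) \<noteq> {0}" by blast
  then obtain v k0 and p q :: nat where v: "v \<noteq> 0" "\<rho> E *v v = complex_of_real (m - real k0) *s v"
    and vmax: "\<And>u c. u \<in> UNIV \<Longrightarrow> u \<noteq> 0 \<Longrightarrow> \<rho> E *v u = complex_of_real c *s u \<Longrightarrow> c \<le> m - real k0"
    and kill: "\<And>\<alpha> X. \<alpha> \<in> positive_roots \<gg> \<tt> \<bb> \<Longrightarrow> X \<in> root_space \<gg> \<tt> \<alpha> \<Longrightarrow> \<rho> X *v v = 0"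
    and pq: "\<rho> h1 *v v = of_nat p *s v" "\<rho> h2 *v v = of_nat q *s v"
    using highest_vector [OF submodule_UNIV] by metis
  \<comment> \<open>The highest vector of the whole space has the top eigenvalue m.\<close>
  have "m \<le> m - real k0" using top_exists vmax by blast
  then have Ev: "\<rho> E *v v = complex_of_real m *s v" using v(2) by simp
  have top: "wt UNIV (int p) (int q) (complex_of_real m)"
    using v(1) pq Ev by (intro wt_scaled) auto
  have "complex_of_real m = complex_of_real (of_int (ev (int p) (int q)))" using wt_E [OF top] by simp
  then have m: "m = of_int (ev (int p) (int q))" using of_real_eq_iff by blast
  \<comment> \<open>The weight \<lambda> - i \<sigma>1 - j \<sigma>2, written in fundamental
    coordinates.\<close>
  define Q where "Q i j \<longleftrightarrow> (\<exists>c. wt UNIV (int p - 2 * i + 3 * j) (int q + i - 2 * j) c)" for i j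
  have ev_Q: "ev (int p - 2 * i + 3 * j) (int q + i - 2 * j) = ev (int p) (int q) - (i * n1 + j * n2)" for i j
    by (simp add: ev_def algebra_simps)
  have span: "vec.span (descendants v) = UNIV"
  proof (rule irreducible [OF descendants_submodule [OF v(1) Ev kill]])
    show "vec.span (descendants v) \<noteq> {0}"
      using v(1) vec.span_base [OF descendants.base [of v]] by blast
  qed
  \<comment> \<open>Principality supplies an eigenvector for m - k. The descendants of v span the
    space and are zero or eigenvectors, so one of them has this eigenvalue; its depth below v gives
    i and j.\<close>
  have cov: "\<exists>i j :: nat. int i * n1 + int j * n2 = int k \<and> Q (int i) (int j)" if k: "real k \<le> 2 * m" for k
  proof -
    let ?L = "{l. \<exists>u\<in>descendants v. u \<noteq> 0 \<and> \<rho> E *v u = l *s u}"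
    have sub: "descendants v \<subseteq> vec.span {u. \<exists>l\<in>?L. \<rho> E *v u = l *s u}"
    proof
      fix u assume u: "u \<in> descendants v"
      obtain l where l: "\<rho> E *v u = l *s u" using descendants_weight [OF u pq Ev] by blast
      show "u \<in> vec.span {u. \<exists>l\<in>?L. \<rho> E *v u = l *s u}"
      proof (cases "u = 0")
        case True
        show ?thesis unfolding True by (rule vec.span_zero)
      next
        case False
        with u l have "l \<in> ?L" by (intro CollectI bexI [of _ u]) auto
        with l have "\<exists>l\<in>?L. \<rho> E *v u = l *s u" by (rule bexI)
        then show ?thesis by (intro vec.span_base CollectI)
      qed
    qed
    have L: "vec.span {u. \<exists>l\<in>?L. \<rho> E *v u = l *s u} = UNIV"
    proof -
      from vec.span_minimal [OF sub vec.subspace_span]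
      have "UNIV \<subseteq> vec.span {u. \<exists>l\<in>?L. \<rho> E *v u = l *s u}" unfolding span .
      then show ?thesis by (rule top.extremum_uniqueI)
    qed
    obtain x where x: "x \<noteq> 0" "\<rho> E *v x = complex_of_real (m - real k) *s x"
      by (rule eigenvector_exists [OF k])
    obtain u where u: "u \<in> descendants v" "u \<noteq> 0" "\<rho> E *v u = complex_of_real (m - real k) *s u"
      using eigenvalue_of_span [OF L x] by blast
    obtain i j :: nat where ij: "\<rho> h1 *v u = (of_nat p - 2 * of_nat i + 3 * of_nat j) *s u"
      "\<rho> h2 *v u = (of_nat q + of_nat i - 2 * of_nat j) *s u"
      "\<rho> E *v u = (complex_of_real m - of_nat i * of_int n1 - of_nat j * of_int n2) *s u"
      using descendants_weight [OF u(1) pq Ev] by blast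
    have "complex_of_real (m - real k) *s u = (complex_of_real m - of_nat i * of_int n1 - of_nat j * of_int n2) *s u"
      using u(3) ij(3) by (rule trans [OF sym])
    then have "complex_of_real (m - real k) = complex_of_real m - of_nat i * of_int n1 - of_nat j * of_int n2"
      using u(2) unfolding vec.scale_cancel_right by blast
    then have "complex_of_int (int i * n1 + int j * n2) = of_int (int k)" by (simp add: algebra_simps)
    then have "int i * n1 + int j * n2 = int k" using of_int_eq_iff by blast
    moreover have "wt UNIV (int p - 2 * int i + 3 * int j) (int q + int i - 2 * int j) (complex_of_real (m - real k))"
      by (rule wt_scaled [OF UNIV_I u(2) _ _ u(3)]) (simp_all add: ij(1,2))
    ultimately show ?thesis unfolding Q_def by blast
  qed
  have pq0: "int p \<noteq> 0 \<or> int q \<noteq> 0"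
  proof (rule ccontr)
    assume "\<not> ?thesis"
    then have "m = 0" unfolding m by (simp add: ev_def)
    then show False by (rule nontrivial)
  qed
  \<comment> \<open>Ensures that m - k is an eigenvalue for all k up to n1 + n2, the range over
    which \<open>weight_combinatorics\<close> asks for weights. It holds as m is at least
    \<omega>1(E) or \<omega>2(E).\<close>
  have m_large: "real_of_int (n1 + n2) \<le> 2 * m"
  proof -
    have "n1 + n2 \<le> ev (int p) (int q)"
    proof -
      define a b where "a = (2 * n1 + n2) * int p" and "b = (3 * n1 + 2 * n2) * int q"
      have "0 \<le> a" "0 \<le> b" using n12(2,4) by (auto simp: a_def b_def)
      moreover have "n1 + n2 \<le> a \<or> n1 + n2 \<le> b"
      proof (cases "p = 0")
        case False
        then have "2 * n1 + n2 \<le> a"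
          unfolding a_def using mult_left_mono [of 1 "int p" "2 * n1 + n2"] n12(2,4) by simp
        then show ?thesis using n12(2,4) by (intro disjI1) linarith
      next
        case True
        then have "3 * n1 + 2 * n2 \<le> b"
          unfolding b_def using mult_left_mono [of 1 "int q" "3 * n1 + 2 * n2"] n12(2,4) pq0 by simp
        then show ?thesis using n12(2,4) by (intro disjI2) linarith
      qed
      ultimately show ?thesis unfolding ev_def a_def [symmetric] b_def [symmetric] by auto
    qed
    then have "real_of_int (n1 + n2) \<le> m" unfolding m by (simp only: of_int_le_iff)
    moreover have "0 \<le> real_of_int (n1 + n2)" using n12(2,4) by simp
    ultimately show ?thesis by linarith
  qed
  have comb: "int p = 1 \<and> int q = 0 \<and> n1 = 1 \<and> n2 = 1"
  proof (rule weight_combinatorics [of Q])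
    show "Q 0 0" unfolding Q_def using top by auto
    show "Q (i + k) j" if "Q i j" "0 \<le> k" "k \<le> int p - 2 * i + 3 * j" for i j k
    proof -
      obtain c where "wt UNIV (int p - 2 * i + 3 * j) (int q + i - 2 * j) c" using \<open>Q i j\<close> unfolding Q_def by blast
      from string1 [OF submodule_UNIV this \<open>0 \<le> k\<close> \<open>k \<le> _\<close>] show ?thesis
        unfolding Q_def by (intro exI) (simp add: algebra_simps)
    qed
    show "Q i (j + k)" if "Q i j" "0 \<le> k" "k \<le> int q + i - 2 * j" for i j k
    proof -
      obtain c where "wt UNIV (int p - 2 * i + 3 * j) (int q + i - 2 * j) c" using \<open>Q i j\<close> unfolding Q_def by blast
      from string2 [OF submodule_UNIV this \<open>0 \<le> k\<close> \<open>k \<le> _\<close>] show ?thesis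
        unfolding Q_def by (intro exI) (simp add: algebra_simps)
    qed
    show "Q (i - k) j" if "Q i j" "0 \<le> k" "k \<le> - (int p - 2 * i + 3 * j)" for i j k
    proof -
      obtain c where "wt UNIV (int p - 2 * i + 3 * j) (int q + i - 2 * j) c" using \<open>Q i j\<close> unfolding Q_def by blast
      from string1_up [OF submodule_UNIV this \<open>0 \<le> k\<close> \<open>k \<le> _\<close>] show ?thesis
        unfolding Q_def by (intro exI) (simp add: algebra_simps)
    qed
    show "Q i (j - k)" if "Q i j" "0 \<le> k" "k \<le> - (int q + i - 2 * j)" for i j k
    proof -
      obtain c where "wt UNIV (int p - 2 * i + 3 * j) (int q + i - 2 * j) c" using \<open>Q i j\<close> unfolding Q_def by blast
      from string2_up [OF submodule_UNIV this \<open>0 \<le> k\<close> \<open>k \<le> _\<close>] show ?thesis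
        unfolding Q_def by (intro exI) (simp add: algebra_simps)
    qed
    show "0 \<le> i * n1 + j * n2" if "Q i j" for i j
    proof -
      obtain c where "wt UNIV (int p - 2 * i + 3 * j) (int q + i - 2 * j) c" using \<open>Q i j\<close> unfolding Q_def by blast
      from wt_le [OF this] have "real_of_int (ev (int p) (int q) - (i * n1 + j * n2)) \<le> of_int (ev (int p) (int q))"
        unfolding m ev_Q .
      then show ?thesis by (simp only: of_int_le_iff)
    qed
    show "i = i' \<and> j = j'" if Q: "Q i j" "Q i' j'" "i * n1 + j * n2 = i' * n1 + j' * n2" for i j i' j'
    proof -
      obtain c where c: "wt UNIV (int p - 2 * i + 3 * j) (int q + i - 2 * j) c" using Q(1) unfolding Q_def by blast
      obtain c' where c': "wt UNIV (int p - 2 * i' + 3 * j') (int q + i' - 2 * j') c'" using Q(2) unfolding Q_def by blast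
      have "ev (int p - 2 * i + 3 * j) (int q + i - 2 * j) = ev (int p - 2 * i' + 3 * j') (int q + i' - 2 * j')"
        unfolding ev_Q Q(3) ..
      from wt_unique [OF c c' this] show ?thesis by linarith
    qed
    show "\<exists>i j. 0 \<le> i \<and> 0 \<le> j \<and> i * n1 + j * n2 = k \<and> Q i j" if k: "0 \<le> k" "k \<le> n1 + n2" for k
    proof -
      have "real (nat k) \<le> 2 * m" using m_large k by linarith
      from cov [OF this] k(1) show ?thesis by (metis nat_0_le of_nat_0_le_iff)
    qed
  qed (use n12 pq0 in auto)
  \<comment> \<open>m is the value of \<omega>1 = 2 \<sigma>1 + \<sigma>2 at
    \<open>E\<close>.\<close>
  have m3: "m = 3" unfolding m using comb by (simp add: ev_def)
  have E: "E = T1 + T2"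
  proof -
    have T: "T1 + T2 \<in> \<tt>" using t_add dual_values by blast
    have diff: "\<alpha> (E - (T1 + T2)) = \<alpha> E - (\<alpha> T1 + \<alpha> T2)" if \<alpha>: "\<alpha> \<in> roots \<gg> \<tt>" for \<alpha>
      using root_add [OF \<alpha> t_diff [OF E_t T] T] root_add [OF \<alpha> dual_values(1,2)] by simp
    have "E - (T1 + T2) = 0"
      using comb by (intro t_eq_0 t_diff [OF E_t T])
        (simp_all add: diff [OF roots(1)] diff [OF roots(2)] dual_values n12)
    then show ?thesis by simp
  qed
  have hw: "has_highest_weight \<gg> \<tt> \<bb> \<rho> (\<lambda>H. 2 * \<sigma>1 H + \<sigma>2 H)"
    unfolding has_highest_weight_def
  proof (intro exI [of _ v] conjI ballI)
    fix H assume H: "H \<in> \<tt>"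
    show "\<rho> H *v v = (2 * \<sigma>1 H + \<sigma>2 H) *s v"
      using weight_values [OF pq H] comb by simp
  qed (use v kill in auto)
  have irr: "irreducible_rep \<gg> \<rho>"
    unfolding irreducible_rep_def using irreducible submodule_def by blast
  have "CARD('n) = 7"
  proof -
    \<comment> \<open>The seven eigenvalues 3, ..., -3; each eigenspace is a line and together they
      span.\<close>
    define C where "C = (\<lambda>k. complex_of_real (m - real k)) ` {..6}"
    have inj: "inj_on (\<lambda>k. complex_of_real (m - real k)) {..6}" by (auto simp: inj_on_def)
    have C: "finite C" "card C = 7" unfolding C_def using card_image [OF inj] by simp_all
    have "\<exists>x. x \<noteq> 0 \<and> \<rho> E *v x = c *s x" if c: "c \<in> C" for c
    proof -
      obtain k where k: "k \<le> 6" "c = complex_of_real (m - real k)" using c unfolding C_def by blast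
      then have "real k \<le> 2 * m" using m3 by simp
      from eigenvector_exists [OF this] show ?thesis unfolding k(2) by metis
    qed
    then obtain f where f: "\<And>c. c \<in> C \<Longrightarrow> f c \<noteq> 0 \<and> \<rho> E *v f c = c *s f c" by metis
    have lin: "vecf.linear_on UNIV ((*v) (\<rho> E))"
      by (simp add: vecf.linear_on_def matrix_vector_right_distrib vector_scalar_commute)
    have ind: "inj_on f C" "vec.independent (f ` C)"
      using vecf.independent_eigenvectors [OF vec.subspace_UNIV lin C(1), of f] f by auto
    have "vec.span {v. \<exists>l\<in>{l. \<exists>k :: int. l = complex_of_real (w + of_int k)}. \<rho> E *v v = l *s v}
        \<subseteq> vec.span (f ` C)"
    proof (rule vec.span_minimal [OF _ vec.subspace_span], rule subsetI)
      fix x assume "x \<in> {v. \<exists>l\<in>{l. \<exists>k :: int. l = complex_of_real (w + of_int k)}. \<rho> E *v v = l *s v}"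
      then obtain l where l: "\<rho> E *v x = l *s x" by blast
      show "x \<in> vec.span (f ` C)"
      proof (cases "x = 0")
        case False
        obtain k where k: "l = complex_of_real (m - real k)" "real k \<le> 2 * m"
          using eigenvalue_form [OF False l] by blast
        then have lC: "l \<in> C" unfolding C_def using m3 by auto
        then obtain a where "x = a *s f l" using eigenspace_line f l by metis
        then show ?thesis using lC by (auto intro: vec.span_scale vec.span_base)
      qed (simp add: vec.span_zero)
    qed
    then have "vec.span (f ` C) = UNIV" unfolding E_span by blast
    then have "vec.dim (UNIV :: (complex^'n) set) = card (f ` C)"
      using vec.dim_eq_card_independent [OF ind(2)] vec.dim_span [of "f ` C"] by simp
    then show ?thesis using card_image [OF ind(1)] C(2) by (simp add: vec.dim_UNIV card_cart_basis)
  qed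
  with irr hw E show ?thesis by blast
qed

end

section \<open>Hodge representations are self-adjoint\<close>

lemma bilin_add_left: "bilin B (u + v) w = bilin B u w + bilin B v w"
  by (simp add: bilin_def sum.distrib algebra_simps)

lemma bilin_add_right: "bilin B u (v + w) = bilin B u v + bilin B u w"
  by (simp add: bilin_def sum.distrib algebra_simps)

lemma bilin_scale_left: "bilin B (c *s u) w = c * bilin B u w"
  by (simp add: bilin_def sum_distrib_left algebra_simps)

lemma bilin_scale_right: "bilin B u (c *s w) = c * bilin B u w"
  by (simp add: bilin_def sum_distrib_left algebra_simps)

lemma bilin_minus_right: "bilin B u (- w) = - bilin B u w"
  by (simp add: bilin_def sum_negf)

lemma mat_deriv_vector:
  assumes "mat_deriv \<gamma> X"
  shows "((\<lambda>t. (\<gamma> t *v u) $ i) has_field_derivative (X *v u) $ i) (at 0)"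
  unfolding matrix_vector_mult_def vec_lambda_beta
  using assms by (intro DERIV_sum DERIV_cmult_right) (auto simp: mat_deriv_def)

lemma mat_deriv_bilin:
  assumes "mat_deriv \<gamma> X" "\<gamma> 0 = mat 1"
  shows "((\<lambda>t. bilin B (\<gamma> t *v u) (\<gamma> t *v v)) has_field_derivative
    bilin B (X *v u) v + bilin B u (X *v v)) (at 0)"
proof -
  have "((\<lambda>t. bilin B (\<gamma> t *v u) (\<gamma> t *v v)) has_field_derivative
    (\<Sum>i\<in>UNIV. \<Sum>j\<in>UNIV. ((X *v u) $ i * B $ i $ j) * (\<gamma> 0 *v v) $ j
      + (X *v v) $ j * ((\<gamma> 0 *v u) $ i * B $ i $ j))) (at 0)"
    unfolding bilin_def
    by (intro DERIV_sum DERIV_mult DERIV_cmult_right mat_deriv_vector [OF assms(1)])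
  then show ?thesis
    by (simp add: assms(2) bilin_def sum.distrib algebra_simps)
qed

text \<open>Derivative at the identity of the invariance of the form under \<open>G\<close>.\<close>

lemma form_skew:
  assumes hom: "mat_group_hom G \<pi>" and X: "X \<in> lie_algebra G"
    and preserves: "\<And>g u v. g \<in> G \<Longrightarrow> bilin B (\<pi> g *v u) (\<pi> g *v v) = bilin B u v"
  shows "bilin B (differential \<pi> X *v u) v = - bilin B u (differential \<pi> X *v v)"
proof -
  interpret mat_group_hom G \<pi> by fact
  let ?F = "\<lambda>g. bilin B (\<pi> g *v u) (\<pi> g *v v) - bilin B u v"
  have entry: "regular_fun UNIV (\<lambda>g. (\<pi> g *v u) $ i)" for u i
    unfolding matrix_vector_mult_def vec_lambda_beta
    by (intro regular_fun_sum regular_fun.mult regular regular_fun.const UNIV_I)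
  have reg: "regular_fun UNIV ?F"
    unfolding bilin_def
    by (intro regular_fun_diff regular_fun_sum regular_fun.mult entry regular_fun.const UNIV_I)
  have 0: "dir_deriv ?F X = 0"
    by (rule lie_algebra_dir_deriv [OF X reg]) (simp add: preserves)
  have "mat_deriv (\<lambda>t. \<pi> (mat 1 + cscale t X)) (differential \<pi> X)"
    by (rule mat_deriv_regular_fun [OF regular _ mat_deriv_line]) simp
  from mat_deriv_bilin [OF this]
  have "((\<lambda>t. ?F (mat 1 + cscale t X)) has_field_derivative
      bilin B (differential \<pi> X *v u) v + bilin B u (differential \<pi> X *v v) - 0) (at 0)"
    by (intro DERIV_diff DERIV_const) (simp add: pi_one)
  then have "bilin B (differential \<pi> X *v u) v + bilin B u (differential \<pi> X *v v) = 0"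
    using DERIV_unique [OF dir_deriv_line [OF reg]] 0 by fastforce
  then show ?thesis by (simp add: eq_neg_iff_add_eq_0)
qed

text \<open>Polarization: reality of h on u + v compares the imaginary parts of h u v and h v u,
  reality on u + i v their real parts.\<close>

lemma positive_form_hermitian:
  fixes h :: "complex^'n \<Rightarrow> complex^'n \<Rightarrow> complex"
  assumes add: "\<And>u v w. h (u + v) w = h u w + h v w" "\<And>u v w. h u (v + w) = h u v + h u w"
    and scale: "\<And>c u w. h (c *s u) w = c * h u w" "\<And>c u w. h u (c *s w) = cnj c * h u w"
    and real: "\<And>v. Im (h v v) = 0"
  shows "h v u = cnj (h u v)"
proof -
  have "Im (h u v + h v u) = 0"
    using real [of "u + v"] real [of u] real [of v] by (simp add: add)
  moreover have "Im (h u (\<i> *s v) + h (\<i> *s v) u) = 0"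
    using real [of "u + \<i> *s v"] real [of u] real [of "\<i> *s v"] by (simp only: add) simp
  ultimately show ?thesis by (simp add: scale complex_eq_iff)
qed

text \<open>The maximum in \<open>lie_rank\<close> is taken over a finite set, since all dimensions
  are bounded by that of the matrix space.\<close>

lemma dim_toral_le_rank:
  assumes "toral_subalgebra \<gg> \<aa>"
  shows "cmat.dim \<aa> \<le> lie_rank \<gg>"
proof -
  have "{cmat.dim \<hh> | \<hh>. toral_subalgebra \<gg> \<hh>} \<subseteq> {..cmat.dim (UNIV :: (complex^'a^'a) set)}"
    using cmatf.dim_subset_UNIV by (auto simp: cmatf.dimension_def)
  then have "finite {cmat.dim \<hh> | \<hh>. toral_subalgebra \<gg> \<hh>}" using finite_subset by blast
  then show ?thesis unfolding lie_rank_def using assms by (intro Max_ge) auto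
qed

lemma lie_isomorphic_g2_centreless:
  assumes iso: "lie_isomorphic \<gg> g2" and g: "cmat.subspace \<gg>"
    and Z: "Z \<in> \<gg>" "\<And>Y. Y \<in> \<gg> \<Longrightarrow> bracket Z Y = 0"
  shows "Z = 0"
proof -
  obtain f where f: "bij_betw f \<gg> g2" "\<And>X Y. X \<in> \<gg> \<Longrightarrow> Y \<in> \<gg> \<Longrightarrow> f (X + Y) = f X + f Y"
    "\<And>X Y. X \<in> \<gg> \<Longrightarrow> Y \<in> \<gg> \<Longrightarrow> f (bracket X Y) = bracket (f X) (f Y)"
    using iso unfolding lie_isomorphic_def by blast
  have 0: "0 \<in> \<gg>" using g by (rule cmat.subspace_0)
  have f0: "f 0 = 0" using f(2) [OF 0 0] by simp
  have "f Z = 0"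
  proof (rule g2_centre)
    show "f Z \<in> g2" using f(1) Z(1) by (auto simp: bij_betw_def)
    fix A assume "A \<in> g2"
    then obtain Y where Y: "Y \<in> \<gg>" "A = f Y" using f(1) by (auto simp: bij_betw_def)
    then show "bracket (f Z) A = 0" using f(3) [OF Z(1) Y(1)] Z(2) [OF Y(1)] f0 by simp
  qed
  then show ?thesis using f(1) f0 Z(1) 0 by (metis bij_betw_def inj_onD)
qed

lemma cis_powi: "cis t powi n = exp (\<i> * complex_of_real t * of_int n)"
proof -
  have "cis t powi n = exp (\<i> * complex_of_real t) powi n" by (simp add: cis_conv_exp)
  also have "\<dots> = exp (of_int n * (\<i> * complex_of_real t))" by (rule exp_power_int)
  finally show ?thesis by (simp add: algebra_simps)
qed

lemma circle_action_of_hom: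
  assumes "circle_hom H \<psi>" and inv: "\<And>g. g \<in> H \<Longrightarrow> invertible g"
  shows "circle_action \<psi>"
proof
  show "\<exists>p. polynomial_function p \<and> (\<forall>z\<in>sphere 0 1. \<psi> z = p z)"
    and mult: "\<And>z w. z \<in> sphere 0 1 \<Longrightarrow> w \<in> sphere 0 1 \<Longrightarrow> \<psi> (z * w) = \<psi> z ** \<psi> w"
    using assms(1) unfolding circle_hom_def by blast+
  have "\<psi> 1 \<in> H" using assms(1) unfolding circle_hom_def real_points_def by force
  then have i: "invertible (\<psi> 1)" by (rule inv)
  have "\<psi> 1 ** \<psi> 1 = \<psi> 1" using mult [of 1 1] by simp
  then have "matrix_inv (\<psi> 1) ** \<psi> 1 ** \<psi> 1 = matrix_inv (\<psi> 1) ** \<psi> 1"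
    by (simp add: matrix_mul_assoc [symmetric])
  then show "\<psi> 1 = mat 1" by (simp add: matrix_inv_cancel(2) [OF i])
qed

text \<open>A regular function vanishing on T vanishes at the real parameters of the extended curve,
  so its complex derivative at 0 is 0. The factor i (p - q) is the derivative of the character
  z^(p-q) along z = e^(it) at t = 0.\<close>

lemma circle_tangent:
  assumes "circle_action \<phi>" and T: "\<And>z. z \<in> sphere 0 1 \<Longrightarrow> \<phi> z \<in> T"
    and reg: "\<And>i j. regular_fun UNIV (\<lambda>g. \<pi> g $ i $ j)"
  obtains X where "X \<in> lie_algebra T"
    "\<And>v p q. v \<in> hodge_space (\<pi> \<circ> \<phi>) p q \<Longrightarrow> differential \<pi> X *v v = (\<i> * of_int (p - q)) *s v"
proof -
  interpret circle_action \<phi> by fact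
  obtain \<gamma> X where \<gamma>: "\<gamma> 0 = mat 1" "mat_deriv \<gamma> X" "\<And>t. \<gamma> (complex_of_real t) = \<phi> (cis t)"
    using circle_curve by metis
  show thesis
  proof (rule that [of X])
    show "X \<in> lie_algebra T"
      unfolding lie_algebra_iff
    proof (intro allI impI, elim conjE)
      fix f assume f: "regular_fun UNIV f" "\<forall>g\<in>T. f g = 0"
      show "dir_deriv f X = 0"
        by (rule deriv_zero_on_reals [OF dir_deriv_curve [OF f(1) \<gamma>(1,2)]]) (use f(2) T in \<open>simp add: \<gamma>(3)\<close>)
    qed
    fix v p q assume v: "v \<in> hodge_space (\<pi> \<circ> \<phi>) p q"
    have "mat_deriv (\<lambda>t. \<pi> (\<gamma> t)) (differential \<pi> X)"
      by (rule mat_deriv_regular_fun [OF reg \<gamma>(1,2)])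
    note d = mat_deriv_vector [OF this]
    show "differential \<pi> X *v v = (\<i> * of_int (p - q)) *s v"
      unfolding vec_eq_iff
    proof
      fix i
      let ?F = "\<lambda>t. (\<pi> (\<gamma> t) *v v) $ i - exp (\<i> * t * of_int (p - q)) * v $ i"
      have "(?F has_field_derivative (differential \<pi> X *v v) $ i - \<i> * of_int (p - q) * v $ i) (at 0)"
        by (auto intro!: derivative_eq_intros d)
      moreover have "?F (complex_of_real t) = 0" for t
      proof -
        have "\<pi> (\<phi> (cis t)) *v v = (cis t powi (p - q)) *s v" using v by (simp add: hodge_space_def)
        then show ?thesis by (simp add: \<gamma>(3) cis_powi)
      qed
      ultimately have "(differential \<pi> X *v v) $ i - \<i> * of_int (p - q) * v $ i = 0"
        by (rule deriv_zero_on_reals)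
      then show "(differential \<pi> X *v v) $ i = ((\<i> * of_int (p - q)) *s v) $ i" by simp
    qed
  qed
qed

text \<open>A weight k of the circle is p - q. The value at -1 forces k to have the parity of w, so
  p = (w + k)/2 is an integer.\<close>

lemma hodge_decomposition:
  assumes "circle_action \<psi>" and parity: "\<psi> (- 1) = mat ((- 1) powi w)"
  shows "vec.span (\<Union>(p, q)\<in>{(p, q). p + q = w}. hodge_space \<psi> p q) = UNIV" (is "vec.span ?U = UNIV")
proof -
  interpret circle_action \<psi> by fact
  have mem: "v \<in> vec.span ?U" if v: "v \<in> weight_space k" for v k
  proof (cases "v = 0")
    case True
    then show ?thesis by (simp add: vec.span_zero)
  next
    case False
    have "\<psi> (- 1) *v v = ((- 1) powi k) *s v"
      using v by (simp add: weight_space_def)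
    then have "((- 1) powi w) *s v = ((- 1) powi k) *s v"
      by (simp add: parity mat_vector_mult)
    then have "((- 1) powi w :: complex) = (- 1) powi k"
      using False unfolding vec.scale_cancel_right by blast
    then have "even w \<longleftrightarrow> even k" by (simp add: power_int_minus_left split: if_splits)
    then have "even (w + k)" by simp
    then obtain p where "w + k = 2 * p" by (rule evenE)
    then have "p + (w - p) = w" "p - (w - p) = k" by simp_all
    then have "v \<in> hodge_space \<psi> p (w - p)" using v by (simp add: hodge_space_def weight_space_def)
    then have "v \<in> ?U" by force
    then show ?thesis by (rule vec.span_base)
  qed
  have "v \<in> vec.span ?U" for v
  proof -
    obtain K P where "\<And>k. P k \<in> weight_space k" "v = (\<Sum>k\<in>K. P k)"
      using weight_decomposition [of v] by metis
    then show ?thesis using mem by (auto intro: vec.span_sum)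
  qed
  then show ?thesis by blast
qed

theorem theorem5p2:
  fixes G T \<bb> :: "(complex^'N^'N) set"
    and w :: int
    and Q :: "rat^'n^'n"
    and \<pi> :: "complex^'N^'N \<Rightarrow> complex^'n^'n"
    and \<phi> :: "complex \<Rightarrow> complex^'N^'N"
    and T\<^sub>\<phi> T1 T2 :: "complex^'N^'N"
    and \<sigma>1 \<sigma>2 :: "complex^'N^'N \<Rightarrow> complex"
  defines "\<gg> \<equiv> lie_algebra G" and "\<tt> \<equiv> lie_algebra T"
  assumes "hodge_representation G w Q \<pi> \<phi>"
    and "lie_isomorphic \<gg> g2"
    and "grading_element G w \<pi> \<phi> T\<^sub>\<phi>"
    and "full_rank_compact_torus G T" and "\<phi> ` sphere 0 1 \<subseteq> T"
    and "borel_subalgebra \<gg> \<bb>" and "\<tt> \<subseteq> \<bb>" and "\<bb> \<subseteq> nonneg_part \<gg> T\<^sub>\<phi>"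
    and "g2_simple_roots \<gg> \<tt> \<bb> \<sigma>1 \<sigma>2"
    and "dual_basis \<tt> \<sigma>1 \<sigma>2 T1 T2"
    and "\<sigma>1 T\<^sub>\<phi> \<in> \<real>\<^sub>\<ge>\<^sub>0" and "\<sigma>2 T\<^sub>\<phi> \<in> \<real>\<^sub>\<ge>\<^sub>0"
  shows "principal_hodge_rep \<pi> T\<^sub>\<phi> \<longleftrightarrow>
    is_standard_rep \<gg> \<tt> \<bb> \<sigma>1 \<sigma>2 (differential \<pi>) \<and> T\<^sub>\<phi> = T1 + T2"
proof -
  have rat: "rational_algebraic_group G" and hom: "rational_hom G (Aut_form Q) \<pi>"
    and inj: "inj_on (differential \<pi>) (lie_algebra G)" and phi: "circle_hom G \<phi>"
    and pol: "polarized_hodge_structure w Q (\<pi> \<circ> \<phi>)"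
    using assms(3) by (auto simp: hodge_representation_def)
  have regQ: "\<And>i j. regular_fun \<rat> (\<lambda>g. \<pi> g $ i $ j)"
    and aut: "\<And>g. g \<in> G \<Longrightarrow> \<pi> g \<in> Aut_form Q"
    and mult: "\<And>g h. g \<in> G \<Longrightarrow> h \<in> G \<Longrightarrow> \<pi> (g ** h) = \<pi> g ** \<pi> h"
    using hom by (auto simp: rational_hom_def)
  note reg = regular_fun_UNIV_mono [OF regQ]
  interpret G: mat_group_hom G \<pi>
    by unfold_locales (use rat reg mult aut in \<open>auto simp: rational_algebraic_group_def Aut_form_def\<close>)
  have T: "matrix_group T" and T_comm: "\<And>s t. s \<in> T \<Longrightarrow> t \<in> T \<Longrightarrow> s ** t = t ** s"
    and T_real: "T \<subseteq> real_points G" and T_dim: "cmat.dim \<tt> = lie_rank \<gg>"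
    using assms(6) by (auto simp: full_rank_compact_torus_def compact_torus_def \<gg>_def \<tt>_def)
  interpret T: mat_group T by unfold_locales (rule T)
  have TG: "T \<subseteq> G" using T_real by (auto simp: real_points_def)
  have T_mcnj: "mcnj g = g" if "g \<in> T" for g
    using T_real that mcnj_real [of g] by (auto simp: real_points_def)
  have phiT: "\<phi> z \<in> T" if "z \<in> sphere 0 1" for z using assms(7) that by blast
  have act_phi: "circle_action \<phi>" by (rule circle_action_of_hom [OF phi G.invertible])
  interpret phi: circle_action \<phi> by (rule act_phi)
  have act_psi: "circle_action (\<pi> \<circ> \<phi>)"
    by (rule circle_action_of_hom [of "Aut_form Q"])
      (use pol in \<open>auto simp: polarized_hodge_structure_def Aut_form_def\<close>)

  define \<rho> where "\<rho> = differential \<pi>"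
  define M where "M = (map_matrix of_rat Q :: complex^'n^'n)"
  \<comment> \<open>\<open>C\<close> is the Weil operator. Its inverse is the image of \<phi>(-i),
    so \<open>star\<close> is, up to sign, conjugation by an element of \<open>G\<close> followed by
    complex conjugation, and both preserve \<gg>.\<close>
  define C where "C = \<pi> (\<phi> \<i>)"
  define d where "d = \<phi> (- \<i>)"
  define star where "star X = - mcnj (d ** X ** matrix_inv d)" for X
  define h where "h u v = bilin M u (C *v vcnj v)" for u v

  have form: "bilin M (\<pi> g *v u) (\<pi> g *v v) = bilin M u v" if "g \<in> G" for g u v
    using aut [OF that] by (simp add: Aut_form_def M_def)
  have skew: "bilin M (\<rho> X *v u) v = - bilin M u (\<rho> X *v v)" if "X \<in> \<gg>" for X u v
    unfolding \<rho>_def by (rule form_skew [OF G.mat_group_hom_axioms that [unfolded \<gg>_def] form])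
  have dT: "d \<in> T" "d \<in> G" and iT: "\<phi> \<i> \<in> T" "\<phi> \<i> \<in> G"
    using phiT TG by (auto simp: d_def)
  have "d ** \<phi> \<i> = mat 1" "\<phi> \<i> ** d = mat 1"
    unfolding d_def using phi.mult [of "- \<i>" \<i>] phi.mult [of \<i> "- \<i>"] phi.psi_one by simp_all
  then have dC: "\<pi> d ** C = mat 1" "C ** \<pi> d = mat 1"
    unfolding C_def using mult dT(2) iT(2) G.pi_one by metis+

  have g_sub: "cmat.subspace \<gg>" and t_sub: "cmat.subspace \<tt>"
    unfolding \<gg>_def \<tt>_def by (rule lie_algebra_subspace)+
  have tg: "\<tt> \<subseteq> \<gg>" unfolding \<gg>_def \<tt>_def by (rule lie_algebra_mono [OF TG])
  have star_g: "star X \<in> \<gg>" if "X \<in> \<gg>" for X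
    unfolding star_def using lie_algebra_mcnj [OF rational_algebraic_group_mcnj [OF rat]]
      G.Ad_closed [OF dT(2)] that cmat.subspace_neg [OF g_sub] unfolding \<gg>_def by blast
  \<comment> \<open>\<open>d\<close> lies in the abelian T and commutes with its Lie algebra, and T
    consists of real matrices.\<close>
  have star_torus: "star X = - mcnj X" "star X \<in> \<tt>" if X: "X \<in> \<tt>" for X
  proof -
    have "d ** X ** matrix_inv d = X ** (d ** matrix_inv d)"
      using T.abelian_lie_algebra(1) [OF T_comm, of X d] X dT(1) by (simp add: \<tt>_def matrix_mul_assoc)
    also have "\<dots> = X" by (simp add: matrix_inv_cancel(1) [OF T.invertible [OF dT(1)]])
    finally show 1: "star X = - mcnj X" by (simp add: star_def)
    have "mcnj X \<in> \<tt>"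
      using lie_algebra_mcnj [of T X] T_mcnj X by (simp add: \<tt>_def)
    then show "star X \<in> \<tt>" unfolding 1 by (rule cmat.subspace_neg [OF t_sub])
  qed
  \<comment> \<open>Invariance of the form moves X to the second argument with a sign; there the
    conjugation by \<open>d\<close> in \<open>star\<close> cancels against \<open>C\<close>, and
    \<open>mcnj\<close> against \<open>vcnj\<close>.\<close>
  have adjoint: "h (\<rho> X *v u) v = h u (\<rho> (star X) *v v)" if X: "X \<in> \<gg>" for X u v
  proof -
    let ?Z = "d ** X ** matrix_inv d"
    have "\<rho> ?Z = \<rho> ?Z ** \<pi> d ** C"
      by (simp add: matrix_mul_assoc [symmetric] dC(1))
    also have "\<rho> ?Z ** \<pi> d = \<pi> d ** \<rho> X"
      unfolding \<rho>_def using G.differential_Ad [OF dT(2)] X by (simp add: \<gg>_def)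
    finally have Z: "\<rho> ?Z = \<pi> d ** \<rho> X ** C" .
    have "\<rho> (star X) = - mcnj (\<rho> ?Z)"
      using G.differential_cscale [of "- 1" "mcnj ?Z"] differential_mcnj [OF regQ, of ?Z]
      by (simp add: star_def \<rho>_def)
    then have "vcnj (\<rho> (star X) *v v) = - (\<rho> ?Z *v vcnj v)"
      by (simp add: vcnj_mult mcnj_minus vec_eq_iff matrix_vector_mult_def sum_negf)
    then have "C *v vcnj (\<rho> (star X) *v v) = - (C *v (\<rho> ?Z *v vcnj v))"
      by (simp add: vec_eq_iff matrix_vector_mult_def sum_negf)
    also have "C *v (\<rho> ?Z *v vcnj v) = \<rho> X *v (C *v vcnj v)"
      unfolding Z by (simp add: matrix_vector_mul_assoc matrix_mul_assoc dC(2))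
    finally show ?thesis by (simp add: h_def skew [OF X] bilin_minus_right)
  qed
  have h_pos: "\<exists>r>0. h v v = complex_of_real r" if "v \<noteq> 0" for v
    using pol that by (simp add: polarized_hodge_structure_def h_def M_def C_def vcnj_def)
  have h_lin: "h (u + v) u' = h u u' + h v u'" "h u (v + u') = h u v + h u u'"
    "h (c *s u) u' = c * h u u'" "h u (c *s u') = cnj c * h u u'" for u v u' c
    by (simp_all add: h_def bilin_add_left bilin_add_right bilin_scale_left bilin_scale_right vcnj_add
        vcnj_scale matrix_vector_right_distrib vector_scalar_commute)
  have h_sym: "h v u = cnj (h u v)" for u v
  proof (rule positive_form_hermitian [of h])
    show "Im (h v v) = 0" for v
    proof (cases "v = 0")
      case True
      then show ?thesis using h_lin(3) [of 0 0 0] by simp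
    next
      case False
      from h_pos [OF this] show ?thesis by auto
    qed
  qed (simp_all add: h_lin)
  \<comment> \<open>\<tt> already has the largest dimension possible for a toral subalgebra.\<close>
  have maximal: "\<aa> = \<tt>" if "toral_subalgebra \<gg> \<aa>" "\<tt> \<subseteq> \<aa>" for \<aa>
  proof -
    have "cmat.subspace \<aa>" using that(1) by (simp add: toral_subalgebra_def lie_subalgebra_def)
    then show ?thesis
      using cmatf.subspace_dim_equal [OF t_sub _ that(2)] dim_toral_le_rank [OF that(1)] T_dim by simp
  qed

  interpret selfadjoint_rep \<gg> \<tt> \<rho> star h
  proof
    show "bracket X Y \<in> \<gg>" if "X \<in> \<gg>" "Y \<in> \<gg>" for X Y
      using that G.bracket_closed by (simp add: \<gg>_def)
    show "bracket X Y = 0" if "X \<in> \<tt>" "Y \<in> \<tt>" for X Y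
      using that T.abelian_lie_algebra(2) [OF T_comm] by (simp add: \<tt>_def)
    show "\<rho> (X + Y) = \<rho> X + \<rho> Y" "\<rho> (cscale c X) = cscale c (\<rho> X)" for X Y c
      by (simp_all add: \<rho>_def G.differential_add G.differential_cscale)
    show "\<rho> (bracket X Y) = bracket (\<rho> X) (\<rho> Y)" if "X \<in> \<gg>" "Y \<in> \<gg>" for X Y
      using that G.differential_bracket by (simp add: \<rho>_def \<gg>_def)
    show "inj_on \<rho> \<gg>" using inj by (simp add: \<rho>_def \<gg>_def)
    show "Z = 0" if "Z \<in> \<gg>" "\<And>Y. Y \<in> \<gg> \<Longrightarrow> bracket Z Y = 0" for Z
      by (rule lie_isomorphic_g2_centreless [OF assms(4) g_sub that])
  qed (fact g_sub t_sub tg star_g star_torus(2) h_lin h_sym h_pos adjoint maximal)+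

  obtain R where R: "R \<in> real_points \<gg>" "T\<^sub>\<phi> = cscale \<i> R"
    and grading: "\<And>p q v. p + q = w \<Longrightarrow> v \<in> hodge_space (\<pi> \<circ> \<phi>) p q \<Longrightarrow>
      \<rho> T\<^sub>\<phi> *v v = (of_int (p - q) / 2) *s v"
    using assms(5) by (auto simp: grading_element_def \<rho>_def \<gg>_def)
  have Rg: "R \<in> \<gg>" and R_real: "mcnj R = R" using R(1) mcnj_real [of R] by (auto simp: real_points_def)
  have Eg: "T\<^sub>\<phi> \<in> \<gg>" unfolding R(2) by (rule g_cscale [OF Rg])
  have E_mcnj: "mcnj T\<^sub>\<phi> = - T\<^sub>\<phi>" by (simp add: R(2) mcnj_cscale R_real)
  have hodge: "vec.span (\<Union>(p, q)\<in>{(p, q). p + q = w}. hodge_space (\<pi> \<circ> \<phi>) p q) = UNIV"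
    by (rule hodge_decomposition [OF act_psi]) (use pol in \<open>simp add: polarized_hodge_structure_def\<close>)

  \<comment> \<open>The tangent vector X of \<phi> lies in \<tt> and acts on the (p, q)-part by i (p
    - q). So X / (2 i) acts like the grading element, and injectivity of the differential identifies
    the two.\<close>
  have Et: "T\<^sub>\<phi> \<in> \<tt>"
  proof -
    obtain X where X: "X \<in> lie_algebra T"
      "\<And>v p q. v \<in> hodge_space (\<pi> \<circ> \<phi>) p q \<Longrightarrow> differential \<pi> X *v v = (\<i> * of_int (p - q)) *s v"
      using circle_tangent [OF act_phi phiT reg] by metis
    let ?E = "cscale (1 / (2 * \<i>)) X"
    have Xt: "X \<in> \<tt>" using X(1) by (simp add: \<tt>_def)
    have "vec.span (\<Union>(p, q)\<in>{(p, q). p + q = w}. hodge_space (\<pi> \<circ> \<phi>) p q)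
        \<subseteq> {v. \<rho> ?E *v v = \<rho> T\<^sub>\<phi> *v v}"
    proof (rule vec.span_minimal)
      show "(\<Union>(p, q)\<in>{(p, q). p + q = w}. hodge_space (\<pi> \<circ> \<phi>) p q) \<subseteq> {v. \<rho> ?E *v v = \<rho> T\<^sub>\<phi> *v v}"
      proof clarify
        fix p q v assume v: "v \<in> hodge_space (\<pi> \<circ> \<phi>) p q" and w: "w = p + q"
        have "\<rho> ?E *v v = (1 / (2 * \<i>)) *s (\<rho> X *v v)" by (simp only: rho_cscale cscale_vector)
        also have "\<rho> X *v v = (\<i> * of_int (p - q)) *s v" using X(2) [OF v] by (simp add: \<rho>_def)
        also have "(1 / (2 * \<i>)) *s ((\<i> * of_int (p - q)) *s v) = (of_int (p - q) / 2) *s v"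
          unfolding vec.scale_scale by (rule arg_cong [of _ _ "\<lambda>c. c *s v"]) (simp add: field_simps)
        finally show "\<rho> ?E *v v = \<rho> T\<^sub>\<phi> *v v" using grading [OF w [symmetric] v] by simp
      qed
      show "vec.subspace {v. \<rho> ?E *v v = \<rho> T\<^sub>\<phi> *v v}"
        by (simp add: vec.subspace_def matrix_vector_right_distrib vector_scalar_commute)
    qed
    then have "\<rho> ?E *v v = \<rho> T\<^sub>\<phi> *v v" for v unfolding hodge by blast
    then have "\<rho> ?E = \<rho> T\<^sub>\<phi>" by (simp add: matrix_eq)
    then have "?E = T\<^sub>\<phi>" using inj_onD [OF rho_inj] Eg t_in_g [OF t_cscale [OF Xt]] by blast
    then show ?thesis using t_cscale [OF Xt] by metis
  qed

  interpret g2_hodge \<gg> \<tt> \<rho> star h \<bb> \<sigma>1 \<sigma>2 T1 T2 T\<^sub>\<phi> "- of_int w / 2"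
  proof
    let ?S = "{v. \<exists>l\<in>{l. \<exists>k :: int. l = complex_of_real (- of_int w / 2 + of_int k)}. \<rho> T\<^sub>\<phi> *v v = l *s v}"
    have "(\<Union>(p, q)\<in>{(p, q). p + q = w}. hodge_space (\<pi> \<circ> \<phi>) p q) \<subseteq> ?S"
    proof clarify
      fix p q v assume v: "v \<in> hodge_space (\<pi> \<circ> \<phi>) p q" and w: "w = p + q"
      have "of_int (p - q) / 2 = complex_of_real (- of_int w / 2 + of_int p)"
        unfolding w by (simp add: field_simps)
      then show "\<exists>l\<in>{l. \<exists>k :: int. l = complex_of_real (- of_int (p + q) / 2 + of_int k)}. \<rho> T\<^sub>\<phi> *v v = l *s v"
        using grading [OF w [symmetric] v] unfolding w by blast
    qed
    from vec.span_mono [OF this] show "vec.span ?S = UNIV" unfolding hodge by blast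
    \<comment> \<open>The grading element is i times a real matrix, so conjugating an eigenvector
      with real eigenvalue negates that eigenvalue.\<close>
    show "\<exists>u. u \<noteq> 0 \<and> \<rho> T\<^sub>\<phi> *v u = complex_of_real (- l) *s u"
      if v: "\<rho> T\<^sub>\<phi> *v v = complex_of_real l *s v" "v \<noteq> 0" for v l
    proof (intro exI [of _ "vcnj v"] conjI)
      have "\<rho> (- T\<^sub>\<phi>) *v vcnj v = vcnj (\<rho> T\<^sub>\<phi> *v v)"
        using differential_mcnj [OF regQ, of "T\<^sub>\<phi>"] by (simp add: \<rho>_def vcnj_mult E_mcnj)
      also have "\<dots> = complex_of_real l *s vcnj v" by (simp add: v(1) vcnj_scale)
      finally show "\<rho> T\<^sub>\<phi> *v vcnj v = complex_of_real (- l) *s vcnj v"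
        by (simp add: rho_minus matrix_vector_mult_minus) (metis minus_minus vec.scale_minus_left)
    qed (use v in simp)
  qed (use assms Et in \<open>auto simp: g2_simple_roots_def\<close>)

  show ?thesis
  proof
    assume "principal_hodge_rep \<pi> T\<^sub>\<phi>"
    then obtain m where m: "eigenspace (\<rho> T\<^sub>\<phi>) m \<noteq> {0}" "\<And>l. eigenspace (\<rho> T\<^sub>\<phi>) l \<noteq> {0} \<Longrightarrow> l \<le> m"
      "\<And>k. real k \<le> 2 * m \<Longrightarrow> vec.dim (eigenspace (\<rho> T\<^sub>\<phi>) (m - real k)) = 1"
      unfolding principal_hodge_rep_def \<rho>_def by metis
    interpret principal_g2 \<gg> \<tt> \<rho> star h \<bb> \<sigma>1 \<sigma>2 T1 T2 T\<^sub>\<phi> "- of_int w / 2" m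
    proof
      show "star T\<^sub>\<phi> = T\<^sub>\<phi>" unfolding star_torus(1) [OF Et] E_mcnj by simp
    qed (fact m)+
    show "is_standard_rep \<gg> \<tt> \<bb> \<sigma>1 \<sigma>2 (differential \<pi>) \<and> T\<^sub>\<phi> = T1 + T2"
      using standard_if_principal by (simp add: is_standard_rep_def \<rho>_def)
  next
    assume "is_standard_rep \<gg> \<tt> \<bb> \<sigma>1 \<sigma>2 (differential \<pi>) \<and> T\<^sub>\<phi> = T1 + T2"
    then show "principal_hodge_rep \<pi> T\<^sub>\<phi>"
      unfolding principal_hodge_rep_def using principal_if_standard
      by (auto simp: is_standard_rep_def \<rho>_def)
  qed
qed

end
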